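(* Let $N^n\subset(M^m,c)$ be a conformal submanifold, with $m>n\ge1$, and if $m=2$ suppose $M$ has a M\"obius structure. Let $k=1-\frac n2$. The operator $$\mathcal L^{ind}:C^\infty(L_N^{1-n/2})\to C^\infty(L_N^{-1-n/2}),$$ $$\mathcal L^{ind}l:=\mathrm{tr}_{TN}\big(\overline{\mathrm{Hess}}^\nabla l\big)+k\,\mathrm{tr}_{TN}(h^\nabla)\,l+\frac{kn}2c(H^\nabla,H^\nabla)l,$$ where $\overline{\mathrm{Hess}}^\nabla(X,Y)l=\nabla_X\nabla_Yl-\nabla_{(\nabla_XY)^N}l$ for $X,Y\in TN$, is well-defined and is independent of the Weyl structure $\nabla$ on $M$.
   Context: All objects are smooth. On an $m$-manifold $M$, for $k\in\mathbb R$, $L^k$ is the oriented real line bundle associated with the frame bundle and the representation $|\det|^{k/m}$. A conformal structure $c$ is a positive-definite section of $S^2T^*M\otimes L^2$, normalized by $|\det c|=1$; equivalently it is the conformal class of metrics $l^{-2}c$, for $l$ a positive section of $L$. Via $c$, $T^*M\cong TM\otimes L^{-2}$; inner products and traces $\mathrm{tr}_c$ are taken with these weights. A Weyl structure $\nabla$ is a torsion-free connection on $TM$ with $\nabla c=0$ (with the induced connections on $L^k$). $F^\nabla\in\Lambda^2T^*M$ (Faraday form) is the curvature of the connection induced by $\nabla$ on $L$. Put $R^\nabla_{X,Y}Z=\nabla_X\nabla_YZ-\nabla_Y\nabla_XZ-\nabla_{[X,Y]}Z$, $\mathrm{Ric}^\nabla(X,Y)=\mathrm{tr}(Z\mapsto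 R^\nabla_{Z,X}Y)$, $\mathrm{Scal}^\nabla=\mathrm{tr}_c\mathrm{Ric}^\nabla$, and $\sigma^\nabla=\frac{1}{2(m-1)}\mathrm{Scal}^\nabla$. Schouten-Weyl tensor $h^\nabla\in T^*M\otimes T^*M$. For $m\ge3$: $h^\nabla=\frac1{m-2}\mathrm{Ric}^{\nabla,s}_0+\frac1m\sigma^\nabla c-\frac12F^\nabla$, where $\mathrm{Ric}^{\nabla,s}_0$ is the symmetric trace-free part of $\mathrm{Ric}^\nabla$. For sections $l$ of $L$, $\mathrm{Hess}^\nabla(X,Y)l=\nabla_X\nabla_Yl-\nabla_{\nabla_XY}l$, and $\mathrm{Hess}^\nabla_0$ is its symmetric trace-free part. A M\"obius structure is a linear second order differential operator $\mathcal M:C^\infty(L)\to C^\infty(S^2_0T^*M\otimes L)$ such that $\mathcal M-\mathrm{Hess}_0^\nabla$ is of order zero for some (hence every) Weyl structure $\nabla$. If $m=2$ and $\mathcal M$ is fixed: $h^\nabla=h_0^{\mathcal M,\nabla}+\frac12\sigma^\nabla c-\frac12F^\nabla$ with $h_0^{\mathcal M,\nabla}:=\mathcal M-\mathrm{Hess}^\nabla_0$. Submanifolds. $N^n\subset M^m$ carries the induced conformal structure $c$, and $L_N=L_M|_N$ is its weight bundle; $\nu$ is its normal bundle, $TM|_N=TN\oplus\nu$, with components denoted by $(\cdot)^N,(\cdot)^\perp$. The mean curvature of $N$ with respect to a Weyl structure $\nabla$ on $M$ is $H^\nabla\in\nu^*\cong\nu\otimes L^{-2}$, $H^\nabla(\xi)=-\frac1n\mathrm{tr}(X\mapsto(\nabla_X\xi)^N)$.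 Traces $\mathrm{tr}_{TN}$ are taken over $TN$ with respect to $c$. *)

theory Defs
  imports "HOL-Analysis.Analysis"
begin

section \<open>Smooth maps and smooth manifolds\<close>

fun Ck_on :: "nat \<Rightarrow> 'x::real_normed_vector set \<Rightarrow> ('x \<Rightarrow> 'y::real_normed_vector) \<Rightarrow> bool" where
  "Ck_on 0 S f = continuous_on S f"
| "Ck_on (Suc k) S f =
     ((\<forall>x\<in>S. f differentiable (at x)) \<and> (\<forall>v. Ck_on k S (\<lambda>x. frechet_derivative f (at x) v)))"

text \<open>Only used for open \<open>S\<close>.\<close>
definition smooth_on :: "'x::real_normed_vector set \<Rightarrow> ('x \<Rightarrow> 'y::real_normed_vector) \<Rightarrow> bool" where
  "smooth_on S f \<longleftrightarrow> (\<forall>k. Ck_on k S f)"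

text \<open>
  A chart is a pair of an open domain and a map; values of the map outside the domain are
  irrelevant.  The manifold \<open>M\<close> is the whole Hausdorff, second countable type \<open>'a\<close>, its dimension
  is \<open>CARD('m)\<close>.
\<close>
type_synonym ('a, 'm) chart = "'a set \<times> ('a \<Rightarrow> real ^ 'm)"
type_synonym ('a, 'm) vfield = "'a \<Rightarrow> real ^ 'm"
type_synonym ('a, 'm) conn = "('a, 'm) vfield \<Rightarrow> ('a, 'm) vfield \<Rightarrow> ('a, 'm) vfield"

definition is_chart :: "('a::topological_space, 'm::finite) chart \<Rightarrow> bool" where
  "is_chart ch \<longleftrightarrow> (case ch of (U, \<phi>) \<Rightarrow>
     open U \<and> open (\<phi> ` U) \<and> (\<exists>\<psi>. homeomorphism U (\<phi> ` U) \<phi> \<psi>))"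

definition compatible ::
    "('a::topological_space, 'm::finite) chart \<Rightarrow> ('a, 'm) chart \<Rightarrow> bool" where
  "compatible ch ch' \<longleftrightarrow> (case ch of (U, \<phi>) \<Rightarrow> case ch' of (V, \<psi>) \<Rightarrow>
     smooth_on (\<phi> ` (U \<inter> V)) (\<psi> \<circ> inv_into U \<phi>) \<and>
     smooth_on (\<psi> ` (U \<inter> V)) (\<phi> \<circ> inv_into V \<psi>))"

text \<open>A smooth structure is a maximal smooth atlas.\<close>
definition smooth_structure :: "('a::topological_space, 'm::finite) chart set \<Rightarrow> bool" where
  "smooth_structure A \<longleftrightarrow>
     (\<forall>ch\<in>A. is_chart ch) \<and> (\<Union>ch\<in>A. fst ch) = UNIV \<and>
     (\<forall>ch\<in>A. \<forall>ch'\<in>A. compatible ch ch') \<and>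
     (\<forall>ch. is_chart ch \<and> (\<forall>ch'\<in>A. compatible ch ch') \<longrightarrow> ch \<in> A)"


section \<open>Tangent bundle and weight bundles\<close>

text \<open>
  The tangent space \<open>T\<^sub>pM\<close> is modelled by \<open>real ^ 'm\<close>: a vector is given by its components in a
  chart \<open>pchart A p\<close> chosen once and for all at each point \<open>p\<close>.  The chosen chart varies
  wildly with \<open>p\<close>; smoothness is always tested after passing to the components in a fixed
  chart \<open>\<phi>\<close>, by means of the isomorphisms \<open>dchart A \<phi> q\<close> (the differential of \<open>\<phi>\<close> at \<open>q\<close>).
\<close>
definition pchart :: "('a, 'm) chart set \<Rightarrow> 'a \<Rightarrow> ('a, 'm) chart" where
  "pchart A p = (SOME ch. ch \<in> A \<and> p \<in> fst ch)"

abbreviation pdom :: "('a, 'm) chart set \<Rightarrow> 'a \<Rightarrow> 'a set" where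
  "pdom A p \<equiv> fst (pchart A p)"

abbreviation pmap :: "('a, 'm) chart set \<Rightarrow> 'a \<Rightarrow> 'a \<Rightarrow> real ^ 'm" where
  "pmap A p \<equiv> snd (pchart A p)"

definition dchart ::
    "('a, 'm::finite) chart set \<Rightarrow> ('a \<Rightarrow> real ^ 'm) \<Rightarrow> 'a \<Rightarrow> real ^ 'm \<Rightarrow> real ^ 'm" where
  "dchart A \<phi> q = frechet_derivative (\<phi> \<circ> inv_into (pdom A q) (pmap A q)) (at (pmap A q q))"

definition jac :: "('a, 'm::finite) chart set \<Rightarrow> ('a \<Rightarrow> real ^ 'm) \<Rightarrow> 'a \<Rightarrow> real" where
  "jac A \<phi> q = \<bar>det (matrix (dchart A \<phi> q))\<bar>"

text \<open>
  The fibre of \<open>L\<^sup>k\<close> at \<open>p\<close> is modelled by the reals: an element is an equivariant function \<open>f\<close> on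
  the frames of \<open>T\<^sub>pM\<close>, \<open>f(uA) = \<bar>det A\<bar>\<^sup>-\<^sup>k\<^sup>/\<^sup>m f(u)\<close>, identified with its value on the coordinate
  frame of \<open>pchart A p\<close>.  Its value on the coordinate frame of another chart \<open>\<phi>\<close> is therefore
  obtained by multiplication with \<open>jac A \<phi> p powr (k / m)\<close>.
\<close>
definition sec_coord ::
    "('a, 'm::finite) chart set \<Rightarrow> real \<Rightarrow> ('a \<Rightarrow> real ^ 'm) \<Rightarrow> ('a \<Rightarrow> real) \<Rightarrow> 'a \<Rightarrow> real" where
  "sec_coord A k \<phi> l q = jac A \<phi> q powr (k / real CARD('m)) * l q"

definition smooth_sec ::
    "('a, 'm::finite) chart set \<Rightarrow> real \<Rightarrow> 'a set \<Rightarrow> ('a \<Rightarrow> real) \<Rightarrow> bool" where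
  "smooth_sec A k W l \<longleftrightarrow> (\<forall>(U, \<phi>)\<in>A. smooth_on (\<phi> ` (U \<inter> W)) (sec_coord A k \<phi> l \<circ> inv_into U \<phi>))"

abbreviation smooth_fun :: "('a, 'm::finite) chart set \<Rightarrow> 'a set \<Rightarrow> ('a \<Rightarrow> real) \<Rightarrow> bool" where
  "smooth_fun A \<equiv> smooth_sec A 0"

definition vec_coord ::
    "('a, 'm::finite) chart set \<Rightarrow> ('a \<Rightarrow> real ^ 'm) \<Rightarrow> ('a, 'm) vfield \<Rightarrow> ('a, 'm) vfield" where
  "vec_coord A \<phi> X q = dchart A \<phi> q (X q)"

definition smooth_vf ::
    "('a, 'm::finite) chart set \<Rightarrow> 'a set \<Rightarrow> ('a, 'm) vfield \<Rightarrow> bool" where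
  "smooth_vf A W X \<longleftrightarrow> (\<forall>(U, \<phi>)\<in>A. smooth_on (\<phi> ` (U \<inter> W)) (vec_coord A \<phi> X \<circ> inv_into U \<phi>))"

text \<open>Smooth sections of \<open>T\<^sup>*M \<otimes> T\<^sup>*M \<otimes> L\<^sup>k\<close> over \<open>W\<close>.\<close>
definition smooth_bil ::
    "('a, 'm::finite) chart set \<Rightarrow> real \<Rightarrow> 'a set \<Rightarrow> ('a \<Rightarrow> real ^ 'm \<Rightarrow> real ^ 'm \<Rightarrow> real) \<Rightarrow> bool" where
  "smooth_bil A k W B \<longleftrightarrow> (\<forall>p\<in>W. bilinear (B p)) \<and>
     (\<forall>(U, \<phi>)\<in>A. \<forall>u v. smooth_on (\<phi> ` (U \<inter> W))
        (sec_coord A k \<phi> (\<lambda>q. B q (inv (dchart A \<phi> q) u) (inv (dchart A \<phi> q) v)) \<circ> inv_into U \<phi>))"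

text \<open>
  Derivative at \<open>p\<close> of a vector-valued function in the direction \<open>v \<in> T\<^sub>pM\<close>; recall that \<open>v\<close>
  consists of the components in the chart \<open>pchart A p\<close>.
\<close>
definition dirderiv ::
    "('a, 'm::finite) chart set \<Rightarrow> ('a \<Rightarrow> 'y::real_normed_vector) \<Rightarrow> 'a \<Rightarrow> real ^ 'm \<Rightarrow> 'y" where
  "dirderiv A f p v = frechet_derivative (f \<circ> inv_into (pdom A p) (pmap A p)) (at (pmap A p p)) v"

definition lie_bracket ::
    "('a, 'm::finite) chart set \<Rightarrow> ('a, 'm) vfield \<Rightarrow> ('a, 'm) vfield \<Rightarrow> ('a, 'm) vfield" where
  "lie_bracket A X Y p =
     dirderiv A (vec_coord A (pmap A p) Y) p (X p) - dirderiv A (vec_coord A (pmap A p) X) p (Y p)"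

text \<open>
  Extensions of a vector, resp. of the unit element of the fibre of \<open>L\<close> at \<open>p\<close>, with constant
  components in the chart \<open>pchart A p\<close>; they are smooth on its domain.
\<close>
definition cext :: "('a, 'm::finite) chart set \<Rightarrow> 'a \<Rightarrow> real ^ 'm \<Rightarrow> ('a, 'm) vfield" where
  "cext A p v q = inv (dchart A (pmap A p) q) v"

definition unit_sec :: "('a, 'm::finite) chart set \<Rightarrow> 'a \<Rightarrow> 'a \<Rightarrow> real" where
  "unit_sec A p q = jac A (pmap A p) q powr (- 1 / real CARD('m))"


section \<open>Connections\<close>

text \<open>
  A connection acts on vector fields defined over arbitrary open sets; such fields are represented
  by total functions that are smooth on \<open>W\<close>.  Linearity over smooth functions on \<open>W\<close>, applied to
  the indicator function of the complement of \<open>W\<close>, shows that \<open>D X Y\<close> on \<open>W\<close> depends only on \<open>X\<close>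
  and \<open>Y\<close> on \<open>W\<close>.
\<close>
definition connection :: "('a::topological_space, 'm::finite) chart set \<Rightarrow> ('a, 'm) conn \<Rightarrow> bool" where
  "connection A D \<longleftrightarrow> (\<forall>W X Y. open W \<and> smooth_vf A W X \<and> smooth_vf A W Y \<longrightarrow>
     smooth_vf A W (D X Y) \<and>
     (\<forall>Z. smooth_vf A W Z \<longrightarrow>
        (\<forall>p\<in>W. D (\<lambda>q. X q + Z q) Y p = D X Y p + D Z Y p \<and>
               D X (\<lambda>q. Y q + Z q) p = D X Y p + D X Z p)) \<and>
     (\<forall>f. smooth_fun A W f \<longrightarrow>
        (\<forall>p\<in>W. D (\<lambda>q. f q *\<^sub>R X q) Y p = f p *\<^sub>R D X Y p \<and>
               D X (\<lambda>q. f q *\<^sub>R Y q) p = f p *\<^sub>R D X Y p + dirderiv A f p (X p) *\<^sub>R Y p)))"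

text \<open>
  The connection induced on \<open>L\<^sup>k\<close>.  The differential of the representation \<open>\<bar>det\<bar>\<^sup>k\<^sup>/\<^sup>m\<close> is
  \<open>(k/m) trace\<close>, hence in a local frame with connection form \<open>\<omega>\<close> one has
  \<open>\<nabla>\<^sub>X l = X(l) + (k/m) trace (\<omega>(X)) l\<close>.  This is used in the coordinate frame of \<open>pchart A p\<close>.
  Only the value of \<open>X\<close> at \<open>p\<close> enters.
\<close>
definition nablaL ::
    "('a, 'm::finite) chart set \<Rightarrow> ('a, 'm) conn \<Rightarrow> real \<Rightarrow> ('a, 'm) vfield \<Rightarrow> ('a \<Rightarrow> real) \<Rightarrow> 'a \<Rightarrow> real" where
  "nablaL A D k X l p =
     dirderiv A (sec_coord A k (pmap A p) l) p (X p) +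
     k / real CARD('m) * trace (matrix (\<lambda>v. D (cext A p (X p)) (cext A p v) p)) * l p"

definition torsion_free :: "('a::topological_space, 'm::finite) chart set \<Rightarrow> ('a, 'm) conn \<Rightarrow> bool" where
  "torsion_free A D \<longleftrightarrow> (\<forall>W X Y. open W \<and> smooth_vf A W X \<and> smooth_vf A W Y \<longrightarrow>
     (\<forall>p\<in>W. D X Y p - D Y X p = lie_bracket A X Y p))"

definition riem ::
    "('a, 'm::finite) chart set \<Rightarrow> ('a, 'm) conn \<Rightarrow>
     ('a, 'm) vfield \<Rightarrow> ('a, 'm) vfield \<Rightarrow> ('a, 'm) vfield \<Rightarrow> ('a, 'm) vfield" where
  "riem A D X Y Z p = D X (D Y Z) p - D Y (D X Z) p - D (lie_bracket A X Y) Z p"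

definition ric ::
    "('a, 'm::finite) chart set \<Rightarrow> ('a, 'm) conn \<Rightarrow> 'a \<Rightarrow> real ^ 'm \<Rightarrow> real ^ 'm \<Rightarrow> real" where
  "ric A D p u v = trace (matrix (\<lambda>w. riem A D (cext A p w) (cext A p u) (cext A p v) p))"

text \<open>
  The curvature of \<open>L\<close> takes values in \<open>End L\<close>, i.e. in the reals; it is read off from its action on
  a section with value \<open>1\<close> at \<open>p\<close>.
\<close>
definition faraday ::
    "('a, 'm::finite) chart set \<Rightarrow> ('a, 'm) conn \<Rightarrow> 'a \<Rightarrow> real ^ 'm \<Rightarrow> real ^ 'm \<Rightarrow> real" where
  "faraday A D p u v = (let X = cext A p u; Y = cext A p v; l = unit_sec A p in
     nablaL A D 1 X (nablaL A D 1 Y l) p - nablaL A D 1 Y (nablaL A D 1 X l) p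
     - nablaL A D 1 (lie_bracket A X Y) l p)"


section \<open>Conformal geometry\<close>

text \<open>
  A trace with respect to \<open>c\<close> takes \<open>L\<^sup>k\<close>-valued bilinear forms to \<open>L\<^sup>k\<^sup>-\<^sup>2\<close>.  All fibres at \<open>p\<close> are
  trivialised by the same frame, so it is computed with a basis orthonormal for the real-valued
  form \<open>c p\<close>.
\<close>
definition orthonormal_basis_of ::
    "('v::real_vector \<Rightarrow> 'v \<Rightarrow> real) \<Rightarrow> 'v set \<Rightarrow> 'v set \<Rightarrow> bool" where
  "orthonormal_basis_of g V E \<longleftrightarrow> finite E \<and> E \<subseteq> V \<and> span E = V \<and>
     (\<forall>e\<in>E. \<forall>e'\<in>E. g e e' = (if e = e' then 1 else 0))"

definition trace_c ::
    "('v::real_vector \<Rightarrow> 'v \<Rightarrow> real) \<Rightarrow> 'v set \<Rightarrow> ('v \<Rightarrow> 'v \<Rightarrow> real) \<Rightarrow> real" where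
  "trace_c g V B = (\<Sum>e\<in>(SOME E. orthonormal_basis_of g V E). B e e)"

text \<open>The trace of an endomorphism of the linear subspace \<open>V\<close>.\<close>
definition lin_trace :: "'v::real_vector set \<Rightarrow> ('v \<Rightarrow> 'v) \<Rightarrow> real" where
  "lin_trace V f = (let E = (SOME E. independent E \<and> span E = V) in
     \<Sum>e\<in>E. real_vector.representation E (f e) e)"

text \<open>\<open>c p\<close> takes values in the fibre of \<open>L\<^sup>2\<close>; \<open>\<bar>det c\<bar>\<close> is then a real number.\<close>
definition conformal_structure ::
    "('a, 'm::finite) chart set \<Rightarrow> ('a \<Rightarrow> real ^ 'm \<Rightarrow> real ^ 'm \<Rightarrow> real) \<Rightarrow> bool" where
  "conformal_structure A c \<longleftrightarrow> smooth_bil A 2 UNIV c \<and>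
     (\<forall>p. (\<forall>u v. c p u v = c p v u) \<and> (\<forall>u. u \<noteq> 0 \<longrightarrow> c p u u > 0) \<and>
          \<bar>det (\<chi> i j. c p (axis i 1) (axis j 1))\<bar> = 1)"

definition weyl_structure ::
    "('a::topological_space, 'm::finite) chart set \<Rightarrow> ('a \<Rightarrow> real ^ 'm \<Rightarrow> real ^ 'm \<Rightarrow> real) \<Rightarrow>
     ('a, 'm) conn \<Rightarrow> bool" where
  "weyl_structure A c D \<longleftrightarrow> connection A D \<and> torsion_free A D \<and>
     (\<forall>W X Y Z. open W \<and> smooth_vf A W X \<and> smooth_vf A W Y \<and> smooth_vf A W Z \<longrightarrow>
        (\<forall>p\<in>W. nablaL A D 2 X (\<lambda>q. c q (Y q) (Z q)) p - c p (D X Y p) (Z p) - c p (Y p) (D X Z p) = 0))"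

definition sym_tracefree ::
    "(real ^ 'm::finite \<Rightarrow> real ^ 'm \<Rightarrow> real) \<Rightarrow> (real ^ 'm \<Rightarrow> real ^ 'm \<Rightarrow> real) \<Rightarrow>
     real ^ 'm \<Rightarrow> real ^ 'm \<Rightarrow> real" where
  "sym_tracefree g B u v = (B u v + B v u) / 2 - trace_c g UNIV B / real CARD('m) * g u v"

definition scal ::
    "('a, 'm::finite) chart set \<Rightarrow> ('a \<Rightarrow> real ^ 'm \<Rightarrow> real ^ 'm \<Rightarrow> real) \<Rightarrow> ('a, 'm) conn \<Rightarrow> 'a \<Rightarrow> real" where
  "scal A c D p = trace_c (c p) UNIV (ric A D p)"

definition sigma ::
    "('a, 'm::finite) chart set \<Rightarrow> ('a \<Rightarrow> real ^ 'm \<Rightarrow> real ^ 'm \<Rightarrow> real) \<Rightarrow> ('a, 'm) conn \<Rightarrow> 'a \<Rightarrow> real" where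
  "sigma A c D p = scal A c D p / (2 * (real CARD('m) - 1))"

text \<open>The Hessian on sections of \<open>L\<close>.\<close>
definition hess ::
    "('a, 'm::finite) chart set \<Rightarrow> ('a, 'm) conn \<Rightarrow> ('a \<Rightarrow> real) \<Rightarrow> 'a \<Rightarrow> real ^ 'm \<Rightarrow> real ^ 'm \<Rightarrow> real" where
  "hess A D l p u v = (let X = cext A p u; Y = cext A p v in
     nablaL A D 1 X (nablaL A D 1 Y l) p - nablaL A D 1 (D X Y) l p)"

definition hess0 ::
    "('a, 'm::finite) chart set \<Rightarrow> ('a \<Rightarrow> real ^ 'm \<Rightarrow> real ^ 'm \<Rightarrow> real) \<Rightarrow> ('a, 'm) conn \<Rightarrow>
     ('a \<Rightarrow> real) \<Rightarrow> 'a \<Rightarrow> real ^ 'm \<Rightarrow> real ^ 'm \<Rightarrow> real" where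
  "hess0 A c D l p = sym_tracefree (c p) (hess A D l p)"

text \<open>
  Differential operators are local, so a Moebius structure is given by its action on sections of
  \<open>L\<close> over open sets.  The difference to \<open>hess0\<close> is the action of a smooth section of
  \<open>T\<^sup>*M \<otimes> T\<^sup>*M = Hom(L, T\<^sup>*M \<otimes> T\<^sup>*M \<otimes> L)\<close>; in particular the operator is linear and of second order
  because \<open>hess0\<close> is.
\<close>
definition order_zero ::
    "('a::topological_space, 'm::finite) chart set \<Rightarrow>
     (('a \<Rightarrow> real) \<Rightarrow> 'a \<Rightarrow> real ^ 'm \<Rightarrow> real ^ 'm \<Rightarrow> real) \<Rightarrow> bool" where
  "order_zero A T \<longleftrightarrow> (\<exists>B. smooth_bil A 0 UNIV B \<and>
     (\<forall>W l. open W \<and> smooth_sec A 1 W l \<longrightarrow> (\<forall>p\<in>W. \<forall>u v. T l p u v = B p u v * l p)))"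

definition moebius_structure ::
    "('a::topological_space, 'm::finite) chart set \<Rightarrow> ('a \<Rightarrow> real ^ 'm \<Rightarrow> real ^ 'm \<Rightarrow> real) \<Rightarrow>
     (('a \<Rightarrow> real) \<Rightarrow> 'a \<Rightarrow> real ^ 'm \<Rightarrow> real ^ 'm \<Rightarrow> real) \<Rightarrow> bool" where
  "moebius_structure A c \<M> \<longleftrightarrow>
     (\<forall>W l. open W \<and> smooth_sec A 1 W l \<longrightarrow> smooth_bil A 1 W (\<M> l) \<and>
        (\<forall>p\<in>W. (\<forall>u v. \<M> l p u v = \<M> l p v u) \<and> trace_c (c p) UNIV (\<M> l p) = 0)) \<and>
     (\<exists>D. weyl_structure A c D \<and> order_zero A (\<lambda>l p u v. \<M> l p u v - hess0 A c D l p u v))"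

text \<open>\<open>\<M>\<close> is only used in dimension 2, where it is evaluated on a section with value 1 at \<open>p\<close>.\<close>
definition schouten ::
    "('a, 'm::finite) chart set \<Rightarrow> ('a \<Rightarrow> real ^ 'm \<Rightarrow> real ^ 'm \<Rightarrow> real) \<Rightarrow>
     (('a \<Rightarrow> real) \<Rightarrow> 'a \<Rightarrow> real ^ 'm \<Rightarrow> real ^ 'm \<Rightarrow> real) \<Rightarrow> ('a, 'm) conn \<Rightarrow>
     'a \<Rightarrow> real ^ 'm \<Rightarrow> real ^ 'm \<Rightarrow> real" where
  "schouten A c \<M> D p u v =
     (if CARD('m) = 2
      then \<M> (unit_sec A p) p u v - hess0 A c D (unit_sec A p) p u v
      else sym_tracefree (c p) (ric A D p) u v / (real CARD('m) - 2))
     + sigma A c D p / real CARD('m) * c p u v - faraday A D p u v / 2"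


section \<open>Submanifolds\<close>

definition slice_chart ::
    "('a::topological_space, 'm::finite) chart set \<Rightarrow> nat \<Rightarrow> 'a set \<Rightarrow> 'a set \<Rightarrow> ('a \<Rightarrow> real ^ 'm) \<Rightarrow> 'm set \<Rightarrow> bool" where
  "slice_chart A n N U \<phi> J \<longleftrightarrow> (U, \<phi>) \<in> A \<and> card J = n \<and>
     \<phi> ` (U \<inter> N) = \<phi> ` U \<inter> {y. \<forall>i. i \<notin> J \<longrightarrow> y $ i = 0}"

definition submanifold ::
    "('a::topological_space, 'm::finite) chart set \<Rightarrow> nat \<Rightarrow> 'a set \<Rightarrow> bool" where
  "submanifold A n N \<longleftrightarrow> (\<forall>p\<in>N. \<exists>U \<phi> J. slice_chart A n N U \<phi> J \<and> p \<in> U)"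

definition tangentN ::
    "('a::topological_space, 'm::finite) chart set \<Rightarrow> nat \<Rightarrow> 'a set \<Rightarrow> 'a \<Rightarrow> (real ^ 'm) set" where
  "tangentN A n N p = {v. \<exists>U \<phi> J. slice_chart A n N U \<phi> J \<and> p \<in> U \<and>
     (\<forall>i. i \<notin> J \<longrightarrow> dchart A \<phi> p v $ i = 0)}"

definition normalN ::
    "('a::topological_space, 'm::finite) chart set \<Rightarrow> ('a \<Rightarrow> real ^ 'm \<Rightarrow> real ^ 'm \<Rightarrow> real) \<Rightarrow>
     nat \<Rightarrow> 'a set \<Rightarrow> 'a \<Rightarrow> (real ^ 'm) set" where
  "normalN A c n N p = {w. \<forall>v\<in>tangentN A n N p. c p w v = 0}"

definition tan_proj ::
    "('a::topological_space, 'm::finite) chart set \<Rightarrow> ('a \<Rightarrow> real ^ 'm \<Rightarrow> real ^ 'm \<Rightarrow> real) \<Rightarrow>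
     nat \<Rightarrow> 'a set \<Rightarrow> 'a \<Rightarrow> real ^ 'm \<Rightarrow> real ^ 'm" where
  "tan_proj A c n N p w = (THE v. v \<in> tangentN A n N p \<and> w - v \<in> normalN A c n N p)"

text \<open>
  Sections of \<open>L\<^sub>N\<^sup>k\<close>, with \<open>L\<^sub>N\<close> the restriction of \<open>L\<^sub>M\<close> to \<open>N\<close>; values outside \<open>N\<close> are
  irrelevant.  Smoothness along \<open>N\<close> means local extendability to a smooth section on \<open>M\<close>.
\<close>
definition extends_sec ::
    "('a::topological_space, 'm::finite) chart set \<Rightarrow> real \<Rightarrow> 'a set \<Rightarrow> ('a \<Rightarrow> real) \<Rightarrow> 'a \<Rightarrow> ('a \<Rightarrow> real) \<Rightarrow> bool" where
  "extends_sec A k N l p l' \<longleftrightarrow>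
     (\<exists>W. open W \<and> p \<in> W \<and> smooth_sec A k W l' \<and> (\<forall>q\<in>W \<inter> N. l' q = l q))"

definition smooth_secN ::
    "('a::topological_space, 'm::finite) chart set \<Rightarrow> real \<Rightarrow> 'a set \<Rightarrow> ('a \<Rightarrow> real) \<Rightarrow> bool" where
  "smooth_secN A k N l \<longleftrightarrow> (\<forall>p\<in>N. \<exists>l'. extends_sec A k N l p l')"

text \<open>
  Vector fields of \<open>M\<close> near \<open>p\<close> that are tangent, resp. normal, to \<open>N\<close> at the points of \<open>N\<close>: the
  local extensions of sections of \<open>TN\<close>, resp. of the normal bundle.
\<close>
definition tangent_field ::
    "('a::topological_space, 'm::finite) chart set \<Rightarrow> nat \<Rightarrow> 'a set \<Rightarrow> 'a \<Rightarrow> ('a, 'm) vfield \<Rightarrow> bool" where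
  "tangent_field A n N p X \<longleftrightarrow>
     (\<exists>W. open W \<and> p \<in> W \<and> smooth_vf A W X \<and> (\<forall>q\<in>W \<inter> N. X q \<in> tangentN A n N q))"

definition normal_field ::
    "('a::topological_space, 'm::finite) chart set \<Rightarrow> ('a \<Rightarrow> real ^ 'm \<Rightarrow> real ^ 'm \<Rightarrow> real) \<Rightarrow>
     nat \<Rightarrow> 'a set \<Rightarrow> 'a \<Rightarrow> ('a, 'm) vfield \<Rightarrow> bool" where
  "normal_field A c n N p X \<longleftrightarrow>
     (\<exists>W. open W \<and> p \<in> W \<and> smooth_vf A W X \<and> (\<forall>q\<in>W \<inter> N. X q \<in> normalN A c n N q))"

text \<open>\<open>H(\<xi>) = -(1/n) trace (v \<mapsto> (\<nabla>\<^sub>v \<xi>)\<^sup>N)\<close> on \<open>TN\<close>, where \<open>\<xi>\<close> is extended to a normal field.\<close>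
definition mean_curv ::
    "('a::topological_space, 'm::finite) chart set \<Rightarrow> ('a \<Rightarrow> real ^ 'm \<Rightarrow> real ^ 'm \<Rightarrow> real) \<Rightarrow>
     nat \<Rightarrow> 'a set \<Rightarrow> ('a, 'm) conn \<Rightarrow> 'a \<Rightarrow> real ^ 'm \<Rightarrow> real" where
  "mean_curv A c n N D p \<xi> =
     (let \<Xi> = (SOME Z. normal_field A c n N p Z \<and> Z p = \<xi>) in
      - (1 / real n) * lin_trace (tangentN A n N p)
          (\<lambda>v. tan_proj A c n N p (D (cext A p v) \<Xi> p)))"

text \<open>\<open>c(H, H)\<close>: square norm on the dual of the normal space, with values in \<open>L\<^sup>-\<^sup>2\<close>.\<close>
definition mean_curv_sq ::
    "('a::topological_space, 'm::finite) chart set \<Rightarrow> ('a \<Rightarrow> real ^ 'm \<Rightarrow> real ^ 'm \<Rightarrow> real) \<Rightarrow>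
     nat \<Rightarrow> 'a set \<Rightarrow> ('a, 'm) conn \<Rightarrow> 'a \<Rightarrow> real" where
  "mean_curv_sq A c n N D p =
     trace_c (c p) (normalN A c n N p) (\<lambda>\<xi> \<eta>. mean_curv A c n N D p \<xi> * mean_curv A c n N D p \<eta>)"

text \<open>
  \<open>\<nabla>\<^sub>X \<nabla>\<^sub>Y l - \<nabla>\<^bsub>(\<nabla>\<^sub>X Y)\<^sup>N\<^esub> l\<close> at \<open>p\<close>, where \<open>X\<close>, \<open>Y\<close>, \<open>l\<close> are local extensions to \<open>M\<close> of sections of
  \<open>TN\<close>, \<open>TN\<close> and \<open>L\<^sub>N\<^sup>k\<close>.
\<close>
definition hess_bar_fields ::
    "('a::topological_space, 'm::finite) chart set \<Rightarrow> ('a \<Rightarrow> real ^ 'm \<Rightarrow> real ^ 'm \<Rightarrow> real) \<Rightarrow>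
     nat \<Rightarrow> 'a set \<Rightarrow> ('a, 'm) conn \<Rightarrow> real \<Rightarrow> ('a, 'm) vfield \<Rightarrow> ('a, 'm) vfield \<Rightarrow> ('a \<Rightarrow> real) \<Rightarrow> 'a \<Rightarrow> real" where
  "hess_bar_fields A c n N D k X Y l p =
     nablaL A D k X (nablaL A D k Y l) p
     - nablaL A D k (\<lambda>q. tan_proj A c n N q (D X Y q)) l p"

text \<open>
  The bilinear form on the tangent space of \<open>N\<close> at \<open>p\<close>, defined by choosing extensions;
  independence of these choices is part of the well-definedness to be proved.
\<close>
definition hess_bar ::
    "('a::topological_space, 'm::finite) chart set \<Rightarrow> ('a \<Rightarrow> real ^ 'm \<Rightarrow> real ^ 'm \<Rightarrow> real) \<Rightarrow>
     nat \<Rightarrow> 'a set \<Rightarrow> ('a, 'm) conn \<Rightarrow> real \<Rightarrow> ('a \<Rightarrow> real) \<Rightarrow> 'a \<Rightarrow> real ^ 'm \<Rightarrow> real ^ 'm \<Rightarrow> real" where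
  "hess_bar A c n N D k l p u v =
     hess_bar_fields A c n N D k
       (SOME X. tangent_field A n N p X \<and> X p = u)
       (SOME Y. tangent_field A n N p Y \<and> Y p = v)
       (SOME l'. extends_sec A k N l p l') p"

definition L_ind ::
    "('a::topological_space, 'm::finite) chart set \<Rightarrow> ('a \<Rightarrow> real ^ 'm \<Rightarrow> real ^ 'm \<Rightarrow> real) \<Rightarrow>
     (('a \<Rightarrow> real) \<Rightarrow> 'a \<Rightarrow> real ^ 'm \<Rightarrow> real ^ 'm \<Rightarrow> real) \<Rightarrow>
     nat \<Rightarrow> 'a set \<Rightarrow> ('a, 'm) conn \<Rightarrow> ('a \<Rightarrow> real) \<Rightarrow> 'a \<Rightarrow> real" where
  "L_ind A c \<M> n N D l p = (let k = 1 - real n / 2; T = tangentN A n N p in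
     trace_c (c p) T (hess_bar A c n N D k l p)
     + k * trace_c (c p) T (schouten A c \<M> D p) * l p
     + k * real n / 2 * mean_curv_sq A c n N D p * l p)"

end

theory Submission
  imports Defs
begin

text \<open>
  Everything is computed in one chart. For a coordinate field \<open>X\<^sub>0\<close> the weight 2 section
  \<open>\<rho> = c(X\<^sub>0, X\<^sub>0)\<close> trivialises all bundles \<open>L\<^sup>k\<close>: writing \<open>l = \<rho>\<^sup>k\<^sup>/\<^sup>2 f\<close>, the condition \<open>\<nabla>c = 0\<close>
  turns the connection on \<open>L\<^sup>k\<close> into \<open>\<nabla>\<^sub>X f = X f + k \<alpha>(X) f\<close> with a 1-form \<open>\<alpha>\<close>, without any
  derivative of a determinant. In this gauge the ingredients of the operator are explicit smooth
  expressions in the Christoffel symbols, the metric \<open>g = c / \<rho>\<close>, \<open>\<alpha>\<close> and a smooth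
  orthonormal frame of \<open>TN\<close> that is obtained by Gram-Schmidt in a slice chart.

  Two Weyl structures differ by a 1-form \<open>\<beta>\<close>:
  \<open>\<nabla>'\<^sub>X Y = \<nabla>\<^sub>X Y + \<beta>(X) Y + \<beta>(Y) X - g(X, Y) \<beta>\<^sup>#\<close>, whence
  \<open>h' = h - \<nabla>\<beta> + \<beta> \<otimes> \<beta> - (1/2) |\<beta>|\<^sup>2 g\<close> on the diagonal (the Faraday form is skew and does not
  contribute to traces) and \<open>H' = H - \<beta>\<^sup>\<bottom>\<close>. The first order terms of the trace of the Hessian change by
  \<open>(2 k - 2 + n) \<nabla>\<^sub>\<beta> l\<close>, which vanishes for \<open>k = 1 - n/2\<close>; the terms of order zero then cancel as well.
\<close>

section \<open>Calculus of smooth maps\<close>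

text \<open>The definitions work at each point \<open>p\<close> in the chart
  \<open>pchart A p\<close>, which varies with \<open>p\<close> without any regularity, and they
  pick bases, fields and extensions by \<open>SOME\<close>. Nothing is therefore visibly smooth or
  independent of choices, and every notion must be rewritten in one fixed chart before it can be
  computed with. For the weight bundles this is delicate because \<open>nablaL\<close> contains the
  trace of the connection form in the frame of \<open>pchart A p\<close>; the length of a coordinate
  field is useful because its covariant derivative is known from compatibility with
  \<open>c\<close>.

  Traces see only diagonal values, so Ricci, Schouten and Hessian terms are compared as quadratic
  forms. The frame of TN lives over the whole chart domain and not only along \<open>N\<close>:
  expressions at points of \<open>N\<close> thereby become smooth functions on open sets, which are
  the extensions that \<open>smooth_secN\<close> asks for. In dimension 2 the Schouten-Weyl tensor
  evaluates \<M> on a section that depends on the point; its smoothness is obtained by comparison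
  with the Weyl structure supplied by the definition of a Moebius structure.\<close>

abbreviation dd :: "('x::real_normed_vector \<Rightarrow> 'y::real_normed_vector) \<Rightarrow> 'x \<Rightarrow> 'x \<Rightarrow> 'y" where
  "dd f x \<equiv> frechet_derivative f (at x)"

lemma dd_eq: "(f has_derivative f') (at x) \<Longrightarrow> dd f x = f'"
  using frechet_derivative_at by metis

lemma dd_cong:
  assumes "open S" "x \<in> S" "\<And>y. y \<in> S \<Longrightarrow> f y = g y"
  shows "dd f x = dd g x"
proof -
  have "(f has_derivative f') (at x) \<longleftrightarrow> (g has_derivative f') (at x)" for f'
    using has_derivative_transform_within_open[of f f' x UNIV S g]
      has_derivative_transform_within_open[of g f' x UNIV S f] assms by auto
  then show ?thesis unfolding frechet_derivative_def by simp
qed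

lemma differentiable_cong_open:
  assumes "open S" "x \<in> S" "\<And>y. y \<in> S \<Longrightarrow> f y = g y" "f differentiable (at x)"
  shows "g differentiable (at x)"
  using assms has_derivative_transform_within_open[of f _ x UNIV S g]
  unfolding differentiable_def by blast

lemma Ck_on_cong:
  assumes "open S" "Ck_on k S f" "\<And>y. y \<in> S \<Longrightarrow> f y = g y"
  shows "Ck_on k S g"
  using assms(2,3)
proof (induction k arbitrary: f g)
  case 0
  then show ?case by (metis Ck_on.simps(1) continuous_on_cong)
next
  case (Suc k)
  have "\<forall>x\<in>S. g differentiable (at x)"
    using Suc.prems differentiable_cong_open[OF assms(1)] by (metis Ck_on.simps(2))
  moreover have "Ck_on k S (\<lambda>x. dd g x v)" for v
    using Suc.IH[of "\<lambda>x. dd f x v" "\<lambda>x. dd g x v"] Suc.prems dd_cong[OF assms(1), of _ f g]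
    by simp
  ultimately show ?case by simp
qed

lemma Ck_on_subset: "Ck_on k S f \<Longrightarrow> T \<subseteq> S \<Longrightarrow> Ck_on k T f"
  by (induction k arbitrary: f) (auto intro: continuous_on_subset)

text \<open>The recursion for \<open>Suc k\<close> does not mention order \<open>k\<close> of the
  map itself: at order 0 continuity comes from differentiability, and higher orders reduce to the
  directional derivatives.\<close>

lemma Ck_on_SucD: "Ck_on (Suc k) S f \<Longrightarrow> Ck_on k S f"
proof (induction k arbitrary: f)
  case 0
  then show ?case
    by (auto intro!: continuous_at_imp_continuous_on differentiable_imp_continuous_within)
next
  case (Suc k)
  then show ?case by (metis Ck_on.simps(2))
qed

lemma Ck_on_const: "Ck_on k S (\<lambda>x. a)"
  by (induction k arbitrary: a) auto

lemma Ck_on_add: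
  assumes "open S" "Ck_on k S f" "Ck_on k S g"
  shows "Ck_on k S (\<lambda>x. f x + g x)"
  using assms(2,3)
proof (induction k arbitrary: f g)
  case 0
  then show ?case by (auto intro: continuous_on_add)
next
  case (Suc k)
  have "Ck_on k S (\<lambda>x. dd (\<lambda>x. f x + g x) x v)" for v
  proof (rule Ck_on_cong[OF assms(1)])
    show "Ck_on k S (\<lambda>x. dd f x v + dd g x v)" using Suc by simp
    fix x assume "x \<in> S"
    then have "((\<lambda>x. f x + g x) has_derivative (\<lambda>h. dd f x h + dd g x h)) (at x)"
      using Suc.prems by (auto intro!: has_derivative_add simp: frechet_derivative_works[symmetric])
    from dd_eq[OF this] show "dd f x v + dd g x v = dd (\<lambda>x. f x + g x) x v" by simp
  qed
  then show ?case using Suc.prems by simp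
qed

text \<open>In the Leibniz rule each summand keeps one factor undifferentiated, which
  \<open>Ck_on_SucD\<close> lowers to order \<open>k\<close>. Products of reals and scaling of
  vectors are the instances used later.\<close>

lemma Ck_on_bilinear:
  assumes B: "bounded_bilinear B" and "open S" "Ck_on k S f" "Ck_on k S g"
  shows "Ck_on k S (\<lambda>x. B (f x) (g x))"
  using assms(3,4)
proof (induction k arbitrary: f g)
  case 0
  then show ?case using bounded_bilinear.continuous_on[OF B] by simp
next
  case (Suc k)
  have d: "((\<lambda>x. B (f x) (g x)) has_derivative (\<lambda>h. B (f x) (dd g x h) + B (dd f x h) (g x))) (at x)"
    if "x \<in> S" for x
    using bounded_bilinear.FDERIV[OF B, of f "dd f x" x UNIV g "dd g x"] Suc.prems that
    by (auto simp: frechet_derivative_works[symmetric])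
  have "Ck_on k S (\<lambda>x. dd (\<lambda>x. B (f x) (g x)) x v)" for v
  proof (rule Ck_on_cong[OF assms(2)])
    show "Ck_on k S (\<lambda>x. B (f x) (dd g x v) + B (dd f x v) (g x))"
      using Suc.prems Suc.prems[THEN Ck_on_SucD]
      by (intro Ck_on_add[OF assms(2)] Suc.IH) simp_all
    show "B (f x) (dd g x v) + B (dd f x v) (g x) = dd (\<lambda>x. B (f x) (g x)) x v" if "x \<in> S" for x
      using dd_eq[OF d[OF that]] by simp
  qed
  moreover have "\<forall>x\<in>S. (\<lambda>x. B (f x) (g x)) differentiable (at x)"
    using d unfolding differentiable_def by blast
  ultimately show ?case by simp
qed

lemma Ck_on_linear:
  assumes L: "bounded_linear L" and "open S" "Ck_on k S f"
  shows "Ck_on k S (\<lambda>x. L (f x))"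
  using assms(3)
proof (induction k arbitrary: f)
  case 0
  then show ?case using bounded_linear.continuous_on[OF L] by simp
next
  case (Suc k)
  have d: "((\<lambda>x. L (f x)) has_derivative (\<lambda>h. L (dd f x h))) (at x)" if "x \<in> S" for x
    using bounded_linear.has_derivative[OF L, of f "dd f x" "at x"] Suc.prems that
    by (auto simp: frechet_derivative_works[symmetric])
  have "Ck_on k S (\<lambda>x. dd (\<lambda>x. L (f x)) x v)" for v
  proof (rule Ck_on_cong[OF assms(2)])
    show "Ck_on k S (\<lambda>x. L (dd f x v))" using Suc by simp
    show "L (dd f x v) = dd (\<lambda>x. L (f x)) x v" if "x \<in> S" for x
      using dd_eq[OF d[OF that]] by simp
  qed
  moreover have "\<forall>x\<in>S. (\<lambda>x. L (f x)) differentiable (at x)"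
    using d unfolding differentiable_def by blast
  ultimately show ?case by simp
qed

lemma Ck_on_sum:
  assumes "open S" "\<And>i. i \<in> I \<Longrightarrow> Ck_on k S (f i)"
  shows "Ck_on k S (\<lambda>x. \<Sum>i\<in>I. f i x)"
  using assms(2)
proof (induction I rule: infinite_finite_induct)
  case (insert i I)
  then show ?case by (auto intro: Ck_on_add[OF assms(1)])
qed (auto intro: Ck_on_const)

text \<open>The exponent is generalised because differentiation lowers it. Real exponents let this
  one lemma serve for reciprocals, inverse square roots and powers of densities.\<close>

lemma Ck_on_powr:
  fixes f :: "'x::real_normed_vector \<Rightarrow> real"
  assumes "open S" "Ck_on k S f" "\<And>x. x \<in> S \<Longrightarrow> f x > 0"
  shows "Ck_on k S (\<lambda>x. f x powr a)"
  using assms(2)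
proof (induction k arbitrary: a)
  case 0
  then show ?case using assms(3)
    by (auto intro!: continuous_on_powr simp: less_imp_neq[THEN not_sym])
next
  case (Suc k)
  have d: "((\<lambda>x. f x powr a) has_derivative (\<lambda>h. (a * f x powr (a - 1)) * dd f x h)) (at x)"
    if "x \<in> S" for x
  proof -
    have "(f has_derivative dd f x) (at x)"
      using Suc.prems that by (auto simp: frechet_derivative_works[symmetric])
    from has_derivative_compose[OF this, of "\<lambda>z. z powr a" "\<lambda>h. (a * f x powr (a - 1)) * h"]
    show ?thesis using has_real_derivative_powr[OF assms(3)[OF that], of a]
      by (simp add: has_field_derivative_def)
  qed
  have "Ck_on k S (\<lambda>x. dd (\<lambda>x. f x powr a) x v)" for v
  proof (rule Ck_on_cong[OF assms(1)])
    show "Ck_on k S (\<lambda>x. a * f x powr (a - 1) * dd f x v)"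
      using Suc.prems Suc.IH[OF Suc.prems[THEN Ck_on_SucD], of "a - 1"]
      by (intro Ck_on_bilinear[OF bounded_bilinear_mult assms(1)] Ck_on_const) simp_all
    show "a * f x powr (a - 1) * dd f x v = dd (\<lambda>x. f x powr a) x v" if "x \<in> S" for x
      using dd_eq[OF d[OF that]] by simp
  qed
  moreover have "\<forall>x\<in>S. (\<lambda>x. f x powr a) differentiable (at x)"
    using d unfolding differentiable_def by blast
  ultimately show ?case by simp
qed

lemma dd_expand:
  fixes f :: "'x::euclidean_space \<Rightarrow> 'y::real_normed_vector"
  assumes "f differentiable (at x)"
  shows "dd f x v = (\<Sum>b\<in>Basis. (v \<bullet> b) *\<^sub>R dd f x b)"
proof -
  have "linear (dd f x)" using linear_frechet_derivative[OF assms] .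
  then have "dd f x (\<Sum>b\<in>Basis. (v \<bullet> b) *\<^sub>R b) = (\<Sum>b\<in>Basis. (v \<bullet> b) *\<^sub>R dd f x b)"
    by (simp add: linear_sum linear_scale)
  then show ?thesis by (simp add: euclidean_representation)
qed

text \<open>The direction \<open>dd g x v\<close> varies with \<open>x\<close>, whereas
  \<open>Ck_on\<close> differentiates in fixed directions. Expansion in \<open>Basis\<close> leaves
  products of \<open>dd g x v \<bullet> b\<close> with compositions \<open>dd f (g x) b\<close>, to
  which the induction hypothesis applies.\<close>

lemma Ck_on_compose:
  fixes f :: "'x::euclidean_space \<Rightarrow> 'y::real_normed_vector"
    and g :: "'z::real_normed_vector \<Rightarrow> 'x"
  assumes "open S" "open T" "Ck_on k T g" "Ck_on k S f" "g ` T \<subseteq> S"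
  shows "Ck_on k T (\<lambda>x. f (g x))"
  using assms(3,4)
proof (induction k arbitrary: f)
  case 0
  then show ?case using assms(5)
    by (auto intro: continuous_on_compose2)
next
  case (Suc k)
  have d: "((\<lambda>x. f (g x)) has_derivative (\<lambda>h. dd f (g x) (dd g x h))) (at x)" if "x \<in> T" for x
    using has_derivative_compose[of g "dd g x" x UNIV f "dd f (g x)"] Suc.prems that assms(5)
    by (auto simp: frechet_derivative_works[symmetric])
  have "Ck_on k T (\<lambda>x. dd (\<lambda>x. f (g x)) x v)" for v
  proof (rule Ck_on_cong[OF assms(2)])
    show "Ck_on k T (\<lambda>x. \<Sum>b\<in>Basis. (dd g x v \<bullet> b) *\<^sub>R dd f (g x) b)"
    proof (intro Ck_on_sum[OF assms(2)] Ck_on_bilinear[OF bounded_bilinear_scaleR assms(2)])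
      fix b :: 'x assume "b \<in> Basis"
      show "Ck_on k T (\<lambda>x. dd g x v \<bullet> b)"
        using Suc.prems by (intro Ck_on_linear[OF bounded_linear_inner_left assms(2)]) simp
      show "Ck_on k T (\<lambda>x. dd f (g x) b)"
        using Suc.IH[of "\<lambda>x. dd f x b"] Suc.prems(2) Ck_on_SucD[OF Suc.prems(1)] by simp
    qed
    show "(\<Sum>b\<in>Basis. (dd g x v \<bullet> b) *\<^sub>R dd f (g x) b) = dd (\<lambda>x. f (g x)) x v" if "x \<in> T" for x
    proof -
      have "f differentiable (at (g x))" using Suc.prems that assms(5) by auto
      then show ?thesis using dd_eq[OF d[OF that]] dd_expand[of f "g x" "dd g x v"] by simp
    qed
  qed
  moreover have "\<forall>x\<in>T. (\<lambda>x. f (g x)) differentiable (at x)"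
    using d unfolding differentiable_def by blast
  ultimately show ?case by simp
qed

section \<open>Smooth maps: closure properties and rules of differentiation\<close>

lemma smooth_on_cong:
  assumes "open S" "smooth_on S f" "\<And>y. y \<in> S \<Longrightarrow> f y = g y"
  shows "smooth_on S g"
  using assms Ck_on_cong unfolding smooth_on_def by metis

lemma smooth_on_subset: "smooth_on S f \<Longrightarrow> T \<subseteq> S \<Longrightarrow> smooth_on T f"
  using Ck_on_subset unfolding smooth_on_def by blast

lemma smooth_on_const: "smooth_on S (\<lambda>x. a)"
  using Ck_on_const unfolding smooth_on_def by blast

lemma smooth_on_add: "open S \<Longrightarrow> smooth_on S f \<Longrightarrow> smooth_on S g \<Longrightarrow> smooth_on S (\<lambda>x. f x + g x)"
  using Ck_on_add unfolding smooth_on_def by blast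

lemma smooth_on_bilinear:
  "bounded_bilinear B \<Longrightarrow> open S \<Longrightarrow> smooth_on S f \<Longrightarrow> smooth_on S g \<Longrightarrow> smooth_on S (\<lambda>x. B (f x) (g x))"
  using Ck_on_bilinear unfolding smooth_on_def by blast

lemmas smooth_on_mult = smooth_on_bilinear[OF bounded_bilinear_mult]
  and smooth_on_scaleR = smooth_on_bilinear[OF bounded_bilinear_scaleR]

lemma smooth_on_linear:
  "bounded_linear L \<Longrightarrow> open S \<Longrightarrow> smooth_on S f \<Longrightarrow> smooth_on S (\<lambda>x. L (f x))"
  using Ck_on_linear unfolding smooth_on_def by blast

lemma smooth_on_diff: "open S \<Longrightarrow> smooth_on S f \<Longrightarrow> smooth_on S g \<Longrightarrow> smooth_on S (\<lambda>x. f x - g x)"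
  using smooth_on_add[of S f "\<lambda>x. - g x"] smooth_on_linear[OF bounded_linear_minus[OF bounded_linear_ident], of S g]
  by simp

lemma smooth_on_inner:
  "open S \<Longrightarrow> smooth_on S f \<Longrightarrow> smooth_on S (\<lambda>x. f x \<bullet> b)"
  by (rule smooth_on_linear[OF bounded_linear_inner_left])

lemma smooth_on_nth:
  fixes f :: "'x::real_normed_vector \<Rightarrow> real^'m"
  shows "open S \<Longrightarrow> smooth_on S f \<Longrightarrow> smooth_on S (\<lambda>x. f x $ i)"
  by (rule smooth_on_linear[OF bounded_linear_vec_nth])

lemma smooth_on_sum:
  "open S \<Longrightarrow> (\<And>i. i \<in> I \<Longrightarrow> smooth_on S (f i)) \<Longrightarrow> smooth_on S (\<lambda>x. \<Sum>i\<in>I. f i x)"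
  unfolding smooth_on_def by (simp add: Ck_on_sum)

lemma smooth_on_powr:
  fixes f :: "'x::real_normed_vector \<Rightarrow> real"
  shows "open S \<Longrightarrow> smooth_on S f \<Longrightarrow> (\<And>x. x \<in> S \<Longrightarrow> f x > 0) \<Longrightarrow> smooth_on S (\<lambda>x. f x powr a)"
  unfolding smooth_on_def by (simp add: Ck_on_powr)

lemma smooth_on_compose:
  fixes f :: "'x::euclidean_space \<Rightarrow> 'y::real_normed_vector"
  shows "open S \<Longrightarrow> open T \<Longrightarrow> smooth_on T g \<Longrightarrow> smooth_on S f \<Longrightarrow> g ` T \<subseteq> S \<Longrightarrow> smooth_on T (\<lambda>x. f (g x))"
  using Ck_on_compose unfolding smooth_on_def by blast

lemma smooth_on_differentiable: "smooth_on S f \<Longrightarrow> x \<in> S \<Longrightarrow> f differentiable (at x)"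
  unfolding smooth_on_def by (metis Ck_on.simps(2))

lemma smooth_on_has_derivative: "smooth_on S f \<Longrightarrow> x \<in> S \<Longrightarrow> (f has_derivative dd f x) (at x)"
  using smooth_on_differentiable frechet_derivative_works by blast

lemma smooth_on_linear_dd: "smooth_on S f \<Longrightarrow> x \<in> S \<Longrightarrow> linear (dd f x)"
  using smooth_on_differentiable linear_frechet_derivative by blast

lemma smooth_on_continuous: "smooth_on S f \<Longrightarrow> continuous_on S f"
  unfolding smooth_on_def by (metis Ck_on.simps(1))

lemma smooth_on_dd_const: "smooth_on S f \<Longrightarrow> smooth_on S (\<lambda>x. dd f x v)"
  unfolding smooth_on_def by (metis Ck_on.simps(2))

lemma smooth_on_dd:
  fixes f :: "'x::euclidean_space \<Rightarrow> 'y::real_normed_vector"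
  assumes "open S" "smooth_on S f" "smooth_on S X"
  shows "smooth_on S (\<lambda>x. dd f x (X x))"
proof (rule smooth_on_cong[OF assms(1)])
  show "smooth_on S (\<lambda>x. \<Sum>b\<in>Basis. (X x \<bullet> b) *\<^sub>R dd f x b)"
    by (intro smooth_on_sum smooth_on_scaleR smooth_on_inner smooth_on_dd_const assms)
qed (metis dd_expand smooth_on_differentiable assms(2))

lemma smooth_on_linear_family:
  fixes L :: "'z::real_normed_vector \<Rightarrow> 'x::euclidean_space \<Rightarrow> 'y::real_normed_vector"
  assumes "open S" "\<And>y. y \<in> S \<Longrightarrow> linear (L y)" "\<And>a. smooth_on S (\<lambda>y. L y a)" "smooth_on S X"
  shows "smooth_on S (\<lambda>y. L y (X y))"
proof (rule smooth_on_cong[OF assms(1)])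
  show "smooth_on S (\<lambda>y. \<Sum>b\<in>Basis. (X y \<bullet> b) *\<^sub>R L y b)"
    by (intro smooth_on_sum smooth_on_scaleR smooth_on_inner assms)
  show "(\<Sum>b\<in>Basis. (X y \<bullet> b) *\<^sub>R L y b) = L y (X y)" if "y \<in> S" for y
  proof -
    have "L y (\<Sum>b\<in>Basis. (X y \<bullet> b) *\<^sub>R b) = (\<Sum>b\<in>Basis. (X y \<bullet> b) *\<^sub>R L y b)"
      using assms(2)[OF that] by (simp add: linear_sum linear_scale)
    then show ?thesis by (simp add: euclidean_representation)
  qed
qed

lemma smooth_on_bilinear_family:
  fixes B :: "'z::real_normed_vector \<Rightarrow> 'x::euclidean_space \<Rightarrow> 'x \<Rightarrow> 'y::real_normed_vector"
  assumes "open S" "\<And>y. y \<in> S \<Longrightarrow> bilinear (B y)" "\<And>a b. smooth_on S (\<lambda>y. B y a b)"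
    "smooth_on S X" "smooth_on S Y"
  shows "smooth_on S (\<lambda>y. B y (X y) (Y y))"
proof (rule smooth_on_linear_family[OF assms(1) _ _ assms(5)])
  show "linear (B y (X y))" if "y \<in> S" for y using assms(2)[OF that] unfolding bilinear_def by blast
  show "smooth_on S (\<lambda>y. B y (X y) a)" for a
    by (rule smooth_on_linear_family[where L="\<lambda>y v. B y v a", OF assms(1) _ _ assms(4)])
      (use assms(2,3) in \<open>auto simp: bilinear_def\<close>)
qed

text \<open>The derivative of the coefficients is expressed with the argument frozen at
  \<open>X x\<close>. For Christoffel symbols this is the form in which their derivatives enter the
  curvature.\<close>

lemma dd_linear_family:
  fixes L :: "'z::real_normed_vector \<Rightarrow> 'x::euclidean_space \<Rightarrow> 'y::real_normed_vector"
  assumes "open S" "\<And>y. y \<in> S \<Longrightarrow> linear (L y)" "\<And>a. smooth_on S (\<lambda>y. L y a)" "smooth_on S X"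
    and x: "x \<in> S"
  shows "dd (\<lambda>y. L y (X y)) x v = dd (\<lambda>y. L y (X x)) x v + L x (dd X x v)"
proof -
  have rep: "L y a = (\<Sum>b\<in>Basis. (a \<bullet> b) *\<^sub>R L y b)" if "y \<in> S" for y a
  proof -
    have "L y (\<Sum>b\<in>Basis. (a \<bullet> b) *\<^sub>R b) = (\<Sum>b\<in>Basis. (a \<bullet> b) *\<^sub>R L y b)"
      using assms(2)[OF that] by (simp add: linear_sum linear_scale)
    then show ?thesis by (simp add: euclidean_representation)
  qed
  have D: "((\<lambda>y. \<Sum>b\<in>Basis. (Z y \<bullet> b) *\<^sub>R L y b) has_derivative
      (\<lambda>h. \<Sum>b\<in>Basis. (Z x \<bullet> b) *\<^sub>R dd (\<lambda>y. L y b) x h + (dd Z x h \<bullet> b) *\<^sub>R L x b)) (at x)"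
    if "smooth_on S Z" for Z :: "'z \<Rightarrow> 'x"
    by (intro has_derivative_sum has_derivative_scaleR
      bounded_linear.has_derivative[OF bounded_linear_inner_left]
      smooth_on_has_derivative[OF that x] smooth_on_has_derivative[OF assms(3) x])
  have e: "dd (\<lambda>y. L y (Z y)) x v =
      (\<Sum>b\<in>Basis. (Z x \<bullet> b) *\<^sub>R dd (\<lambda>y. L y b) x v + (dd Z x v \<bullet> b) *\<^sub>R L x b)"
    if "smooth_on S Z" for Z :: "'z \<Rightarrow> 'x"
    using dd_cong[OF assms(1) x, of "\<lambda>y. L y (Z y)" "\<lambda>y. \<Sum>b\<in>Basis. (Z y \<bullet> b) *\<^sub>R L y b"] rep
      dd_eq[OF D[OF that]] by simp
  have "dd (\<lambda>y. L y (X x)) x v = (\<Sum>b\<in>Basis. (X x \<bullet> b) *\<^sub>R dd (\<lambda>y. L y b) x v)"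
    using e[OF smooth_on_const, of "X x"] by simp
  moreover have "L x (dd X x v) = (\<Sum>b\<in>Basis. (dd X x v \<bullet> b) *\<^sub>R L x b)"
    by (rule rep[OF x])
  ultimately show ?thesis using e[OF assms(4)] by (simp add: sum.distrib)
qed

lemma dd_bilinear_family:
  fixes B :: "'z::real_normed_vector \<Rightarrow> 'x::euclidean_space \<Rightarrow> 'x \<Rightarrow> 'y::real_normed_vector"
  assumes "open S" "\<And>y. y \<in> S \<Longrightarrow> bilinear (B y)" "\<And>a b. smooth_on S (\<lambda>y. B y a b)"
    "smooth_on S X" "smooth_on S Y" and x: "x \<in> S"
  shows "dd (\<lambda>y. B y (X y) (Y y)) x v =
    dd (\<lambda>y. B y (X x) (Y x)) x v + B x (dd X x v) (Y x) + B x (X x) (dd Y x v)"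
proof -
  have lin: "linear (\<lambda>a. B y a b)" "linear (B y a)" if "y \<in> S" for y a b
    using assms(2)[OF that] unfolding bilinear_def by auto
  have "dd (\<lambda>y. B y (X y) (Y y)) x v = dd (\<lambda>y. B y (X x) (Y y)) x v + B x (dd X x v) (Y x)"
    by (rule dd_linear_family[where L="\<lambda>y a. B y a (Y y)", OF assms(1) _ _ assms(4) x])
      (auto intro: lin smooth_on_linear_family[OF assms(1) _ _ assms(5)] assms(3))
  also have "dd (\<lambda>y. B y (X x) (Y y)) x v = dd (\<lambda>y. B y (X x) (Y x)) x v + B x (X x) (dd Y x v)"
    by (rule dd_linear_family[where L="\<lambda>y. B y (X x)", OF assms(1) _ _ assms(5) x])
      (auto intro: lin assms(3))
  finally show ?thesis by simp
qed

lemma linear_dd_family: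
  fixes L :: "'z::real_normed_vector \<Rightarrow> 'x::euclidean_space \<Rightarrow> 'y::real_normed_vector"
  assumes "open S" "\<And>y. y \<in> S \<Longrightarrow> linear (L y)" "\<And>a. smooth_on S (\<lambda>y. L y a)" and x: "x \<in> S"
  shows "linear (\<lambda>a. dd (\<lambda>y. L y a) x v)"
proof (rule linearI)
  fix a b :: 'x and r :: real
  have "((\<lambda>y. L y a + L y b) has_derivative (\<lambda>h. dd (\<lambda>y. L y a) x h + dd (\<lambda>y. L y b) x h)) (at x)"
    by (intro has_derivative_add smooth_on_has_derivative[OF assms(3) x])
  from dd_eq[OF this]
  show "dd (\<lambda>y. L y (a + b)) x v = dd (\<lambda>y. L y a) x v + dd (\<lambda>y. L y b) x v"
    using dd_cong[OF assms(1) x, of "\<lambda>y. L y (a + b)" "\<lambda>y. L y a + L y b"] linear_add[OF assms(2)]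
    by simp
  have "((\<lambda>y. r *\<^sub>R L y a) has_derivative (\<lambda>h. r *\<^sub>R dd (\<lambda>y. L y a) x h)) (at x)"
    by (intro has_derivative_scaleR_right smooth_on_has_derivative[OF assms(3) x])
  from dd_eq[OF this]
  show "dd (\<lambda>y. L y (r *\<^sub>R a)) x v = r *\<^sub>R dd (\<lambda>y. L y a) x v"
    using dd_cong[OF assms(1) x, of "\<lambda>y. L y (r *\<^sub>R a)" "\<lambda>y. r *\<^sub>R L y a"] linear_scale[OF assms(2)]
    by simp
qed

lemma dd_add:
  "smooth_on S f \<Longrightarrow> smooth_on S g \<Longrightarrow> x \<in> S \<Longrightarrow> dd (\<lambda>y. f y + g y) x v = dd f x v + dd g x v"
  using dd_eq[OF has_derivative_add[OF smooth_on_has_derivative smooth_on_has_derivative]] by metis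

lemma dd_diff:
  "smooth_on S f \<Longrightarrow> smooth_on S g \<Longrightarrow> x \<in> S \<Longrightarrow> dd (\<lambda>y. f y - g y) x v = dd f x v - dd g x v"
  using dd_eq[OF has_derivative_diff[OF smooth_on_has_derivative smooth_on_has_derivative]] by metis

lemma dd_mult:
  fixes f g :: "'x::real_normed_vector \<Rightarrow> real"
  assumes "smooth_on S f" "smooth_on S g" "x \<in> S"
  shows "dd (\<lambda>y. f y * g y) x v = f x * dd g x v + dd f x v * g x"
  using dd_eq[OF has_derivative_mult[OF smooth_on_has_derivative[OF assms(1,3)] smooth_on_has_derivative[OF assms(2,3)]]]
  by simp

lemma dd_cmult:
  fixes f :: "'x::real_normed_vector \<Rightarrow> real"
  assumes "smooth_on S f" "x \<in> S"
  shows "dd (\<lambda>y. r * f y) x v = r * dd f x v"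
  using dd_mult[OF smooth_on_const assms, of r v] by simp

lemma dd_linear_comp:
  assumes "bounded_linear L" "smooth_on S f" "x \<in> S"
  shows "dd (\<lambda>y. L (f y)) x v = L (dd f x v)"
  using dd_eq[OF bounded_linear.has_derivative[OF assms(1) smooth_on_has_derivative[OF assms(2,3)]]]
  by metis

lemma dd_compose:
  assumes "f differentiable (at (g x))" "g differentiable (at x)"
  shows "dd (\<lambda>y. f (g y)) x v = dd f (g x) (dd g x v)"
  using dd_eq[OF has_derivative_compose[OF assms(2,1)[unfolded frechet_derivative_works]]] by metis

section \<open>Symmetry of second derivatives\<close>

text \<open>The second difference over the parallelogram spanned by \<open>t *\<^sub>R u\<close> and
  \<open>t *\<^sub>R v\<close> is symmetric in \<open>u\<close> and \<open>v\<close>. The mean value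
  theorem along \<open>u\<close> and then along \<open>v\<close> expresses it by a single mixed
  derivative.\<close>

lemma second_derivative_mvt:
  fixes f :: "'x::real_normed_vector \<Rightarrow> real"
  assumes S: "open S" and f: "smooth_on S f" and t: "t > 0"
    and box: "\<And>r s. 0 \<le> r \<Longrightarrow> r \<le> t \<Longrightarrow> 0 \<le> s \<Longrightarrow> s \<le> t \<Longrightarrow> x + r *\<^sub>R u + s *\<^sub>R v \<in> S"
  shows "\<exists>r s. 0 \<le> r \<and> r \<le> t \<and> 0 \<le> s \<and> s \<le> t \<and>
    f (x + t *\<^sub>R u + t *\<^sub>R v) - f (x + t *\<^sub>R u) - f (x + t *\<^sub>R v) + f x
      = t * t * dd (\<lambda>y. dd f y u) (x + r *\<^sub>R u + s *\<^sub>R v) v"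
proof -
  define G where "G r = f (x + r *\<^sub>R u + t *\<^sub>R v) - f (x + r *\<^sub>R u)" for r
  have line: "((\<lambda>r. h (p + r *\<^sub>R w)) has_real_derivative dd h (p + r *\<^sub>R w) w) (at r)"
    if "smooth_on S h" "p + r *\<^sub>R w \<in> S" for h :: "'x \<Rightarrow> real" and p w r
  proof -
    have "((\<lambda>r. p + r *\<^sub>R w) has_derivative (\<lambda>k. k *\<^sub>R w)) (at r)"
      by (auto intro!: derivative_eq_intros)
    note has_derivative_compose[OF this smooth_on_has_derivative[OF that]]
    moreover have "(\<lambda>k. dd h (p + r *\<^sub>R w) (k *\<^sub>R w)) = (*) (dd h (p + r *\<^sub>R w) w)"
      by (rule ext) (simp add: linear_scale[OF smooth_on_linear_dd[OF that]])
    ultimately show ?thesis unfolding has_field_derivative_def by simp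
  qed
  have G': "(G has_real_derivative
      (dd f (x + r *\<^sub>R u + t *\<^sub>R v) u - dd f (x + r *\<^sub>R u) u)) (at r)" if "0 \<le> r" "r \<le> t" for r
    unfolding G_def
    using line[OF f, of "x + t *\<^sub>R v" r u] line[OF f, of x r u] box[OF that, of t] box[OF that, of 0] t
    by (intro DERIV_diff) (auto simp: algebra_simps)
  have "\<exists>r>0. r < t \<and> G t - G 0 = (t - 0) * (dd f (x + r *\<^sub>R u + t *\<^sub>R v) u - dd f (x + r *\<^sub>R u) u)"
    by (rule MVT2[OF t]) (rule G')
  then obtain r where r: "0 < r" "r < t"
      "G t - G 0 = (t - 0) * (dd f (x + r *\<^sub>R u + t *\<^sub>R v) u - dd f (x + r *\<^sub>R u) u)"
    by auto
  have H': "((\<lambda>s. dd f (x + r *\<^sub>R u + s *\<^sub>R v) u) has_real_derivative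
      dd (\<lambda>y. dd f y u) (x + r *\<^sub>R u + s *\<^sub>R v) v) (at s)" if "0 \<le> s" "s \<le> t" for s
    using line[OF smooth_on_dd_const[OF f], of "x + r *\<^sub>R u" s v u] box[of r s] r that by auto
  have "\<exists>s>0. s < t \<and> dd f (x + r *\<^sub>R u + t *\<^sub>R v) u - dd f (x + r *\<^sub>R u + 0 *\<^sub>R v) u
        = (t - 0) * dd (\<lambda>y. dd f y u) (x + r *\<^sub>R u + s *\<^sub>R v) v"
    by (rule MVT2[OF t]) (rule H')
  then obtain s where s: "0 < s" "s < t"
      "dd f (x + r *\<^sub>R u + t *\<^sub>R v) u - dd f (x + r *\<^sub>R u) u
        = t * dd (\<lambda>y. dd f y u) (x + r *\<^sub>R u + s *\<^sub>R v) v"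
    by auto
  have "f (x + t *\<^sub>R u + t *\<^sub>R v) - f (x + t *\<^sub>R u) - f (x + t *\<^sub>R v) + f x = G t - G 0"
    unfolding G_def by simp
  also have "\<dots> = t * t * dd (\<lambda>y. dd f y u) (x + r *\<^sub>R u + s *\<^sub>R v) v"
    using r(3) s(3) by simp
  finally show ?thesis using r(1,2) s(1,2) by (metis less_imp_le)
qed

text \<open>If the mixed derivatives differed at \<open>x\<close>, continuity would keep their
  values apart on a ball; but a small parallelogram in that ball evaluates the same second
  difference by both of them.\<close>

lemma second_derivative_symmetric_real:
  fixes f :: "'x::real_normed_vector \<Rightarrow> real"
  assumes S: "open S" and f: "smooth_on S f" and x: "x \<in> S"
  shows "dd (\<lambda>y. dd f y u) x v = dd (\<lambda>y. dd f y v) x u"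
proof (rule ccontr)
  define P where "P y = dd (\<lambda>y. dd f y u) y v" for y
  define Q where "Q y = dd (\<lambda>y. dd f y v) y u" for y
  assume "\<not> ?thesis"
  then have ne: "\<bar>P x - Q x\<bar> > 0" unfolding P_def Q_def by simp
  let ?e = "\<bar>P x - Q x\<bar> / 2"
  have "continuous_on S P" "continuous_on S Q" unfolding P_def Q_def
    by (intro smooth_on_continuous smooth_on_dd_const f)+
  then have "isCont P x" "isCont Q x" using S x continuous_on_eq_continuous_at by blast+
  then obtain d1 d2 where d1: "d1 > 0" "\<And>y. dist y x < d1 \<Longrightarrow> dist (P y) (P x) < ?e"
    and d2: "d2 > 0" "\<And>y. dist y x < d2 \<Longrightarrow> dist (Q y) (Q x) < ?e"
    unfolding continuous_at_eps_delta using ne by (metis half_gt_zero)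
  obtain d3 where d3: "d3 > 0" "ball x d3 \<subseteq> S" using S x openE by blast
  define d where "d = min d1 (min d2 d3)"
  have d: "d > 0" using d1 d2 d3 by (simp add: d_def)
  \<comment> \<open>This side length keeps the parallelogram inside the ball of radius
    \<open>d\<close>; the summand 1 covers the case that both directions vanish.\<close>
  define t where "t = d / (2 * (norm u + norm v + 1))"
  have t: "t > 0" unfolding t_def using d by (simp add: add_nonneg_pos)
  have tb: "t * (norm u + norm v) < d"
  proof -
    have "t * (2 * (norm u + norm v + 1)) = d"
      unfolding t_def using add_nonneg_pos[of "norm u + norm v" 1] by (simp del: mult_2)
    then have "2 * (t * (norm u + norm v)) = d - 2 * t" by (simp add: algebra_simps)
    moreover have "t * (norm u + norm v) \<ge> 0" using t by simp
    ultimately show ?thesis using t by linarith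
  qed
  have nb: "dist (x + (r *\<^sub>R u + s *\<^sub>R v)) x < d" if "0 \<le> r" "r \<le> t" "0 \<le> s" "s \<le> t" for r s
  proof -
    have "norm (r *\<^sub>R u + s *\<^sub>R v) \<le> r * norm u + s * norm v"
      using norm_triangle_ineq[of "r *\<^sub>R u" "s *\<^sub>R v"] that by simp
    also have "\<dots> \<le> t * norm u + t * norm v"
      by (intro add_mono mult_right_mono that) auto
    finally show ?thesis using tb by (simp add: dist_norm algebra_simps)
  qed
  have inS: "x + (r *\<^sub>R u + s *\<^sub>R v) \<in> S" if "0 \<le> r" "r \<le> t" "0 \<le> s" "s \<le> t" for r s
    using nb[OF that] d3(2) by (auto simp: d_def dist_commute)
  have inS1: "x + r *\<^sub>R u + s *\<^sub>R v \<in> S" and inS2: "x + r *\<^sub>R v + s *\<^sub>R u \<in> S"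
    if "0 \<le> r" "r \<le> t" "0 \<le> s" "s \<le> t" for r s
    using inS[of r s] inS[of s r] that by (simp_all add: algebra_simps)
  obtain r s where 1: "0 \<le> r" "r \<le> t" "0 \<le> s" "s \<le> t"
    "f (x + t *\<^sub>R u + t *\<^sub>R v) - f (x + t *\<^sub>R u) - f (x + t *\<^sub>R v) + f x = t * t * P (x + r *\<^sub>R u + s *\<^sub>R v)"
    using second_derivative_mvt[OF S f t inS1] unfolding P_def by blast
  obtain r' s' where 2: "0 \<le> r'" "r' \<le> t" "0 \<le> s'" "s' \<le> t"
    "f (x + t *\<^sub>R v + t *\<^sub>R u) - f (x + t *\<^sub>R v) - f (x + t *\<^sub>R u) + f x = t * t * Q (x + r' *\<^sub>R v + s' *\<^sub>R u)"
    using second_derivative_mvt[OF S f t inS2] unfolding Q_def by blast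
  have "t * t * P (x + r *\<^sub>R u + s *\<^sub>R v) = t * t * Q (x + r' *\<^sub>R v + s' *\<^sub>R u)"
    using 1(5) 2(5) by (simp add: algebra_simps)
  then have eq: "P (x + (r *\<^sub>R u + s *\<^sub>R v)) = Q (x + (s' *\<^sub>R u + r' *\<^sub>R v))"
    using t by (simp add: algebra_simps)
  have "dist (P (x + (r *\<^sub>R u + s *\<^sub>R v))) (P x) < ?e" "dist (Q (x + (s' *\<^sub>R u + r' *\<^sub>R v))) (Q x) < ?e"
    using d1(2) d2(2) nb 1 2 by (auto simp: d_def)
  moreover have "\<bar>P x - Q x\<bar> \<le> \<bar>a - P x\<bar> + \<bar>a - Q x\<bar>" for a by arith
  ultimately show False unfolding eq dist_real_def
    by (smt (verit) field_sum_of_halves)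
qed

lemma second_derivative_symmetric:
  fixes f :: "'x::real_normed_vector \<Rightarrow> 'y::euclidean_space"
  assumes S: "open S" and f: "smooth_on S f" and x: "x \<in> S"
  shows "dd (\<lambda>y. dd f y u) x v = dd (\<lambda>y. dd f y v) x u"
proof (rule euclidean_eqI)
  fix b :: 'y
  have "dd (\<lambda>y. dd f y w) x z \<bullet> b = dd (\<lambda>y. dd (\<lambda>y. f y \<bullet> b) y w) x z" for w z
  proof -
    have "dd (\<lambda>y. dd f y w) x z \<bullet> b = dd (\<lambda>y. dd f y w \<bullet> b) x z"
      by (rule dd_linear_comp[OF bounded_linear_inner_left smooth_on_dd_const[OF f] x, symmetric])
    also have "\<dots> = dd (\<lambda>y. dd (\<lambda>y. f y \<bullet> b) y w) x z"
    proof (rule fun_cong[OF dd_cong[OF S x]])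
      show "dd f y w \<bullet> b = dd (\<lambda>y. f y \<bullet> b) y w" if "y \<in> S" for y
        by (rule dd_linear_comp[OF bounded_linear_inner_left f that, symmetric])
    qed
    finally show ?thesis .
  qed
  then show "dd (\<lambda>y. dd f y u) x v \<bullet> b = dd (\<lambda>y. dd f y v) x u \<bullet> b"
    using second_derivative_symmetric_real[OF S smooth_on_inner[OF S f] x] by simp
qed

section \<open>Orthonormal bases and traces\<close>

lemmas linear_simps = linear_add linear_scale
  and bilinear_simps = bilinear_ladd bilinear_radd bilinear_lmul bilinear_rmul

definition inner_form :: "('v::real_vector \<Rightarrow> 'v \<Rightarrow> real) \<Rightarrow> bool" where
  "inner_form g \<longleftrightarrow> bilinear g \<and> (\<forall>u v. g u v = g v u) \<and> (\<forall>u. u \<noteq> 0 \<longrightarrow> g u u > 0)"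

lemma inner_formD:
  assumes "inner_form g"
  shows "bilinear g" "g u v = g v u" "u \<noteq> 0 \<Longrightarrow> g u u > 0" "linear (g u)" "linear (\<lambda>u. g u v)"
proof -
  show "bilinear g" using assms by (simp add: inner_form_def)
  show "g u v = g v u" using assms unfolding inner_form_def by blast
  show "u \<noteq> 0 \<Longrightarrow> g u u > 0" using assms unfolding inner_form_def by blast
  from \<open>bilinear g\<close> show "linear (g u)" "linear (\<lambda>u. g u v)" by (simp_all add: bilinear_def)
qed

lemma inner_form_sum:
  assumes "inner_form g"
  shows "g (\<Sum>i\<in>I. a i *\<^sub>R x i) v = (\<Sum>i\<in>I. a i * g (x i) v)"
    "g v (\<Sum>i\<in>I. a i *\<^sub>R x i) = (\<Sum>i\<in>I. a i * g v (x i))"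
proof -
  show "g v (\<Sum>i\<in>I. a i *\<^sub>R x i) = (\<Sum>i\<in>I. a i * g v (x i))"
    using linear_sum[OF inner_formD(4)[OF assms, of v], of "\<lambda>i. a i *\<^sub>R x i" I]
      linear_scale[OF inner_formD(4)[OF assms]] by (simp add: o_def)
  show "g (\<Sum>i\<in>I. a i *\<^sub>R x i) v = (\<Sum>i\<in>I. a i * g (x i) v)"
    using linear_sum[OF inner_formD(5)[OF assms, of v], of "\<lambda>i. a i *\<^sub>R x i" I]
      linear_scale[OF inner_formD(5)[OF assms]] by (simp add: o_def)
qed

lemma inner_form_eqI:
  assumes "inner_form g" "\<And>z. g a z = g b z"
  shows "a = b"
proof (rule ccontr)
  assume "a \<noteq> b"
  then have "g (a - b) (a - b) > 0" using inner_formD(3)[OF assms(1)] by simp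
  then show False using linear_diff[OF inner_formD(5)[OF assms(1)]] assms(2) by (metis diff_self less_irrefl)
qed

abbreviation "onb \<equiv> orthonormal_basis_of"

lemma onb_coeff:
  assumes "onb g V E" "inner_form g" "e \<in> E"
  shows "g (\<Sum>e'\<in>E. a e' *\<^sub>R e') e = a e"
proof -
  have "g (\<Sum>e'\<in>E. a e' *\<^sub>R e') e = (\<Sum>e'\<in>E. a e' * g e' e)"
    by (rule inner_form_sum(1)[OF assms(2)])
  also have "\<dots> = (\<Sum>e'\<in>E. if e' = e then a e' else 0)"
    using assms unfolding orthonormal_basis_of_def by (intro sum.cong) auto
  finally show ?thesis using assms(1,3) by (simp add: orthonormal_basis_of_def)
qed

lemma onb_expand:
  assumes E: "onb g V E" and g: "inner_form g" and v: "v \<in> V"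
  shows "v = (\<Sum>e\<in>E. g v e *\<^sub>R e)"
proof -
  have "v \<in> span E" "finite E" using E v unfolding orthonormal_basis_of_def by auto
  then obtain a where a: "v = (\<Sum>e\<in>E. a e *\<^sub>R e)" by (auto simp: span_finite)
  show ?thesis using onb_coeff[OF E g, of _ a] a by (simp cong: sum.cong)
qed

lemma onb_parseval:
  assumes E: "onb g V E" and g: "inner_form g" and v: "v \<in> V"
  shows "g v w = (\<Sum>e\<in>E. g v e * g e w)"
  using inner_form_sum(1)[OF g, of "g v" "\<lambda>e. e" E w] onb_expand[OF E g v] by simp

lemma onb_linear_expand:
  assumes E: "onb g V E" and g: "inner_form g" and v: "v \<in> V" and L: "linear L"
  shows "L v = (\<Sum>e\<in>E. g v e *\<^sub>R L e)"
  using linear_sum[OF L, of "\<lambda>e. g v e *\<^sub>R e" E] linear_scale[OF L] onb_expand[OF E g v]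
  by (simp add: o_def)

lemma onb_norm: "onb g V E \<Longrightarrow> e \<in> E \<Longrightarrow> g e e = 1"
  unfolding orthonormal_basis_of_def by simp

lemma onb_in: "onb g V E \<Longrightarrow> e \<in> E \<Longrightarrow> e \<in> V"
  unfolding orthonormal_basis_of_def by auto

lemma onb_finite: "onb g V E \<Longrightarrow> finite E"
  unfolding orthonormal_basis_of_def by auto

lemma onb_independent:
  assumes E: "onb g V E" and g: "inner_form g"
  shows "independent E"
proof (rule independent_if_scalars_zero[OF onb_finite[OF E]])
  fix a x assume "(\<Sum>x\<in>E. a x *\<^sub>R x) = 0" "x \<in> E"
  then show "a x = 0" using onb_coeff[OF E g, of x a] linear_0[OF inner_formD(5)[OF g]] by simp
qed

lemma onb_card:
  assumes "onb g V E" "inner_form g"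
  shows "card E = dim V"
  using onb_independent[OF assms] assms(1) unfolding orthonormal_basis_of_def
  by (metis dim_span_eq_card_independent)

lemma span_insert_span: "span (insert a (span S)) = span (insert a S)"
  unfolding span_insert span_span ..

text \<open>Shared by the pointwise existence of orthonormal bases and by the smooth frames; for the
  latter the new basis vector has to be explicit.\<close>

lemma gram_schmidt_step:
  assumes E: "onb g V E" and g: "inner_form g" and a: "a \<notin> V"
    and w: "w = a - (\<Sum>e\<in>E. g a e *\<^sub>R e)"
  shows "g w w > 0" "e \<in> E \<Longrightarrow> g w e = 0" "w /\<^sub>R sqrt (g w w) \<notin> E"
    "onb g (span (insert a V)) (insert (w /\<^sub>R sqrt (g w w)) E)"
proof -
  have span: "span E = V" and fin: "finite E" using E unfolding orthonormal_basis_of_def by auto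
  let ?s = "\<Sum>e\<in>E. g a e *\<^sub>R e"
  have s: "?s \<in> V" unfolding span[symmetric] by (intro span_sum span_scale span_base)
  have "w \<noteq> 0" using a s w by auto
  then show pos: "g w w > 0" by (rule inner_formD(3)[OF g])
  show orth: "g w e = 0" if "e \<in> E" for e
    using onb_coeff[OF E g that, of "g a"] linear_diff[OF inner_formD(5)[OF g]] w by simp
  define w' where "w' = w /\<^sub>R sqrt (g w w)"
  have gw: "g w' x = g w x / sqrt (g w w)" "g x w' = g w x / sqrt (g w w)" for x
    using linear_scale[OF inner_formD(5)[OF g]] inner_formD(2)[OF g, of x w'] unfolding w'_def
    by (simp_all add: divide_inverse mult.commute)
  have w'w': "g w' w' = 1" unfolding gw using pos by simp
  \<comment> \<open>A unit vector orthogonal to all of \<open>E\<close> cannot belong to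
    \<open>E\<close>.\<close>
  show nin: "w /\<^sub>R sqrt (g w w) \<notin> E"
    using orth gw[of w'] w'w' by (metis divide_eq_0_iff w'_def zero_neq_one)
  have "span (insert a V) = span (insert w' E)"
  proof -
    have "span (insert a V) = span (insert a E)"
      unfolding span[symmetric] by (rule span_insert_span)
    moreover have "insert a E \<subseteq> span (insert w' E)"
    proof -
      have "a = sqrt (g w w) *\<^sub>R w' + ?s" using pos w by (simp add: w'_def)
      moreover have "?s \<in> span (insert w' E)"
        by (intro span_sum span_scale span_base) auto
      ultimately have "a \<in> span (insert w' E)"
        by (metis insertI1 span_add span_base span_scale)
      then show ?thesis by (auto intro: span_base)
    qed
    moreover have "insert w' E \<subseteq> span (insert a E)"
    proof -
      have "?s \<in> span (insert a E)" by (intro span_sum span_scale span_base) auto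
      then have "w' \<in> span (insert a E)" unfolding w'_def w
        by (intro span_scale span_diff) (auto intro: span_base)
      then show ?thesis by (auto intro: span_base)
    qed
    ultimately show ?thesis by (metis span_eq)
  qed
  then show "onb g (span (insert a V)) (insert (w /\<^sub>R sqrt (g w w)) E)"
    using E w'w' orth gw nin fin unfolding orthonormal_basis_of_def w'_def[symmetric]
    by (auto simp: span_base)
qed

lemma onb_exists_span:
  assumes g: "inner_form g" and "finite S"
  shows "\<exists>E. onb g (span S) E"
  using assms(2)
proof (induction S rule: finite_induct)
  case empty
  show ?case by (rule exI[of _ "{}"]) (auto simp: orthonormal_basis_of_def)
next
  case (insert a S)
  then obtain E where E: "onb g (span S) E" by blast
  have eq: "span (insert a (span S)) = span (insert a S)"
    by (rule span_insert_span)
  show ?case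
  proof (cases "a \<in> span S")
    case True
    then show ?thesis using E by (metis span_redundant)
  next
    case False
    from gram_schmidt_step(4)[OF E g this refl] show ?thesis unfolding eq by blast
  qed
qed

lemma onb_exists:
  fixes g :: "'v::euclidean_space \<Rightarrow> 'v \<Rightarrow> real"
  assumes g: "inner_form g" and "subspace V"
  shows "\<exists>E. onb g V E"
proof -
  obtain S where "S \<subseteq> V" "independent S" "V \<subseteq> span S" "card S = dim V"
    using basis_exists[of V] by blast
  then have "span S = V" "finite S"
    using assms(2) by (auto simp: span_minimal subset_antisym independent_imp_finite)
  then show ?thesis using onb_exists_span[OF g, of S] by auto
qed

section \<open>Traces and their independence of bases\<close>

text \<open>Expanding each element of \<open>E'\<close> in \<open>E\<close> produces coefficients
  whose sum over \<open>E'\<close> is \<open>g e f\<close> by Parseval for \<open>E'\<close>. This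
  disposes of the choice by \<open>SOME\<close> in \<open>trace_c\<close>.\<close>

lemma onb_sum_eq:
  assumes E: "onb g V E" and E': "onb g V E'" and g: "inner_form g"
    and B: "bilinear B"
  shows "(\<Sum>e\<in>E'. B e e) = (\<Sum>e\<in>E. B e e :: real)"
proof -
  have lin: "linear (B u)" "linear (\<lambda>u. B u v)" for u v using B unfolding bilinear_def by auto
  have "(\<Sum>e'\<in>E'. B e' e') = (\<Sum>e'\<in>E'. \<Sum>e\<in>E. \<Sum>f\<in>E. g e' e * g e' f * B e f)"
  proof (rule sum.cong[OF refl])
    fix e' assume "e' \<in> E'"
    then have v: "e' \<in> V" using onb_in[OF E'] by blast
    have "B e' e' = (\<Sum>e\<in>E. g e' e * B e e')"
      using onb_linear_expand[OF E g v lin(2)] by simp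
    also have "\<dots> = (\<Sum>e\<in>E. g e' e * (\<Sum>f\<in>E. g e' f * B e f))"
      using onb_linear_expand[OF E g v lin(1)] by simp
    finally show "B e' e' = (\<Sum>e\<in>E. \<Sum>f\<in>E. g e' e * g e' f * B e f)"
      by (simp add: sum_distrib_left mult.assoc)
  qed
  also have "\<dots> = (\<Sum>e\<in>E. \<Sum>e'\<in>E'. \<Sum>f\<in>E. g e' e * g e' f * B e f)"
    by (rule sum.swap)
  also have "\<dots> = (\<Sum>e\<in>E. \<Sum>f\<in>E. \<Sum>e'\<in>E'. g e' e * g e' f * B e f)"
    by (intro sum.cong refl sum.swap)
  also have "\<dots> = (\<Sum>e\<in>E. \<Sum>f\<in>E. (\<Sum>e'\<in>E'. g e e' * g e' f) * B e f)"
    unfolding sum_distrib_right by (intro sum.cong refl) (metis inner_formD(2)[OF g])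
  also have "\<dots> = (\<Sum>e\<in>E. \<Sum>f\<in>E. g e f * B e f)"
    using onb_parseval[OF E' g] onb_in[OF E] by (simp cong: sum.cong)
  also have "\<dots> = (\<Sum>e\<in>E. \<Sum>f\<in>E. if e = f then B e f else 0)"
    using E unfolding orthonormal_basis_of_def by (intro sum.cong refl) auto
  finally show ?thesis using onb_finite[OF E] by simp
qed

text \<open>Agreement with a bilinear form is asked on the diagonal of \<open>V\<close> only. This
  suits \<open>schouten\<close>, which is computed on the diagonal, and \<open>hess_bar\<close>,
  which is controlled on tangent vectors.\<close>

lemma trace_c_onb:
  assumes E: "onb g V E" and g: "inner_form g"
    and B: "bilinear B'" "\<And>u. u \<in> V \<Longrightarrow> B u u = B' u u"
  shows "trace_c g V B = (\<Sum>e\<in>E. B e e)"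
proof -
  have E': "onb g V (SOME E. onb g V E)"
    using E by (rule someI)
  show ?thesis unfolding trace_c_def
    using onb_sum_eq[OF E E' g B(1)] B(2) onb_in[OF E] onb_in[OF E'] by (simp cong: sum.cong)
qed

lemma onb_image:
  assumes E: "onb g V E" and g: "inner_form g" and K: "linear K" "inj K"
    and c: "\<And>a b. c (K a) (K b) = r * g a b" and r: "r > 0"
  shows "onb c (K ` V) ((\<lambda>e. K (e /\<^sub>R sqrt r)) ` E)"
    and "inj_on (\<lambda>e. K (e /\<^sub>R sqrt r)) E"
proof -
  have sr: "sqrt r \<noteq> 0" using r by simp
  have K': "K (e /\<^sub>R sqrt r) = K e /\<^sub>R sqrt r" for e using linear_scale[OF K(1)] by simp
  have i: "inj (\<lambda>e. K (e /\<^sub>R sqrt r))"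
    using injD[OF K(2)] sr by (intro injI) fastforce
  then show "inj_on (\<lambda>e. K (e /\<^sub>R sqrt r)) E" by (rule inj_on_subset) simp
  have sub: "(\<lambda>e. K (e /\<^sub>R sqrt r)) ` E \<subseteq> K ` V"
    using E unfolding orthonormal_basis_of_def by (auto intro!: imageI span_scale simp: span_base)
  have "K ` V \<subseteq> span ((\<lambda>e. K (e /\<^sub>R sqrt r)) ` E)"
  proof -
    have "K e \<in> span ((\<lambda>e. K (e /\<^sub>R sqrt r)) ` E)" if "e \<in> E" for e
    proof -
      have "K e = sqrt r *\<^sub>R K (e /\<^sub>R sqrt r)" using sr K' by simp
      then show ?thesis using that by (metis image_eqI span_base span_scale)
    qed
    then have "span (K ` E) \<subseteq> span ((\<lambda>e. K (e /\<^sub>R sqrt r)) ` E)"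
      by (intro span_minimal) auto
    then show ?thesis using E K(1) unfolding orthonormal_basis_of_def
      by (auto simp: linear_span_image)
  qed
  moreover have "subspace (K ` V)" using E K(1) unfolding orthonormal_basis_of_def
    by (metis linear_subspace_image subspace_span)
  ultimately have "span ((\<lambda>e. K (e /\<^sub>R sqrt r)) ` E) = K ` V"
    using sub span_minimal by blast
  moreover have "c (K (e /\<^sub>R sqrt r)) (K (e' /\<^sub>R sqrt r)) = g e e'" for e e'
    using r linear_scale[OF inner_formD(4)[OF g]] linear_scale[OF inner_formD(5)[OF g]]
    unfolding c by (simp add: field_simps)
  moreover have "K (e /\<^sub>R sqrt r) = K (e' /\<^sub>R sqrt r) \<longleftrightarrow> e = e'" for e e'
    using i by (auto simp: inj_def)
  ultimately show "onb c (K ` V) ((\<lambda>e. K (e /\<^sub>R sqrt r)) ` E)"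
    using E sub unfolding orthonormal_basis_of_def by auto
qed

text \<open>The form pulled back by \<open>K\<close> is \<open>r\<close> times \<open>g\<close>, so
  unit vectors are divided by \<open>sqrt r\<close> and the trace by \<open>r\<close>. This factor
  is the weight -2 of a conformal trace.\<close>

lemma trace_c_transport:
  assumes E: "onb g V E" and g: "inner_form g"
    and K: "linear K" "linear K'" "\<And>a. K' (K a) = a"
    and c: "inner_form c" "\<And>a b. c (K a) (K b) = r * g a b" and r: "r > 0"
    and B: "bilinear B'" "\<And>u. u \<in> V \<Longrightarrow> B (K u) (K u) = B' u u"
  shows "trace_c c (K ` V) B = (\<Sum>e\<in>E. B' e e) / r"
proof -
  let ?F = "(\<lambda>e. K (e /\<^sub>R sqrt r)) ` E"
  have inj: "inj K" by (metis K(3) injI)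
  note im = onb_image[OF E g K(1) inj c(2) r]
  have sub: "e /\<^sub>R sqrt r \<in> V" if "e \<in> E" for e
    using E that unfolding orthonormal_basis_of_def by (metis span_base span_scale)
  have bil: "bilinear (\<lambda>u v. B' (K' u) (K' v))"
    using B(1) linear_compose[OF K(2)] unfolding bilinear_def by (auto simp: o_def)
  have "trace_c c (K ` V) B = (\<Sum>e\<in>?F. B e e)"
    by (rule trace_c_onb[OF im(1) c(1) bil]) (auto simp: B(2) K(3))
  also have "\<dots> = (\<Sum>e\<in>E. B (K (e /\<^sub>R sqrt r)) (K (e /\<^sub>R sqrt r)))"
    by (rule sum.reindex_cong[OF im(2) refl refl])
  also have "\<dots> = (\<Sum>e\<in>E. B' e e / r)"
    using r sub B(2)
    by (intro sum.cong refl) (simp add: bilinear_lmul[OF B(1)] bilinear_rmul[OF B(1)] divide_simps)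
  finally show ?thesis by (simp add: sum_divide_distrib)
qed

text \<open>The basis behind \<open>lin_trace\<close> is arbitrary. Both traces equal the double sum
  of \<open>g (f b) e\<close> times the coefficient of \<open>e\<close> at \<open>b\<close>, summed
  in either order.\<close>

lemma lin_trace_onb:
  assumes E: "onb g V E" and g: "inner_form g"
    and f: "linear f'" "\<And>v. v \<in> V \<Longrightarrow> f v = f' v" "\<And>v. v \<in> V \<Longrightarrow> f v \<in> V"
  shows "lin_trace V f = (\<Sum>e\<in>E. g (f e) e)"
proof -
  define F where "F = (SOME E. independent E \<and> span E = V)"
  have VE: "span E = V" using E unfolding orthonormal_basis_of_def by simp
  have ex: "\<exists>E. independent E \<and> span E = V" using onb_independent[OF E g] VE by blast
  have F: "independent F" "span F = V"
    using someI_ex[OF ex] unfolding F_def by auto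
  have "F \<subseteq> span E" using F(2) VE by (metis span_superset)
  then have fin: "finite F" using independent_span_bound[OF onb_finite[OF E] F(1)] by blast
  let ?r = "representation F"
  have sub: "V = span F" using F by simp
  have eV: "e \<in> span F" if "e \<in> E" for e using onb_in[OF E that] sub by simp
  have bV: "b \<in> V" if "b \<in> F" for b using that F(2) by (metis span_base)
  have rf: "?r (f b) b = (\<Sum>e\<in>E. g (f b) e * ?r e b)" if b: "b \<in> F" for b
  proof -
    have "?r (f b) = ?r (\<Sum>e\<in>E. g (f b) e *\<^sub>R e)"
      using onb_expand[OF E g f(3)[OF bV[OF b]]] by simp
    also have "\<dots> = (\<lambda>b'. \<Sum>e\<in>E. ?r (g (f b) e *\<^sub>R e) b')"
      using eV by (intro representation_sum[OF F(1)] span_scale) auto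
    finally show ?thesis using eV by (simp add: representation_sum[OF F(1)] representation_scale[OF F(1)] span_scale cong: sum.cong)
  qed
  have fe: "g (f e) e = (\<Sum>b\<in>F. ?r e b * g (f b) e)" if e: "e \<in> E" for e
  proof -
    have "f e = f' (\<Sum>b\<in>F. ?r e b *\<^sub>R b)"
      using sum_representation_eq[OF F(1) eV[OF e] fin] f(2)[OF onb_in[OF E e]] by simp
    also have "\<dots> = (\<Sum>b\<in>F. ?r e b *\<^sub>R f b)"
      using f(2)[OF bV] by (simp add: linear_sum[OF f(1)] linear_scale[OF f(1)])
    finally show ?thesis by (simp add: inner_form_sum(1)[OF g])
  qed
  have "lin_trace V f = (\<Sum>b\<in>F. ?r (f b) b)"
    unfolding lin_trace_def F_def[symmetric] by simp
  also have "\<dots> = (\<Sum>b\<in>F. \<Sum>e\<in>E. g (f b) e * ?r e b)" using rf by simp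
  also have "\<dots> = (\<Sum>e\<in>E. \<Sum>b\<in>F. ?r e b * g (f b) e)"
    by (subst sum.swap) (simp add: mult.commute)
  finally show ?thesis using fe by simp
qed

text \<open>In contrast to \<open>trace_c_transport\<close> no power of \<open>r\<close> survives,
  since the trace of an endomorphism has weight 0.\<close>

lemma lin_trace_transport:
  assumes E: "onb g V E" and g: "inner_form g"
    and K: "linear K" "linear K'" "\<And>a. K' (K a) = a"
    and c: "inner_form c" "\<And>a b. c (K a) (K b) = r * g a b" and r: "r > 0"
    and f: "linear f'" "\<And>v. v \<in> V \<Longrightarrow> f (K v) = K (f' v)" "\<And>v. v \<in> V \<Longrightarrow> f' v \<in> V"
  shows "lin_trace (K ` V) f = (\<Sum>e\<in>E. g (f' e) e)"
proof -
  let ?F = "(\<lambda>e. K (e /\<^sub>R sqrt r)) ` E"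
  have inj: "inj K" by (metis K(3) injI)
  note im = onb_image[OF E g K(1) inj c(2) r]
  have sub: "e /\<^sub>R sqrt r \<in> V" if "e \<in> E" for e
    using E that unfolding orthonormal_basis_of_def by (metis span_base span_scale)
  have lin: "linear (\<lambda>v. K (f' (K' v)))"
    using linear_compose[OF linear_compose[OF K(2) f(1)] K(1)] by (simp add: o_def)
  have rsq: "r * (inverse (sqrt r) * (inverse (sqrt r) * x)) = x" for x
    using r by (simp add: divide_simps)
  have "lin_trace (K ` V) f = (\<Sum>e\<in>?F. c (f e) e)"
    by (rule lin_trace_onb[OF im(1) c(1) lin]) (auto simp: f K(3))
  also have "\<dots> = (\<Sum>e\<in>E. c (f (K (e /\<^sub>R sqrt r))) (K (e /\<^sub>R sqrt r)))"
    by (rule sum.reindex_cong[OF im(2) refl refl])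
  also have "\<dots> = (\<Sum>e\<in>E. g (f' e) e)"
    using r sub rsq
    by (intro sum.cong refl)
      (simp add: f c linear_scale[OF f(1)] linear_scale[OF inner_formD(4)[OF g]] linear_scale[OF inner_formD(5)[OF g]])
  finally show ?thesis .
qed

lemma trace_matrix_onb:
  fixes f :: "real^'m \<Rightarrow> real^'m"
  assumes E: "onb g UNIV E" and g: "inner_form g" and f: "linear f"
  shows "trace (matrix f) = (\<Sum>e\<in>E. g (f e) e)"
proof -
  have "(\<Sum>e\<in>E. g (f e) e) = (\<Sum>e\<in>E. \<Sum>i\<in>UNIV. e $ i * g (f (axis i 1)) e)"
  proof (rule sum.cong[OF refl])
    fix e
    have "f e = f (\<Sum>i\<in>UNIV. e $ i *\<^sub>R axis i 1)"
      using basis_expansion[of e] by (simp add: scalar_mult_eq_scaleR)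
    also have "\<dots> = (\<Sum>i\<in>UNIV. e $ i *\<^sub>R f (axis i 1))"
      by (simp add: linear_sum[OF f] linear_scale[OF f])
    finally show "g (f e) e = (\<Sum>i\<in>UNIV. e $ i * g (f (axis i 1)) e)"
      by (simp add: inner_form_sum(1)[OF g])
  qed
  also have "\<dots> = (\<Sum>i\<in>UNIV. (\<Sum>e\<in>E. g (f (axis i 1)) e *\<^sub>R e) $ i)"
    by (subst sum.swap) (simp add: mult.commute)
  also have "\<dots> = (\<Sum>i\<in>UNIV. f (axis i 1) $ i)"
    using onb_expand[OF E g] by simp
  also have "\<dots> = trace (matrix f)"
    by (simp add: trace_def matrix_def)
  finally show ?thesis by simp
qed

definition onb_proj :: "('v::real_vector \<Rightarrow> 'v \<Rightarrow> real) \<Rightarrow> 'v set \<Rightarrow> 'v \<Rightarrow> 'v" where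
  "onb_proj g E v = (\<Sum>e\<in>E. g v e *\<^sub>R e)"

lemma onb_proj:
  assumes E: "onb g V E" and g: "inner_form g"
  shows "linear (onb_proj g E)" "onb_proj g E v \<in> V" "w \<in> V \<Longrightarrow> g (onb_proj g E v) w = g v w"
    "v \<in> V \<Longrightarrow> onb_proj g E v = v" "(\<And>w. w \<in> V \<Longrightarrow> g v w = 0) \<Longrightarrow> onb_proj g E v = 0"
proof -
  show "linear (onb_proj g E)" unfolding onb_proj_def
    by (intro linearI) (simp_all add: linear_simps[OF inner_formD(5)[OF g]]
      algebra_simps sum.distrib scaleR_sum_right)
  have span: "span E = V" using E unfolding orthonormal_basis_of_def by simp
  show "onb_proj g E v \<in> V" unfolding span[symmetric] onb_proj_def
    by (intro span_sum span_scale span_base)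
  show "v \<in> V \<Longrightarrow> onb_proj g E v = v" unfolding onb_proj_def using onb_expand[OF E g] by simp
  show "(\<And>w. w \<in> V \<Longrightarrow> g v w = 0) \<Longrightarrow> onb_proj g E v = 0"
    unfolding onb_proj_def using onb_in[OF E] by simp
  assume w: "w \<in> V"
  have "g (onb_proj g E v) w = (\<Sum>e\<in>E. g v e * g e w)"
    unfolding onb_proj_def by (rule inner_form_sum(1)[OF g])
  also have "\<dots> = (\<Sum>e\<in>E. g w e * g e v)"
    by (intro sum.cong refl) (metis inner_formD(2)[OF g] mult.commute)
  also have "\<dots> = g w v" by (rule onb_parseval[OF E g w, symmetric])
  finally show "g (onb_proj g E v) w = g v w" by (simp only: inner_formD(2)[OF g, of w v])
qed

text \<open>The pointwise algebra of the conformal variation of the Ricci tensor: \<open>dT\<close>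
  and \<open>b\<close> stand for the covariant derivatives of the difference tensor \<open>T\<close>
  and of \<beta>, and the left side is the contracted change of the curvature. Each sum collapses
  when a linear form is contracted against \<open>g\<close>.\<close>

lemma ric_variation:
  assumes E: "onb g UNIV E" and g: "inner_form g"
    and b: "bilinear (b :: 'v \<Rightarrow> 'v \<Rightarrow> real)" and \<beta>: "linear (\<beta> :: 'v::euclidean_space \<Rightarrow> real)"
    and dT: "\<And>w u v z. g (dT w u v) z = b w u * g v z + b w v * g u z - b w z * g u v"
    and T: "\<And>u v z. g (T u v) z = \<beta> u * g v z + \<beta> v * g u z - \<beta> z * g u v"
  shows "(\<Sum>e\<in>E. g (dT e u u - dT u e u + T e (T u u) - T u (T e u)) e) =
    - (real (card E) - 2) * b u u - (\<Sum>e\<in>E. b e e) * g u u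
    + (real (card E) - 2) * ((\<beta> u)\<^sup>2 - (\<Sum>e\<in>E. (\<beta> e)\<^sup>2) * g u u)"
proof -
  note lin = inner_formD(5)[OF g]
  let ?m = "real (card E)" and ?n = "\<Sum>e\<in>E. (\<beta> e)\<^sup>2"
  have lb: "linear (b u)" "linear (\<lambda>u. b u v)" for u v using b unfolding bilinear_def by auto
  have s1: "(\<Sum>e\<in>E. L e * g x e) = L x" if "linear L" for L :: "'v \<Rightarrow> real" and x
    using onb_linear_expand[OF E g _ that, of x] by (simp add: mult.commute)
  have s2: "(\<Sum>e\<in>E. g e e) = ?m" using onb_norm[OF E] by simp
  have sym: "g x y = g y x" for x y by (rule inner_formD(2)[OF g])
  \<comment> \<open>The squared norm \<open>?n\<close> of \<beta> appears because \<open>T\<close>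
    contains the metric dual of \<beta>, to which \<beta> is applied once more.\<close>
  have b1: "\<beta> (T x u) = 2 * \<beta> u * \<beta> x - ?n * g x u" for x u
  proof -
    have "\<beta> (T x u) = (\<Sum>e\<in>E. \<beta> e * g (T x u) e)" by (rule s1[OF \<beta>, symmetric])
    also have "\<dots> = \<beta> x * (\<Sum>e\<in>E. \<beta> e * g u e) + \<beta> u * (\<Sum>e\<in>E. \<beta> e * g x e) - ?n * g x u"
      unfolding T by (simp add: algebra_simps sum.distrib sum_subtractf sum_distrib_left sum_distrib_right power2_eq_square)
    finally show ?thesis using s1[OF \<beta>] by simp
  qed
  have e1: "g (dT e u u) e = 2 * (b e u * g u e) - b e e * g u u" for e
    unfolding dT by simp
  have e2: "g (dT u e u) e = b u u * g e e" for e
    unfolding dT using sym[of e u] by simp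
  have e3: "g (T e x) e = \<beta> x * g e e" for e x
    unfolding T using sym[of e x] by simp
  have e4: "g (T u (T e u)) e = \<beta> u * (\<beta> u * g e e) + (2 * \<beta> u * (\<beta> e * g u e) - ?n * (g u e * g u e)) - (\<beta> e)\<^sup>2 * g u u" for e
    unfolding T[of u "T e u"] b1 e3[of e u] sym[of u "T e u"] T[of e u u]
    using sym[of e u] by (simp add: power2_eq_square algebra_simps)
  have "(\<Sum>e\<in>E. g (dT e u u - dT u e u + T e (T u u) - T u (T e u)) e) =
    (\<Sum>e\<in>E. g (dT e u u) e) - (\<Sum>e\<in>E. g (dT u e u) e) + (\<Sum>e\<in>E. g (T e (T u u)) e) - (\<Sum>e\<in>E. g (T u (T e u)) e)"
    by (simp add: linear_diff[OF lin] linear_add[OF lin] sum.distrib sum_subtractf)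
  also have "(\<Sum>e\<in>E. g (dT e u u) e) = 2 * b u u - (\<Sum>e\<in>E. b e e) * g u u"
    unfolding e1 using s1[OF lb(2), of u u]
    by (simp add: sum_subtractf sum_distrib_right flip: sum_distrib_left)
  also have "(\<Sum>e\<in>E. g (dT u e u) e) = ?m * b u u"
    unfolding e2 using s2 by (simp flip: sum_distrib_left)
  also have "(\<Sum>e\<in>E. g (T e (T u u)) e) = ?m * (2 * (\<beta> u)\<^sup>2 - ?n * g u u)"
    unfolding e3 b1 using s2 by (simp add: power2_eq_square flip: sum_distrib_left)
  also have "(\<Sum>e\<in>E. g (T u (T e u)) e) = (\<beta> u)\<^sup>2 * ?m + 2 * (\<beta> u)\<^sup>2 - ?n * g u u - ?n * g u u"
  proof -
    have "(\<Sum>e\<in>E. g (T u (T e u)) e) = \<beta> u * (\<beta> u * (\<Sum>e\<in>E. g e e)) + (2 * \<beta> u * (\<Sum>e\<in>E. \<beta> e * g u e) - ?n * (\<Sum>e\<in>E. g u e * g u e)) - ?n * g u u"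
      unfolding e4 by (simp add: sum.distrib sum_subtractf sum_distrib_left sum_distrib_right)
    then show ?thesis using s2 s1[OF \<beta>, of u] s1[OF inner_formD(4)[OF g], of u u]
      by (simp add: power2_eq_square)
  qed
  finally show ?thesis by (simp add: algebra_simps)
qed

section \<open>Charts\<close>

lemma smooth_on_prod:
  fixes f :: "'i \<Rightarrow> 'x::real_normed_vector \<Rightarrow> real"
  assumes "open S" "\<And>i. i \<in> I \<Longrightarrow> smooth_on S (f i)"
  shows "smooth_on S (\<lambda>x. \<Prod>i\<in>I. f i x)"
  using assms(2) by (induction I rule: infinite_finite_induct)
    (auto intro: smooth_on_const smooth_on_mult assms(1))

locale smooth_manifold =
  fixes A :: "('a::topological_space, 'm::finite) chart set"
  assumes atlas: "smooth_structure A"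
begin

lemma atlas_chart: "ch \<in> A \<Longrightarrow> is_chart ch"
  using atlas unfolding smooth_structure_def by blast

lemma chart_facts:
  assumes "(U, \<phi>) \<in> A"
  shows "open U" "open (\<phi> ` U)" "inj_on \<phi> U"
    "open W \<Longrightarrow> open (\<phi> ` (U \<inter> W))" "open W \<Longrightarrow> W \<subseteq> U \<Longrightarrow> open (\<phi> ` W)"
proof -
  obtain \<psi> where h: "homeomorphism U (\<phi> ` U) \<phi> \<psi>" and o: "open U" "open (\<phi> ` U)"
    using atlas_chart[OF assms] unfolding is_chart_def by auto
  show "open U" "open (\<phi> ` U)" by fact+
  show "inj_on \<phi> U" using h unfolding homeomorphism_def inj_on_def by metis
  show *: "open (\<phi> ` (U \<inter> W))" if "open W" for W
    using homeomorphism_imp_open_map[OF h, of "U \<inter> W"] o that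
    by (metis Int_lower1 open_Int openin_open_eq)
  show "open (\<phi> ` W)" if "open W" "W \<subseteq> U"
    using *[OF that(1)] that(2) by (simp add: Int_absorb1)
qed

lemma chart_inv [simp]:
  assumes "(U, \<phi>) \<in> A" "q \<in> U"
  shows "inv_into U \<phi> (\<phi> q) = q"
  using chart_facts(3)[OF assms(1)] assms(2) by simp

lemma transition_smooth:
  assumes "(U, \<phi>) \<in> A" "(V, \<eta>) \<in> A"
  shows "smooth_on (\<phi> ` (U \<inter> V)) (\<lambda>y. \<eta> (inv_into U \<phi> y))"
proof -
  have "compatible (U, \<phi>) (V, \<eta>)" using atlas assms unfolding smooth_structure_def by blast
  then show ?thesis unfolding compatible_def by (simp add: o_def)
qed

text \<open>Objects at \<open>q\<close> are defined in \<open>pchart A q\<close>; this chain rule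
  carries them to any chart around \<open>q\<close>. It is the source of
  \<open>dchart_transition\<close> and \<open>dirderiv_chart\<close>.\<close>

lemma transition_compose:
  fixes f :: "'a \<Rightarrow> 'b::real_normed_vector"
  assumes U: "(U, \<phi>) \<in> A" and V: "(V, \<eta>) \<in> A" and q: "q \<in> U" "q \<in> V"
    and f: "(\<lambda>z. f (inv_into V \<eta> z)) differentiable (at (\<eta> q))"
  shows "(\<lambda>y. f (inv_into U \<phi> y)) differentiable (at (\<phi> q))"
    and "dd (\<lambda>y. f (inv_into U \<phi> y)) (\<phi> q) v
      = dd (\<lambda>z. f (inv_into V \<eta> z)) (\<eta> q) (dd (\<lambda>y. \<eta> (inv_into U \<phi> y)) (\<phi> q) v)"
proof -
  let ?S = "\<phi> ` (U \<inter> V)"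
  have o: "open ?S" using chart_facts[OF U] chart_facts(1)[OF V] by auto
  have in': "\<phi> q \<in> ?S" using q by auto
  have eq: "f (inv_into V \<eta> (\<eta> (inv_into U \<phi> y))) = f (inv_into U \<phi> y)" if "y \<in> ?S" for y
    using that U V by auto
  have t: "(\<lambda>y. \<eta> (inv_into U \<phi> y)) differentiable (at (\<phi> q))"
    by (rule smooth_on_differentiable[OF transition_smooth[OF U V] in'])
  have f': "(\<lambda>z. f (inv_into V \<eta> z)) differentiable (at (\<eta> (inv_into U \<phi> (\<phi> q))))"
    using f q U by simp
  have d: "(\<lambda>y. f (inv_into V \<eta> (\<eta> (inv_into U \<phi> y)))) differentiable (at (\<phi> q))"
    using differentiable_chain_at[OF t f'] by (simp add: o_def)
  show "(\<lambda>y. f (inv_into U \<phi> y)) differentiable (at (\<phi> q))"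
    by (rule differentiable_cong_open[OF o in' eq d])
  have "dd (\<lambda>y. f (inv_into U \<phi> y)) (\<phi> q) = dd (\<lambda>y. f (inv_into V \<eta> (\<eta> (inv_into U \<phi> y)))) (\<phi> q)"
    by (rule dd_cong[OF o in' eq[symmetric]])
  then show "dd (\<lambda>y. f (inv_into U \<phi> y)) (\<phi> q) v
      = dd (\<lambda>z. f (inv_into V \<eta> z)) (\<eta> q) (dd (\<lambda>y. \<eta> (inv_into U \<phi> y)) (\<phi> q) v)"
    using dd_compose[OF f' t, of v] q U by simp
qed

lemma transition_self:
  assumes U: "(U, \<phi>) \<in> A" and q: "q \<in> U"
  shows "dd (\<lambda>y. \<phi> (inv_into U \<phi> y)) (\<phi> q) v = v"
proof -
  have "dd (\<lambda>y. \<phi> (inv_into U \<phi> y)) (\<phi> q) = dd (\<lambda>y. y) (\<phi> q)"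
    by (rule dd_cong[OF chart_facts(2)[OF U]]) (use q U in auto)
  then show ?thesis by simp
qed

lemma transition_differentiable:
  assumes U: "(U, \<phi>) \<in> A" and V: "(V, \<eta>) \<in> A" and q: "q \<in> U" "q \<in> V"
  shows "(\<lambda>y. \<eta> (inv_into U \<phi> y)) differentiable (at (\<phi> q))"
  by (rule smooth_on_differentiable[OF transition_smooth[OF U V]]) (use q in auto)

lemma pchart_mem: "(pdom A q, pmap A q) \<in> A" and in_pdom: "q \<in> pdom A q"
proof -
  have "\<exists>ch. ch \<in> A \<and> q \<in> fst ch" using atlas unfolding smooth_structure_def by blast
  from someI_ex[OF this] show "(pdom A q, pmap A q) \<in> A" "q \<in> pdom A q"
    unfolding pchart_def by auto
qed

lemma dchart_alt: "dchart A \<phi> q = dd (\<lambda>y. \<phi> (inv_into (pdom A q) (pmap A q) y)) (pmap A q q)"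
  unfolding dchart_def by (simp add: o_def)

lemma dirderiv_alt: "dirderiv A f q v = dd (\<lambda>y. f (inv_into (pdom A q) (pmap A q) y)) (pmap A q q) v"
  unfolding dirderiv_def by (simp add: o_def)

lemma dchart_transition:
  assumes U: "(U, \<phi>) \<in> A" and V: "(V, \<eta>) \<in> A" and q: "q \<in> U" "q \<in> V"
  shows "dchart A \<eta> q v = dd (\<lambda>y. \<eta> (inv_into U \<phi> y)) (\<phi> q) (dchart A \<phi> q v)"
  unfolding dchart_alt
  by (rule transition_compose(2)[OF pchart_mem U in_pdom q(1) transition_differentiable[OF U V q]])

lemma dirderiv_chart:
  assumes U: "(U, \<phi>) \<in> A" and q: "q \<in> U"
    and f: "(\<lambda>y. f (inv_into U \<phi> y)) differentiable (at (\<phi> q))"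
  shows "dirderiv A f q v = dd (\<lambda>y. f (inv_into U \<phi> y)) (\<phi> q) (dchart A \<phi> q v)"
  unfolding dirderiv_alt dchart_alt by (rule transition_compose(2)[OF pchart_mem U in_pdom q f])

lemma dchart_pmap: "dchart A (pmap A q) q v = v"
  unfolding dchart_alt by (rule transition_self[OF pchart_mem in_pdom])

lemma dchart_linear:
  assumes U: "(U, \<phi>) \<in> A" and q: "q \<in> U"
  shows "linear (dchart A \<phi> q)"
  unfolding dchart_alt
  by (rule linear_frechet_derivative[OF transition_differentiable[OF pchart_mem U in_pdom q]])

lemma dchart_inverse:
  assumes U: "(U, \<phi>) \<in> A" and q: "q \<in> U"
  shows "dchart A \<phi> q (inv (dchart A \<phi> q) v) = v" "inv (dchart A \<phi> q) (dchart A \<phi> q v) = v"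
    "linear (inv (dchart A \<phi> q))"
    "inv (dchart A \<phi> q) v = dd (\<lambda>y. pmap A q (inv_into U \<phi> y)) (\<phi> q) v"
proof -
  let ?F = "dd (\<lambda>y. pmap A q (inv_into U \<phi> y)) (\<phi> q)"
  have 1: "?F (dchart A \<phi> q v) = v" for v
    using dchart_transition[OF U pchart_mem q in_pdom, of v] dchart_pmap by simp
  have 2: "dchart A \<phi> q (?F v) = v" for v
    using transition_compose(2)[OF U pchart_mem q in_pdom
      transition_differentiable[OF pchart_mem U in_pdom q], of v] transition_self[OF U q]
    unfolding dchart_alt by simp
  have inv: "inv (dchart A \<phi> q) = ?F" by (rule inv_equality) (use 1 2 in auto)
  show "dchart A \<phi> q (inv (dchart A \<phi> q) v) = v" "inv (dchart A \<phi> q) (dchart A \<phi> q v) = v"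
    "inv (dchart A \<phi> q) v = ?F v" using 1 2 inv by auto
  show "linear (inv (dchart A \<phi> q))" unfolding inv
    by (rule linear_frechet_derivative[OF transition_differentiable[OF U pchart_mem q in_pdom]])
qed

lemma jac_pos:
  assumes U: "(U, \<phi>) \<in> A" and q: "q \<in> U"
  shows "jac A \<phi> q > 0"
proof -
  note lin = dchart_linear[OF U q] dchart_inverse(3)[OF U q]
  have "matrix (inv (dchart A \<phi> q)) ** matrix (dchart A \<phi> q) = matrix (inv (dchart A \<phi> q) \<circ> dchart A \<phi> q)"
    by (rule matrix_compose[symmetric]) (use lin in \<open>simp_all add: linear_linear\<close>)
  also have "inv (dchart A \<phi> q) \<circ> dchart A \<phi> q = id" using dchart_inverse(2)[OF U q] by (simp add: fun_eq_iff)
  finally have "det (matrix (inv (dchart A \<phi> q)) ** matrix (dchart A \<phi> q)) = 1"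
    by (simp only: matrix_id_mat_1 det_I)
  then show ?thesis unfolding jac_def det_mul by auto
qed

lemma jac_pmap: "jac A (pmap A q) q = 1"
proof -
  have "dchart A (pmap A q) q = id" using dchart_pmap by (simp add: fun_eq_iff)
  then show ?thesis unfolding jac_def by (simp add: matrix_id_mat_1)
qed

lemma sec_coord_0:
  assumes "(U, \<phi>) \<in> A" "q \<in> U"
  shows "sec_coord A 0 \<phi> f q = f q"
  unfolding sec_coord_def using jac_pos[OF assms] by simp

lemma smooth_secI:
  assumes "\<And>U \<phi>. (U, \<phi>) \<in> A \<Longrightarrow> smooth_on (\<phi> ` (U \<inter> W)) (\<lambda>y. sec_coord A k \<phi> l (inv_into U \<phi> y))"
  shows "smooth_sec A k W l"
  using assms unfolding smooth_sec_def by (auto simp: o_def)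

lemma smooth_secD:
  assumes "smooth_sec A k W l" "(U, \<phi>) \<in> A"
  shows "smooth_on (\<phi> ` (U \<inter> W)) (\<lambda>y. sec_coord A k \<phi> l (inv_into U \<phi> y))"
  using assms unfolding smooth_sec_def by (auto simp: o_def)

lemma smooth_vfD:
  assumes "smooth_vf A W X" "(U, \<phi>) \<in> A"
  shows "smooth_on (\<phi> ` (U \<inter> W)) (\<lambda>y. dchart A \<phi> (inv_into U \<phi> y) (X (inv_into U \<phi> y)))"
  using assms unfolding smooth_vf_def by (auto simp: o_def vec_coord_def)

lemma smooth_vfI:
  assumes "\<And>U \<phi>. (U, \<phi>) \<in> A \<Longrightarrow>
    smooth_on (\<phi> ` (U \<inter> W)) (\<lambda>y. dchart A \<phi> (inv_into U \<phi> y) (X (inv_into U \<phi> y)))"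
  shows "smooth_vf A W X"
  using assms unfolding smooth_vf_def by (auto simp: o_def vec_coord_def)

lemma smooth_vf_subset: "smooth_vf A W X \<Longrightarrow> W' \<subseteq> W \<Longrightarrow> smooth_vf A W' X"
  by (rule smooth_vfI, rule smooth_on_subset[OF smooth_vfD]) auto

lemma smooth_sec_subset: "smooth_sec A k W X \<Longrightarrow> W' \<subseteq> W \<Longrightarrow> smooth_sec A k W' X"
  by (rule smooth_secI, rule smooth_on_subset[OF smooth_secD]) auto

lemma smooth_vf_cong:
  assumes "smooth_vf A W X" "open W" "\<And>q. q \<in> W \<Longrightarrow> X q = Y q"
  shows "smooth_vf A W Y"
proof (rule smooth_vfI)
  fix U \<phi> assume U: "(U, \<phi>) \<in> A"
  show "smooth_on (\<phi> ` (U \<inter> W)) (\<lambda>y. dchart A \<phi> (inv_into U \<phi> y) (Y (inv_into U \<phi> y)))"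
    by (rule smooth_on_cong[OF chart_facts(4)[OF U assms(2)] smooth_vfD[OF assms(1) U]])
      (use U assms(3) in auto)
qed

lemma smooth_sec_cong:
  assumes "smooth_sec A k W X" "open W" "\<And>q. q \<in> W \<Longrightarrow> X q = Y q"
  shows "smooth_sec A k W Y"
proof (rule smooth_secI)
  fix U \<phi> assume U: "(U, \<phi>) \<in> A"
  show "smooth_on (\<phi> ` (U \<inter> W)) (\<lambda>y. sec_coord A k \<phi> Y (inv_into U \<phi> y))"
    by (rule smooth_on_cong[OF chart_facts(4)[OF U assms(2)] smooth_secD[OF assms(1) U]])
      (use U assms(3) in \<open>auto simp: sec_coord_def\<close>)
qed

lemma smooth_vf_add:
  assumes "open W" "smooth_vf A W X" "smooth_vf A W Y"
  shows "smooth_vf A W (\<lambda>q. X q + Y q)"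
proof (rule smooth_vfI)
  fix U \<phi> assume U: "(U, \<phi>) \<in> A"
  show "smooth_on (\<phi> ` (U \<inter> W)) (\<lambda>y. dchart A \<phi> (inv_into U \<phi> y) (X (inv_into U \<phi> y) + Y (inv_into U \<phi> y)))"
    by (rule smooth_on_cong[OF chart_facts(4)[OF U assms(1)]
        smooth_on_add[OF chart_facts(4)[OF U assms(1)] smooth_vfD[OF assms(2) U] smooth_vfD[OF assms(3) U]]])
      (use U in \<open>auto simp: linear_add[OF dchart_linear]\<close>)
qed

lemma smooth_funD:
  assumes "smooth_fun A W f" "(U, \<phi>) \<in> A" "open W"
  shows "smooth_on (\<phi> ` (U \<inter> W)) (\<lambda>y. f (inv_into U \<phi> y))"
  by (rule smooth_on_cong[OF chart_facts(4)[OF assms(2,3)] smooth_secD[OF assms(1,2)]])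
    (use assms(2) in \<open>auto simp: sec_coord_0\<close>)

lemma smooth_funI:
  assumes "open W" "\<And>U \<phi>. (U, \<phi>) \<in> A \<Longrightarrow> smooth_on (\<phi> ` (U \<inter> W)) (\<lambda>y. f (inv_into U \<phi> y))"
  shows "smooth_fun A W f"
proof (rule smooth_secI)
  fix U \<phi> assume U: "(U, \<phi>) \<in> A"
  show "smooth_on (\<phi> ` (U \<inter> W)) (\<lambda>y. sec_coord A 0 \<phi> f (inv_into U \<phi> y))"
    by (rule smooth_on_cong[OF chart_facts(4)[OF U assms(1)] assms(2)[OF U]])
      (use U in \<open>auto simp: sec_coord_0\<close>)
qed

lemma smooth_on_change_chart:
  fixes f :: "'a \<Rightarrow> 'b::real_normed_vector"
  assumes U: "(U, \<phi>) \<in> A" and V: "(V, \<eta>) \<in> A" and W: "open W" "W \<subseteq> U"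
    and f: "smooth_on (\<phi> ` W) (\<lambda>y. f (inv_into U \<phi> y))"
  shows "smooth_on (\<eta> ` (V \<inter> W)) (\<lambda>y. f (inv_into V \<eta> y))"
proof (rule smooth_on_cong)
  have t: "smooth_on (\<eta> ` (V \<inter> W)) (\<lambda>y. \<phi> (inv_into V \<eta> y))"
    by (rule smooth_on_subset[OF transition_smooth[OF V U]]) (use W in auto)
  show "smooth_on (\<eta> ` (V \<inter> W)) (\<lambda>y. f (inv_into U \<phi> (\<phi> (inv_into V \<eta> y))))"
    by (rule smooth_on_compose[OF chart_facts(5)[OF U W] chart_facts(4)[OF V W(1)] t f])
      (use V in auto)
qed (use chart_facts(4)[OF V W(1)] U V W in auto)

lemma smooth_fun_chart:
  assumes U: "(U, \<phi>) \<in> A" and W: "open W" "W \<subseteq> U"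
    and f: "smooth_on (\<phi> ` W) (\<lambda>y. f (inv_into U \<phi> y))"
  shows "smooth_fun A W f"
  by (rule smooth_funI[OF W(1) smooth_on_change_chart[OF U _ W f]])

lemma smooth_vf_scale:
  assumes W: "open W" and f: "smooth_fun A W f" and X: "smooth_vf A W X"
  shows "smooth_vf A W (\<lambda>q. f q *\<^sub>R X q)"
proof (rule smooth_vfI)
  fix U \<phi> assume U: "(U, \<phi>) \<in> A"
  note o = chart_facts(4)[OF U W]
  show "smooth_on (\<phi> ` (U \<inter> W)) (\<lambda>y. dchart A \<phi> (inv_into U \<phi> y) (f (inv_into U \<phi> y) *\<^sub>R X (inv_into U \<phi> y)))"
    by (rule smooth_on_cong[OF o smooth_on_scaleR[OF o smooth_funD[OF f U W] smooth_vfD[OF X U]]])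
      (use U in \<open>auto simp: linear_scale[OF dchart_linear]\<close>)
qed

lemma smooth_vf_zero: "open W \<Longrightarrow> smooth_vf A W (\<lambda>q. 0)"
proof (rule smooth_vfI)
  fix U \<phi> assume U: "(U, \<phi>) \<in> A" and W: "open W"
  show "smooth_on (\<phi> ` (U \<inter> W)) (\<lambda>y. dchart A \<phi> (inv_into U \<phi> y) 0)"
    by (rule smooth_on_cong[OF chart_facts(4)[OF U W] smooth_on_const[of _ 0]])
      (use U in \<open>auto simp: linear_0[OF dchart_linear]\<close>)
qed

lemma smooth_vf_sum:
  assumes W: "open W" and X: "\<And>i. i \<in> I \<Longrightarrow> smooth_vf A W (X i)"
  shows "smooth_vf A W (\<lambda>q. \<Sum>i\<in>I. X i q)"
  using X by (induction I rule: infinite_finite_induct) (auto intro: smooth_vf_zero smooth_vf_add W)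

lemma smooth_fun_const: "open W \<Longrightarrow> smooth_fun A W (\<lambda>q. a)"
  by (rule smooth_funI) (auto intro: smooth_on_const)

section \<open>Coordinate fields and the unit section\<close>

definition coord_field :: "('a \<Rightarrow> real^'m) \<Rightarrow> real^'m \<Rightarrow> 'a \<Rightarrow> real^'m" where
  "coord_field \<phi> a q = inv (dchart A \<phi> q) a"

text \<open>In a second chart the components are the derivative of the transition map in the fixed
  direction \<open>a\<close>.\<close>

lemma smooth_coord_field:
  assumes U: "(U, \<phi>) \<in> A"
  shows "smooth_vf A U (coord_field \<phi> a)"
proof (rule smooth_vfI)
  fix V \<eta> assume V: "(V, \<eta>) \<in> A"
  let ?t = "\<lambda>y. \<eta> (inv_into U \<phi> y)"
  have o: "open (\<eta> ` (V \<inter> U))" "open (\<phi> ` (U \<inter> V))"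
    using chart_facts(4)[OF V] chart_facts(4)[OF U] chart_facts(1)[OF V] chart_facts(1)[OF U] by auto
  have "smooth_on (\<eta> ` (V \<inter> U)) (\<lambda>y. dd ?t (\<phi> (inv_into V \<eta> y)) a)"
    by (rule smooth_on_compose[OF o(2) o(1) transition_smooth[OF V U]
        smooth_on_dd_const[OF transition_smooth[OF U V]]]) (use V in auto)
  then show "smooth_on (\<eta> ` (V \<inter> U)) (\<lambda>y. dchart A \<eta> (inv_into V \<eta> y) (coord_field \<phi> a (inv_into V \<eta> y)))"
  proof (rule smooth_on_cong[OF o(1)])
    fix y assume "y \<in> \<eta> ` (V \<inter> U)"
    then have q: "inv_into V \<eta> y \<in> U" "inv_into V \<eta> y \<in> V" using V by auto
    show "dd ?t (\<phi> (inv_into V \<eta> y)) a = dchart A \<eta> (inv_into V \<eta> y) (coord_field \<phi> a (inv_into V \<eta> y))"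
      unfolding coord_field_def dchart_transition[OF U V q] dchart_inverse(1)[OF U q(1)] ..
  qed
qed

lemma cext_eq: "cext A p v = coord_field (pmap A p) v"
  unfolding cext_def coord_field_def by (rule ext) simp

lemma unit_sec_1: "unit_sec A p p = 1"
  unfolding unit_sec_def jac_pmap by simp

lemma jac_transition:
  assumes U: "(U, \<phi>) \<in> A" and V: "(V, \<eta>) \<in> A" and q: "q \<in> U" "q \<in> V"
  shows "jac A \<eta> q = \<bar>det (matrix (dd (\<lambda>y. \<eta> (inv_into U \<phi> y)) (\<phi> q)))\<bar> * jac A \<phi> q"
proof -
  let ?t = "dd (\<lambda>y. \<eta> (inv_into U \<phi> y)) (\<phi> q)"
  have lin: "linear ?t"
    by (rule linear_frechet_derivative[OF transition_differentiable[OF U V q]])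
  have "dchart A \<eta> q = ?t \<circ> dchart A \<phi> q"
    using dchart_transition[OF U V q] by (simp add: fun_eq_iff)
  then have "matrix (dchart A \<eta> q) = matrix ?t ** matrix (dchart A \<phi> q)"
    using matrix_compose[OF dchart_linear[OF U q(1)] lin] by simp
  then show ?thesis unfolding jac_def by (simp add: det_mul abs_mult)
qed

text \<open>\<open>faraday\<close> and \<open>schouten\<close> evaluate operators on this section,
  so it must be smooth near \<open>p\<close>. In another chart it becomes a power of the absolute
  Jacobian determinant of the transition map.\<close>

lemma unit_sec_smooth: "smooth_sec A 1 (pdom A p) (unit_sec A p)"
proof (rule smooth_secI)
  fix V \<eta> assume V: "(V, \<eta>) \<in> A"
  let ?U = "pdom A p" and ?\<phi> = "pmap A p" and ?m = "real CARD('m)"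
  let ?t = "\<lambda>y. \<eta> (inv_into ?U ?\<phi> y)"
  let ?d = "\<lambda>y. det (matrix (dd ?t (?\<phi> (inv_into V \<eta> y))))"
  note U = pchart_mem[of p]
  let ?S = "\<eta> ` (V \<inter> ?U)"
  have o: "open ?S" "open (?\<phi> ` (?U \<inter> V))"
    using chart_facts(4)[OF V] chart_facts(4)[OF U] chart_facts(1)[OF V] chart_facts(1)[OF U] by auto
  have s: "smooth_on ?S (\<lambda>y. dd ?t (?\<phi> (inv_into V \<eta> y)) a)" for a
    by (rule smooth_on_compose[OF o(2) o(1) transition_smooth[OF V U]
        smooth_on_dd_const[OF transition_smooth[OF U V]]]) (use V in auto)
  have d: "smooth_on ?S ?d"
    unfolding det_def
    by (intro smooth_on_sum o(1) smooth_on_mult smooth_on_const smooth_on_prod)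
      (simp_all add: matrix_def smooth_on_nth[OF o(1) s])
  have jt: "jac A \<eta> (inv_into V \<eta> y) = \<bar>?d y\<bar> * jac A ?\<phi> (inv_into V \<eta> y)" if "y \<in> ?S" for y
    by (rule jac_transition[OF U V]) (use that V in auto)
  have pos: "?d y * ?d y > 0" if "y \<in> ?S" for y
    using jt[OF that] jac_pos[OF V, of "inv_into V \<eta> y"] that V by (auto simp: zero_less_mult_iff)
  \<comment> \<open>The absolute value is traded for the square of the determinant, which is smooth
    and positive, with half the exponent.\<close>
  have "smooth_on ?S (\<lambda>y. (?d y * ?d y) powr (1 / (2 * ?m)))"
    by (intro smooth_on_powr o(1) smooth_on_mult d pos)
  then show "smooth_on ?S (\<lambda>y. sec_coord A 1 \<eta> (unit_sec A p) (inv_into V \<eta> y))"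
  proof (rule smooth_on_cong[OF o(1)])
    fix y assume y: "y \<in> ?S"
    have j: "jac A ?\<phi> (inv_into V \<eta> y) > 0" using jac_pos[OF U] y V by auto
    have "(?d y * ?d y) powr (1 / (2 * ?m)) = (\<bar>?d y\<bar> powr 2) powr (1 / (2 * ?m))"
      using pos[OF y] by (simp add: powr_numeral power2_eq_square)
    also have "\<dots> = \<bar>?d y\<bar> powr (1 / ?m)" unfolding powr_powr by simp
    also have "\<dots> = sec_coord A 1 \<eta> (unit_sec A p) (inv_into V \<eta> y)"
      unfolding sec_coord_def unit_sec_def jt[OF y] using j
      by (simp add: powr_mult powr_minus)
    finally show "(?d y * ?d y) powr (1 / (2 * ?m)) = sec_coord A 1 \<eta> (unit_sec A p) (inv_into V \<eta> y)" .
  qed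
qed

section \<open>Locality of connections and frame expansions\<close>

lemma connection_add:
  assumes "connection A D" "open W" "smooth_vf A W X" "smooth_vf A W Y" "smooth_vf A W Z" "p \<in> W"
  shows "D (\<lambda>q. X q + Z q) Y p = D X Y p + D Z Y p" "D X (\<lambda>q. Y q + Z q) p = D X Y p + D X Z p"
  using assms unfolding connection_def by blast+

lemma connection_scale:
  assumes "connection A D" "open W" "smooth_vf A W X" "smooth_vf A W Y" "smooth_fun A W f" "p \<in> W"
  shows "D (\<lambda>q. f q *\<^sub>R X q) Y p = f p *\<^sub>R D X Y p"
    "D X (\<lambda>q. f q *\<^sub>R Y q) p = f p *\<^sub>R D X Y p + dirderiv A f p (X p) *\<^sub>R Y p"
  using assms unfolding connection_def by blast+

lemma connection_smooth:
  assumes "connection A D" "open W" "smooth_vf A W X" "smooth_vf A W Y"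
  shows "smooth_vf A W (D X Y)"
  using assms unfolding connection_def by blast

lemma dirderiv_zero:
  assumes "open W" "p \<in> W" "\<And>q. q \<in> W \<Longrightarrow> f q = 0"
  shows "dirderiv A f p v = 0"
proof -
  have "dd (\<lambda>y. f (inv_into (pdom A p) (pmap A p) y)) (pmap A p p) = dd (\<lambda>y. 0) (pmap A p p)"
    by (rule dd_cong[OF chart_facts(4)[OF pchart_mem assms(1)]]) (use assms in_pdom pchart_mem in auto)
  then show ?thesis unfolding dirderiv_alt by simp
qed

text \<open>The indicator of the complement of \<open>W\<close> is smooth on \<open>W\<close>, being
  0 there. Fields that agree on \<open>W\<close> differ by this function times a field, and the
  rules for scaling by functions make that difference invisible at \<open>p\<close>.\<close>

lemma connection_local:
  assumes D: "connection A D" and W: "open W" and X: "smooth_vf A W X" and Y: "smooth_vf A W Y" and p: "p \<in> W"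
    and eq: "\<And>q. q \<in> W \<Longrightarrow> X q = X' q" "\<And>q. q \<in> W \<Longrightarrow> Y q = Y' q"
  shows "D X Y p = D X' Y' p"
proof -
  define f :: "'a \<Rightarrow> real" where "f q = (if q \<in> W then 0 else 1)" for q
  have f: "smooth_fun A W f"
    by (rule smooth_sec_cong[OF smooth_fun_const[OF W, of 0] W]) (simp add: f_def)
  have Xd: "smooth_vf A W (\<lambda>q. X' q - X q)"
    by (rule smooth_vf_cong[OF smooth_vf_zero[OF W] W]) (simp add: eq)
  have Yd: "smooth_vf A W (\<lambda>q. Y' q - Y q)"
    by (rule smooth_vf_cong[OF smooth_vf_zero[OF W] W]) (simp add: eq)
  have X': "X' = (\<lambda>q. X q + f q *\<^sub>R (X' q - X q))" and Y': "Y' = (\<lambda>q. Y q + f q *\<^sub>R (Y' q - Y q))"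
    using eq by (auto simp: f_def)
  have Xs: "smooth_vf A W X'" by (rule smooth_vf_cong[OF X W eq(1)])
  have "D X' Y' p = D X' Y p + D X' (\<lambda>q. f q *\<^sub>R (Y' q - Y q)) p"
    by (subst (1) Y') (rule connection_add(2)[OF D W Xs Y smooth_vf_scale[OF W f Yd] p])
  also have "\<dots> = D X' Y p"
    using connection_scale(2)[OF D W Xs Yd f p] dirderiv_zero[OF W p, of f] p by (simp add: f_def)
  also have "\<dots> = D X Y p + D (\<lambda>q. f q *\<^sub>R (X' q - X q)) Y p"
    by (subst (1) X') (rule connection_add(1)[OF D W X Y smooth_vf_scale[OF W f Xd] p])
  also have "\<dots> = D X Y p"
    using connection_scale(1)[OF D W Xd Y f p] p by (simp add: f_def)
  finally show ?thesis by simp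
qed

lemma connection_sum:
  assumes D: "connection A D" and W: "open W" and p: "p \<in> W" and Y: "smooth_vf A W Y"
    and f: "\<And>i. i \<in> I \<Longrightarrow> smooth_fun A W (f i)" and Z: "\<And>i. i \<in> I \<Longrightarrow> smooth_vf A W (Z i)"
  shows "D (\<lambda>q. \<Sum>i\<in>I. f i q *\<^sub>R Z i q) Y p = (\<Sum>i\<in>I. f i p *\<^sub>R D (Z i) Y p)"
    "D Y (\<lambda>q. \<Sum>i\<in>I. f i q *\<^sub>R Z i q) p = (\<Sum>i\<in>I. f i p *\<^sub>R D Y (Z i) p + dirderiv A (f i) p (Y p) *\<^sub>R Z i p)"
proof -
  have z: "D (\<lambda>q. 0) Y p = 0" "D Y (\<lambda>q. 0) p = 0"
    using connection_scale[OF D W smooth_vf_zero[OF W] Y smooth_fun_const[OF W, of 0] p]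
      connection_scale[OF D W Y smooth_vf_zero[OF W] smooth_fun_const[OF W, of 0] p]
      dirderiv_zero[OF W p, of "\<lambda>q. 0"] by auto
  have "D (\<lambda>q. \<Sum>i\<in>I. f i q *\<^sub>R Z i q) Y p = (\<Sum>i\<in>I. f i p *\<^sub>R D (Z i) Y p) \<and>
    D Y (\<lambda>q. \<Sum>i\<in>I. f i q *\<^sub>R Z i q) p = (\<Sum>i\<in>I. f i p *\<^sub>R D Y (Z i) p + dirderiv A (f i) p (Y p) *\<^sub>R Z i p)"
    using f Z
  proof (induction I rule: infinite_finite_induct)
    case (insert i I)
    have s: "smooth_vf A W (\<lambda>q. f i q *\<^sub>R Z i q)" "smooth_vf A W (\<lambda>q. \<Sum>i\<in>I. f i q *\<^sub>R Z i q)"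
      using insert.prems by (auto intro!: smooth_vf_scale smooth_vf_sum W)
    show ?case
      using insert connection_add(1)[OF D W s(1) Y s(2) p] connection_add(2)[OF D W Y s p]
        connection_scale(1)[OF D W _ Y _ p, of "Z i" "f i"] connection_scale(2)[OF D W Y _ _ p, of "Z i" "f i"]
      by simp
  qed (use z in auto)
  then show "D (\<lambda>q. \<Sum>i\<in>I. f i q *\<^sub>R Z i q) Y p = (\<Sum>i\<in>I. f i p *\<^sub>R D (Z i) Y p)"
    "D Y (\<lambda>q. \<Sum>i\<in>I. f i q *\<^sub>R Z i q) p = (\<Sum>i\<in>I. f i p *\<^sub>R D Y (Z i) p + dirderiv A (f i) p (Y p) *\<^sub>R Z i p)"
    by auto
qed

end

section \<open>Connections in coordinates\<close>

lemma dd_powr: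
  fixes f :: "'x::real_normed_vector \<Rightarrow> real"
  assumes "smooth_on S f" "x \<in> S" "f x > 0"
  shows "((\<lambda>y. f y powr a) has_derivative (\<lambda>v. a * f x powr (a - 1) * dd f x v)) (at x)"
  using has_derivative_compose[OF smooth_on_has_derivative[OF assms(1,2)], of "\<lambda>z. z powr a" "\<lambda>h. (a * f x powr (a - 1)) * h"]
    has_real_derivative_powr[OF assms(3), of a]
  by (simp add: has_field_derivative_def)

lemma trace_conj:
  fixes f K K' :: "real^'m \<Rightarrow> real^'m"
  assumes "linear f" "linear K" "linear K'" "\<And>a. K' (K a) = a"
  shows "trace (matrix (\<lambda>v. K (f (K' v)))) = trace (matrix f)"
proof -
  have "matrix (\<lambda>v. K (f (K' v))) = matrix K ** matrix (\<lambda>v. f (K' v))"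
    using matrix_compose[OF linear_compose[OF assms(3,1)] assms(2)] by (simp add: o_def)
  then have "trace (matrix (\<lambda>v. K (f (K' v)))) = trace (matrix (\<lambda>v. f (K' v)) ** matrix K)"
    by (simp only: trace_mul_sym[of "matrix K" "matrix (\<lambda>v. f (K' v))"])
  also have "matrix (\<lambda>v. f (K' v)) ** matrix K = matrix f"
    using matrix_compose[OF assms(2) linear_compose[OF assms(3,1)]] assms(4) by (simp add: o_def)
  finally show ?thesis .
qed

text \<open>\<open>smooth_bil\<close> tests vectors with constant components in a chart; bilinearity
  extends this to smoothly varying arguments.\<close>

lemma (in smooth_manifold) smooth_bil_fields:
  assumes B: "smooth_bil A k W' B" and W: "open W" "W \<subseteq> W'" and X: "smooth_vf A W X" and Y: "smooth_vf A W Y"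
  shows "smooth_sec A k W (\<lambda>q. B q (X q) (Y q))"
proof (rule smooth_secI)
  fix V \<eta> assume V: "(V, \<eta>) \<in> A"
  let ?q = "inv_into V \<eta>"
  let ?S = "\<eta> ` (V \<inter> W)"
  note o = chart_facts(4)[OF V W(1)]
  have q: "?q y \<in> V" "?q y \<in> W" if "y \<in> ?S" for y using that V by auto
  define b where "b y u v = sec_coord A k \<eta> (\<lambda>q. B q (inv (dchart A \<eta> q) u) (inv (dchart A \<eta> q) v)) (?q y)" for y u v
  have bil: "bilinear (B (?q y))" if "y \<in> ?S" for y
    using B q[OF that] W unfolding smooth_bil_def by blast
  have "smooth_on ?S (\<lambda>y. b y (dchart A \<eta> (?q y) (X (?q y))) (dchart A \<eta> (?q y) (Y (?q y))))"
  proof (rule smooth_on_bilinear_family[OF o _ _ smooth_vfD[OF X V] smooth_vfD[OF Y V]])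
    fix y assume y: "y \<in> ?S"
    note l = dchart_inverse(3)[OF V q(1)[OF y]]
    show "bilinear (b y)"
      unfolding bilinear_def b_def sec_coord_def
      by (intro allI conjI linearI)
        (simp_all add: linear_simps[OF l] bilinear_simps[OF bil[OF y]] algebra_simps)
  next
    fix u v
    have "smooth_on (\<eta> ` (V \<inter> W')) (\<lambda>y. b y u v)"
      using B V unfolding smooth_bil_def b_def by (auto simp: o_def)
    then show "smooth_on ?S (\<lambda>y. b y u v)" by (rule smooth_on_subset) (use W in auto)
  qed
  then show "smooth_on ?S (\<lambda>y. sec_coord A k \<eta> (\<lambda>q. B q (X q) (Y q)) (?q y))"
    by (rule smooth_on_cong[OF o]) (simp add: b_def sec_coord_def dchart_inverse(2)[OF V q(1)])
qed

locale coordinates = smooth_manifold A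
  for A :: "('a::topological_space, 'm::finite) chart set" +
  fixes U :: "'a set" and \<phi> :: "'a \<Rightarrow> real^'m"
  assumes chart: "(U, \<phi>) \<in> A"
begin

abbreviation "\<psi> \<equiv> inv_into U \<phi>"
abbreviation "cf \<equiv> coord_field \<phi>"
abbreviation "d\<phi> \<equiv> dchart A \<phi>"

definition vc :: "('a, 'm) vfield \<Rightarrow> real^'m \<Rightarrow> real^'m" where
  "vc X y = d\<phi> (\<psi> y) (X (\<psi> y))"

text \<open>The Christoffel symbols, as a bilinear map at each point of the chart image.\<close>

definition \<Gamma> :: "('a, 'm) conn \<Rightarrow> real^'m \<Rightarrow> real^'m \<Rightarrow> real^'m \<Rightarrow> real^'m" where
  "\<Gamma> D y a b = vc (D (cf a) (cf b)) y"

lemma open_U: "open U" and open_image: "open W \<Longrightarrow> W \<subseteq> U \<Longrightarrow> open (\<phi> ` W)"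
  using chart_facts[OF chart] by blast+

lemma psi_phi [simp]: "q \<in> U \<Longrightarrow> \<psi> (\<phi> q) = q"
  using chart by simp

lemma phi_psi [simp]: "y \<in> \<phi> ` U \<Longrightarrow> \<phi> (\<psi> y) = y" and psi_in: "y \<in> \<phi> ` U \<Longrightarrow> \<psi> y \<in> U"
  by auto

lemma dphi_cf [simp]: "q \<in> U \<Longrightarrow> d\<phi> q (cf a q) = a"
  unfolding coord_field_def by (rule dchart_inverse[OF chart])

lemma cf_dphi [simp]: "q \<in> U \<Longrightarrow> cf (d\<phi> q v) q = v"
  unfolding coord_field_def by (rule dchart_inverse[OF chart])

lemma linear_dphi: "q \<in> U \<Longrightarrow> linear (d\<phi> q)"
  by (rule dchart_linear[OF chart])

lemma linear_cf: "q \<in> U \<Longrightarrow> linear (\<lambda>a. cf a q)"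
  unfolding coord_field_def by (rule dchart_inverse(3)[OF chart])

lemma smooth_cf: "open W \<Longrightarrow> W \<subseteq> U \<Longrightarrow> smooth_vf A W (cf a)"
  by (rule smooth_vf_subset[OF smooth_coord_field[OF chart]])

lemma smooth_vc: "smooth_vf A W X \<Longrightarrow> W \<subseteq> U \<Longrightarrow> smooth_on (\<phi> ` W) (vc X)"
  unfolding vc_def using smooth_vfD[OF _ chart, of W X] by (simp add: Int_absorb1)

lemma vc_phi: "q \<in> U \<Longrightarrow> vc X (\<phi> q) = d\<phi> q (X q)"
  unfolding vc_def by simp

lemma cf_sum: "q \<in> U \<Longrightarrow> cf (\<Sum>i\<in>I. a i *\<^sub>R x i) q = (\<Sum>i\<in>I. a i *\<^sub>R cf (x i) q)"
  unfolding linear_sum[OF linear_cf] linear_scale[OF linear_cf] ..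

lemma vf_expand: "q \<in> U \<Longrightarrow> X q = (\<Sum>b\<in>Basis. (vc X (\<phi> q) \<bullet> b) *\<^sub>R cf b q)"
proof -
  assume q: "q \<in> U"
  have "X q = cf (\<Sum>b\<in>Basis. (d\<phi> q (X q) \<bullet> b) *\<^sub>R b) q" using q by (simp add: euclidean_representation)
  also have "\<dots> = (\<Sum>b\<in>Basis. (d\<phi> q (X q) \<bullet> b) *\<^sub>R cf b q)"
    by (rule cf_sum[OF q])
  finally show ?thesis using vc_phi[OF q] by simp
qed

lemma smooth_vc_component:
  assumes "smooth_vf A W X" "open W" "W \<subseteq> U"
  shows "smooth_fun A W (\<lambda>q. vc X (\<phi> q) \<bullet> b)"
proof (rule smooth_fun_chart[OF chart assms(2,3)])
  show "smooth_on (\<phi> ` W) (\<lambda>y. vc X (\<phi> (\<psi> y)) \<bullet> b)"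
    by (rule smooth_on_cong[OF open_image[OF assms(2,3)] smooth_on_inner[OF open_image[OF assms(2,3)] smooth_vc[OF assms(1,3)]]])
      (use assms in auto)
qed

lemma smooth_vf_const_combination:
  assumes Z: "smooth_on (\<phi> ` W) Z" and W: "open W" "W \<subseteq> U"
  shows "smooth_vf A W (\<lambda>q. cf (Z (\<phi> q)) q)"
proof -
  have f: "smooth_fun A W (\<lambda>q. Z (\<phi> q) \<bullet> b)" for b
  proof (rule smooth_fun_chart[OF chart W])
    show "smooth_on (\<phi> ` W) (\<lambda>y. Z (\<phi> (\<psi> y)) \<bullet> b)"
      by (rule smooth_on_cong[OF open_image[OF W] smooth_on_inner[OF open_image[OF W] Z]]) (use W in auto)
  qed
  show ?thesis
  proof (rule smooth_vf_cong[OF smooth_vf_sum[OF W(1) smooth_vf_scale[OF W(1) f smooth_cf[OF W]]] W(1)])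
    fix q assume "q \<in> W"
    then have q: "q \<in> U" using W by auto
    have "cf (\<Sum>b\<in>Basis. (Z (\<phi> q) \<bullet> b) *\<^sub>R b) q = (\<Sum>b\<in>Basis. (Z (\<phi> q) \<bullet> b) *\<^sub>R cf b q)"
      by (rule cf_sum[OF q])
    then show "(\<Sum>b\<in>Basis. (Z (\<phi> q) \<bullet> b) *\<^sub>R cf b q) = cf (Z (\<phi> q)) q" by (simp add: euclidean_representation)
  qed
qed

lemma smooth_Gamma: 
  assumes "connection A D" shows "smooth_on (\<phi> ` U) (\<lambda>y. \<Gamma> D y a b)"
  unfolding \<Gamma>_def
  by (rule smooth_vc[OF connection_smooth[OF assms open_U]]) (auto intro: smooth_cf open_U)

lemma bilinear_Gamma:
  assumes D: "connection A D" and y: "y \<in> \<phi> ` U"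
  shows "bilinear (\<Gamma> D y)"
proof -
  have q: "\<psi> y \<in> U" using psi_in[OF y] .
  note s = smooth_cf[OF open_U subset_refl]
  have add: "cf (a + b) r = cf a r + cf b r" and scale: "cf (t *\<^sub>R a) r = t *\<^sub>R cf a r" if "r \<in> U" for a b t r
    using linear_simps[OF linear_cf[OF that]] by auto
  note ss = smooth_vf_add[OF open_U s s] smooth_vf_scale[OF open_U smooth_fun_const[OF open_U] s]
  note lin = linear_simps[OF linear_dphi[OF q]]
  have z: "dirderiv A (\<lambda>q. t) (\<psi> y) v = 0" for t v unfolding dirderiv_alt by simp
  have "D (cf (a + b)) (cf d) (\<psi> y) = D (\<lambda>q. cf a q + cf b q) (cf d) (\<psi> y)" for a b d
    by (rule connection_local[OF D open_U s s q]) (auto simp: add)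
  moreover have "D (cf d) (cf (a + b)) (\<psi> y) = D (cf d) (\<lambda>q. cf a q + cf b q) (\<psi> y)" for a b d
    by (rule connection_local[OF D open_U s s q]) (auto simp: add)
  moreover have "D (cf (t *\<^sub>R a)) (cf d) (\<psi> y) = D (\<lambda>q. t *\<^sub>R cf a q) (cf d) (\<psi> y)" for a t d
    by (rule connection_local[OF D open_U s s q]) (auto simp: scale)
  moreover have "D (cf d) (cf (t *\<^sub>R a)) (\<psi> y) = D (cf d) (\<lambda>q. t *\<^sub>R cf a q) (\<psi> y)" for a t d
    by (rule connection_local[OF D open_U s s q]) (auto simp: scale)
  ultimately show ?thesis
    unfolding bilinear_def \<Gamma>_def vc_def
    using connection_add[OF D open_U s s s q] connection_scale[OF D open_U s s smooth_fun_const[OF open_U] q]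
    by (auto intro!: linearI simp: lin z)
qed

text \<open>By locality both fields may be replaced near \<open>q\<close> by their expansions in the
  coordinate frame; the derivative term comes from the coefficients of \<open>Y\<close>.\<close>

lemma connection_coord:
  assumes D: "connection A D" and W: "open W" "W \<subseteq> U" and X: "smooth_vf A W X" and Y: "smooth_vf A W Y"
    and y: "y \<in> \<phi> ` W"
  shows "vc (D X Y) y = dd (vc Y) y (vc X y) + \<Gamma> D y (vc X y) (vc Y y)"
proof -
  obtain q where q: "q \<in> W" "y = \<phi> q" using y by auto
  then have qU: "q \<in> U" using W by auto
  have yU: "y \<in> \<phi> ` U" using q qU by auto
  define f where "f Z b q = vc Z (\<phi> q) \<bullet> b" for Z b q
  note fs = smooth_vc_component[OF _ W, folded f_def]
  note s = smooth_cf[OF W]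
  have XY: "D X Y q = D (\<lambda>q. \<Sum>b\<in>Basis. f X b q *\<^sub>R cf b q) (\<lambda>q. \<Sum>b\<in>Basis. f Y b q *\<^sub>R cf b q) q"
    by (rule connection_local[OF D W(1) X Y q(1)]; unfold f_def; rule vf_expand) (use W in auto)
  have sX: "smooth_vf A W (\<lambda>q. \<Sum>b\<in>Basis. f X b q *\<^sub>R cf b q)"
    by (intro smooth_vf_sum smooth_vf_scale W(1) fs X s)
  have Xq: "(\<Sum>b\<in>Basis. f X b q *\<^sub>R cf b q) = X q"
    using vf_expand[OF qU, of X] by (simp add: f_def)
  have dir: "dirderiv A (f Y b) q (X q) = dd (vc Y) y (vc X y) \<bullet> b" for b
  proof -
    have o: "open (\<phi> ` W)" by (rule open_image[OF W])
    have sm: "smooth_on (\<phi> ` W) (\<lambda>y. vc Y y \<bullet> b)" by (rule smooth_on_inner[OF o smooth_vc[OF Y W(2)]])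
    have eq: "vc Y y \<bullet> b = f Y b (\<psi> y)" if "y \<in> \<phi> ` W" for y using that W by (auto simp: f_def)
    have "dirderiv A (f Y b) q (X q) = dd (\<lambda>y. f Y b (\<psi> y)) (\<phi> q) (d\<phi> q (X q))"
      by (rule dirderiv_chart[OF chart qU])
        (rule smooth_on_differentiable[OF smooth_on_cong[OF o sm eq]]; use q in auto)
    also have "dd (\<lambda>y. f Y b (\<psi> y)) (\<phi> q) = dd (\<lambda>y. vc Y y \<bullet> b) (\<phi> q)"
      by (rule dd_cong[OF o, symmetric]) (use q eq in auto)
    also have "dd (\<lambda>y. vc Y y \<bullet> b) (\<phi> q) (d\<phi> q (X q)) = dd (vc Y) (\<phi> q) (d\<phi> q (X q)) \<bullet> b"
      by (rule dd_linear_comp[OF bounded_linear_inner_left smooth_vc[OF Y W(2)]]) (use q in auto)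
    finally show ?thesis using q vc_phi[OF qU, of X] by simp
  qed
  have "D X Y q = (\<Sum>b\<in>Basis. f Y b q *\<^sub>R D (\<lambda>q. \<Sum>b\<in>Basis. f X b q *\<^sub>R cf b q) (cf b) q + dirderiv A (f Y b) q (X q) *\<^sub>R cf b q)"
    unfolding XY using connection_sum(2)[OF D W(1) q(1) sX, of Basis "f Y" cf] fs[OF Y] s Xq by simp
  also have "\<dots> = (\<Sum>b\<in>Basis. f Y b q *\<^sub>R (\<Sum>a\<in>Basis. f X a q *\<^sub>R D (cf a) (cf b) q) + (dd (vc Y) y (vc X y) \<bullet> b) *\<^sub>R cf b q)"
    using connection_sum(1)[OF D W(1) q(1) s, of Basis "f X" cf] fs[OF X] s dir by simp
  finally have "d\<phi> q (D X Y q) = (\<Sum>b\<in>Basis. f Y b q *\<^sub>R (\<Sum>a\<in>Basis. f X a q *\<^sub>R d\<phi> q (D (cf a) (cf b) q)) + (dd (vc Y) y (vc X y) \<bullet> b) *\<^sub>R b)"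
    using qU by (simp add: linear_sum[OF linear_dphi[OF qU]] linear_simps[OF linear_dphi[OF qU]])
  also have "\<dots> = (\<Sum>b\<in>Basis. f Y b q *\<^sub>R (\<Sum>a\<in>Basis. f X a q *\<^sub>R \<Gamma> D y a b)) + dd (vc Y) y (vc X y)"
    using q qU by (simp add: sum.distrib euclidean_representation \<Gamma>_def vc_def)
  also have "(\<Sum>b\<in>Basis. f Y b q *\<^sub>R (\<Sum>a\<in>Basis. f X a q *\<^sub>R \<Gamma> D y a b)) = \<Gamma> D y (vc X y) (vc Y y)"
  proof -
    have lin: "linear (\<Gamma> D y a)" "linear (\<lambda>a. \<Gamma> D y a b)" for a b
      using bilinear_Gamma[OF D yU] unfolding bilinear_def by auto
    have "\<Gamma> D y (vc X y) (vc Y y) = \<Gamma> D y (vc X y) (\<Sum>b\<in>Basis. f Y b q *\<^sub>R b)"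
      using q by (simp add: f_def euclidean_representation)
    also have "\<dots> = (\<Sum>b\<in>Basis. f Y b q *\<^sub>R \<Gamma> D y (vc X y) b)"
      by (simp add: linear_sum[OF lin(1)] linear_scale[OF lin(1)])
    also have "\<dots> = (\<Sum>b\<in>Basis. f Y b q *\<^sub>R \<Gamma> D y (\<Sum>a\<in>Basis. f X a q *\<^sub>R a) b)"
      using q by (simp add: f_def euclidean_representation)
    finally show ?thesis by (simp add: linear_sum[OF lin(2)] linear_scale[OF lin(2)])
  qed
  finally show ?thesis using vc_phi[OF qU, of "D X Y"] q by (simp add: add.commute)
qed

section \<open>Torsion and curvature in a chart\<close>

text \<open>The bracket at \<open>q\<close> is taken in \<open>pchart A q\<close>, where the
  components of \<open>cf b\<close> are the derivative of the transition map in the direction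
  \<open>b\<close>. It is thus a difference of mixed second derivatives of that map.\<close>

lemma lie_bracket_cf:
  assumes q: "q \<in> U"
  shows "lie_bracket A (cf a) (cf b) q = 0"
proof -
  let ?V = "pdom A q" and ?\<eta> = "pmap A q"
  let ?t = "\<lambda>y. ?\<eta> (\<psi> y)"
  note V = pchart_mem[of q]
  let ?S = "\<phi> ` (U \<inter> ?V)"
  have o: "open ?S" using chart_facts(4)[OF chart] chart_facts(1)[OF V] by blast
  have t: "smooth_on ?S ?t" by (rule transition_smooth[OF chart V])
  have in': "\<phi> q \<in> ?S" using q in_pdom by auto
  have eq: "dd ?t y b = vec_coord A ?\<eta> (cf b) (\<psi> y)" if y: "y \<in> ?S" for y b
  proof -
    have r: "\<psi> y \<in> U" "\<psi> y \<in> ?V" "y = \<phi> (\<psi> y)" using y by auto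
    show ?thesis unfolding vec_coord_def dchart_transition[OF chart V r(1,2)] using r by simp
  qed
  have "dirderiv A (vec_coord A ?\<eta> (cf b)) q (cf a q) = dd (\<lambda>y. dd ?t y b) (\<phi> q) a" for a b
  proof -
    have "dirderiv A (vec_coord A ?\<eta> (cf b)) q (cf a q)
        = dd (\<lambda>y. vec_coord A ?\<eta> (cf b) (\<psi> y)) (\<phi> q) (d\<phi> q (cf a q))"
      by (rule dirderiv_chart[OF chart q])
        (rule smooth_on_differentiable[OF smooth_on_cong[OF o smooth_on_dd_const[OF t] eq] in'])
    also have "\<dots> = dd (\<lambda>y. dd ?t y b) (\<phi> q) (d\<phi> q (cf a q))"
      using dd_cong[OF o in' eq] by simp
    finally show ?thesis using q by simp
  qed
  then show ?thesis
    unfolding lie_bracket_def using second_derivative_symmetric[OF o t in', of a b] by simp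
qed

lemma Gamma_sym:
  assumes "connection A D" "torsion_free A D" "y \<in> \<phi> ` U"
  shows "\<Gamma> D y a b = \<Gamma> D y b a"
proof -
  have "D (cf a) (cf b) (\<psi> y) - D (cf b) (cf a) (\<psi> y) = lie_bracket A (cf a) (cf b) (\<psi> y)"
    using assms(2) open_U smooth_cf[OF open_U] psi_in[OF assms(3)] unfolding torsion_free_def by blast
  then show ?thesis unfolding \<Gamma>_def vc_def lie_bracket_cf[OF psi_in[OF assms(3)]] by simp
qed

definition Rm :: "('a, 'm) conn \<Rightarrow> real^'m \<Rightarrow> real^'m \<Rightarrow> real^'m \<Rightarrow> real^'m \<Rightarrow> real^'m" where
  "Rm D y u v w = dd (\<lambda>y. \<Gamma> D y v w) y u - dd (\<lambda>y. \<Gamma> D y u w) y v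
     + \<Gamma> D y u (\<Gamma> D y v w) - \<Gamma> D y v (\<Gamma> D y u w)"

text \<open>Tensoriality of the curvature by direct computation: derivatives of \<open>X\<close> and
  \<open>Y\<close> cancel against the bracket term, second derivatives of \<open>Z\<close> cancel by
  symmetry.\<close>

lemma riem_coord:
  assumes D: "connection A D" "torsion_free A D" and W: "open W" "W \<subseteq> U" and q: "q \<in> W"
    and X: "smooth_vf A W X" and Y: "smooth_vf A W Y" and Z: "smooth_vf A W Z"
  shows "d\<phi> q (riem A D X Y Z q) = Rm D (\<phi> q) (d\<phi> q (X q)) (d\<phi> q (Y q)) (d\<phi> q (Z q))"
proof -
  let ?S = "\<phi> ` W"
  have o: "open ?S" by (rule open_image[OF W])
  have qU: "q \<in> U" and y: "\<phi> q \<in> ?S" using q W by auto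
  have SU: "z \<in> ?S \<Longrightarrow> z \<in> \<phi> ` U" for z using W by auto
  note bil = bilinear_Gamma[OF D(1) SU]
  have sG: "smooth_on ?S (\<lambda>y. \<Gamma> D y a b)" for a b
    by (rule smooth_on_subset[OF smooth_Gamma[OF D(1)]]) (use W in auto)
  define x where "x = vc X" define z where "z = vc Z" define w where "w = vc Y"
  have s: "smooth_on ?S x" "smooth_on ?S z" "smooth_on ?S w"
    unfolding x_def z_def w_def by (intro smooth_vc X Y Z W(2))+
  have twice: "vc (D X' (D Y' Z)) (\<phi> q) = dd (\<lambda>p. dd z p (vc Y' (\<phi> q))) (\<phi> q) (vc X' (\<phi> q))
      + dd z (\<phi> q) (dd (vc Y') (\<phi> q) (vc X' (\<phi> q)))
      + dd (\<lambda>p. \<Gamma> D p (vc Y' (\<phi> q)) (z (\<phi> q))) (\<phi> q) (vc X' (\<phi> q))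
      + \<Gamma> D (\<phi> q) (dd (vc Y') (\<phi> q) (vc X' (\<phi> q))) (z (\<phi> q)) + \<Gamma> D (\<phi> q) (vc Y' (\<phi> q)) (dd z (\<phi> q) (vc X' (\<phi> q)))
      + \<Gamma> D (\<phi> q) (vc X' (\<phi> q)) (dd z (\<phi> q) (vc Y' (\<phi> q))) + \<Gamma> D (\<phi> q) (vc X' (\<phi> q)) (\<Gamma> D (\<phi> q) (vc Y' (\<phi> q)) (z (\<phi> q)))"
    if X': "smooth_vf A W X'" and Y': "smooth_vf A W Y'" for X' Y'
  proof -
    note sy = smooth_vc[OF Y' W(2)]
    have eq: "vc (D Y' Z) p = dd z p (vc Y' p) + \<Gamma> D p (vc Y' p) (z p)" if "p \<in> ?S" for p
      unfolding z_def by (rule connection_coord[OF D(1) W Y' Z that])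
    have s1: "smooth_on ?S (\<lambda>p. dd z p (vc Y' p))" by (rule smooth_on_dd[OF o s(2) sy])
    have s2: "smooth_on ?S (\<lambda>p. \<Gamma> D p (vc Y' p) (z p))"
      by (rule smooth_on_bilinear_family[OF o bil sG sy s(2)])
    have "dd (vc (D Y' Z)) (\<phi> q) v = dd (\<lambda>p. dd z p (vc Y' p)) (\<phi> q) v + dd (\<lambda>p. \<Gamma> D p (vc Y' p) (z p)) (\<phi> q) v" for v
      using dd_cong[OF o y eq] dd_add[OF s1 s2 y] by simp
    also have "dd (\<lambda>p. dd z p (vc Y' p)) (\<phi> q) v = dd (\<lambda>p. dd z p (vc Y' (\<phi> q))) (\<phi> q) v + dd z (\<phi> q) (dd (vc Y') (\<phi> q) v)" for v
      by (rule dd_linear_family[OF o smooth_on_linear_dd[OF s(2)] smooth_on_dd_const[OF s(2)] sy y])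
    also have "dd (\<lambda>p. \<Gamma> D p (vc Y' p) (z p)) (\<phi> q) v = dd (\<lambda>p. \<Gamma> D p (vc Y' (\<phi> q)) (z (\<phi> q))) (\<phi> q) v
        + \<Gamma> D (\<phi> q) (dd (vc Y') (\<phi> q) v) (z (\<phi> q)) + \<Gamma> D (\<phi> q) (vc Y' (\<phi> q)) (dd z (\<phi> q) v)" for v
      by (rule dd_bilinear_family[OF o bil sG sy s(2) y])
    finally have d: "dd (vc (D Y' Z)) (\<phi> q) v = dd (\<lambda>p. dd z p (vc Y' (\<phi> q))) (\<phi> q) v + dd z (\<phi> q) (dd (vc Y') (\<phi> q) v)
       + (dd (\<lambda>p. \<Gamma> D p (vc Y' (\<phi> q)) (z (\<phi> q))) (\<phi> q) v
        + \<Gamma> D (\<phi> q) (dd (vc Y') (\<phi> q) v) (z (\<phi> q)) + \<Gamma> D (\<phi> q) (vc Y' (\<phi> q)) (dd z (\<phi> q) v))" for v .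
    show ?thesis
      unfolding connection_coord[OF D(1) W X' connection_smooth[OF D(1) W(1) Y' Z] y] d eq[OF y]
        bilinear_radd[OF bil[OF y]] by (simp add: algebra_simps)
  qed
  \<comment> \<open>\<open>lie_bracket\<close> refers to a chart that changes with the point.
    Torsion-freeness replaces it by \<open>D\<close>, whose form in the fixed chart is
    known.\<close>
  have br: "lie_bracket A X Y p = D X Y p - D Y X p" if "p \<in> W" for p
    using D(2) W(1) X Y that unfolding torsion_free_def by metis
  have sbr: "smooth_vf A W (lie_bracket A X Y)"
  proof (rule smooth_vf_cong[OF smooth_vf_add[OF W(1) connection_smooth[OF D(1) W(1) X Y]
        smooth_vf_scale[OF W(1) smooth_fun_const[OF W(1), of "-1"] connection_smooth[OF D(1) W(1) Y X]]] W(1)])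
  qed (simp add: br)
  have vbr: "vc (lie_bracket A X Y) (\<phi> q) = dd w (\<phi> q) (x (\<phi> q)) - dd x (\<phi> q) (w (\<phi> q))"
  proof -
    have "vc (lie_bracket A X Y) (\<phi> q) = vc (D X Y) (\<phi> q) - vc (D Y X) (\<phi> q)"
      using br[OF q] qU by (simp add: vc_def linear_diff[OF linear_dphi])
    then show ?thesis
      unfolding connection_coord[OF D(1) W X Y y] connection_coord[OF D(1) W Y X y] x_def w_def
      using Gamma_sym[OF D SU[OF y], of "vc X (\<phi> q)" "vc Y (\<phi> q)"] by simp
  qed
  have "d\<phi> q (riem A D X Y Z q) = vc (D X (D Y Z)) (\<phi> q) - vc (D Y (D X Z)) (\<phi> q) - vc (D (lie_bracket A X Y) Z) (\<phi> q)"
    using qU by (simp add: riem_def vc_def linear_diff[OF linear_dphi])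
  also have "\<dots> = Rm D (\<phi> q) (x (\<phi> q)) (w (\<phi> q)) (z (\<phi> q))"
    unfolding twice[OF X Y] twice[OF Y X] connection_coord[OF D(1) W sbr Z y] vbr
      x_def[symmetric] w_def[symmetric] z_def[symmetric] Rm_def
      second_derivative_symmetric[OF o s(2) y, of "x (\<phi> q)" "w (\<phi> q)"]
      linear_diff[OF smooth_on_linear_dd[OF s(2) y]] bilinear_lsub[OF bil[OF y]]
    by (simp add: algebra_simps)
  finally show ?thesis using vc_phi[OF qU] by (simp add: x_def w_def z_def)
qed

lemma linear_Rm:
  assumes D: "connection A D" and y: "y \<in> \<phi> ` U"
  shows "linear (\<lambda>u. Rm D y u v w)"
proof -
  have o: "open (\<phi> ` U)" by (rule open_image[OF open_U subset_refl])
  note bil = bilinear_Gamma[OF D]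
  have l1: "linear (dd (\<lambda>y. \<Gamma> D y v w) y)" by (rule smooth_on_linear_dd[OF smooth_Gamma[OF D] y])
  have l2: "linear (\<lambda>u. dd (\<lambda>y. \<Gamma> D y u w) y v)"
    by (rule linear_dd_family[where L="\<lambda>y u. \<Gamma> D y u w", OF o _ smooth_Gamma[OF D] y])
      (use bil in \<open>auto simp: bilinear_def\<close>)
  show ?thesis unfolding Rm_def
    by (intro linearI) (simp_all add: linear_simps[OF l1] linear_simps[OF l2]
      bilinear_simps[OF bil[OF y]] algebra_simps)
qed

text \<open>\<open>ric\<close> uses extensions that are constant in a different chart; tensoriality
  of the curvature and conjugation invariance of the trace remove the discrepancy.\<close>

lemma ric_coord:
  assumes D: "connection A D" "torsion_free A D" and q: "q \<in> U"
  shows "ric A D q (cf u q) (cf v q) = trace (matrix (\<lambda>w. Rm D (\<phi> q) w u v))"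
proof -
  let ?W = "pdom A q \<inter> U"
  have W: "open ?W" "?W \<subseteq> U" using chart_facts(1)[OF pchart_mem] open_U by auto
  have qW: "q \<in> ?W" using q in_pdom by auto
  have s: "smooth_vf A ?W (cext A q a)" for a
    unfolding cext_eq by (rule smooth_vf_subset[OF smooth_coord_field[OF pchart_mem]]) auto
  have c: "cext A q a q = a" for a
    unfolding cext_def using dchart_inverse(2)[OF pchart_mem in_pdom, of q a] dchart_pmap by simp
  have "riem A D (cext A q w) (cext A q (cf u q)) (cext A q (cf v q)) q = cf (Rm D (\<phi> q) (d\<phi> q w) u v) q" for w
    using riem_coord[OF D W qW s s s, of w "cf u q" "cf v q"] q unfolding c by (metis cf_dphi dphi_cf)
  then have "ric A D q (cf u q) (cf v q) = trace (matrix (\<lambda>w. cf (Rm D (\<phi> q) (d\<phi> q w) u v) q))"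
    unfolding ric_def by simp
  also have "\<dots> = trace (matrix (\<lambda>w. Rm D (\<phi> q) w u v))"
    by (rule trace_conj[OF linear_Rm[OF D(1)] linear_cf[OF q] linear_dphi[OF q]]) (use q in auto)
  finally show ?thesis .
qed

end

section \<open>Weyl structures in a local gauge\<close>

text \<open>In a slice chart this subspace models both \<open>N\<close> itself and its tangent
  spaces.\<close>

definition coord_subspace :: "'m set \<Rightarrow> (real^'m) set" where
  "coord_subspace J = {v. \<forall>i. i \<notin> J \<longrightarrow> v $ i = 0}"

lemma subspace_coord_subspace: "subspace (coord_subspace J)"
  unfolding coord_subspace_def by (rule subspaceI) auto

lemma span_axis: "span ((\<lambda>j. axis j 1) ` J) = coord_subspace (J :: 'm::finite set)"
proof
  show "span ((\<lambda>j. axis j 1) ` J) \<subseteq> coord_subspace J"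
    by (rule span_minimal[OF _ subspace_coord_subspace]) (auto simp: coord_subspace_def axis_def)
  show "coord_subspace J \<subseteq> span ((\<lambda>j. axis j 1) ` J)"
  proof
    fix v :: "real^'m" assume v: "v \<in> coord_subspace J"
    have "v = (\<Sum>i\<in>UNIV. v $ i *\<^sub>R axis i 1)"
      using basis_expansion[of v] by (simp add: scalar_mult_eq_scaleR)
    also have "\<dots> = (\<Sum>i\<in>J. v $ i *\<^sub>R axis i 1)"
      using v by (intro sum.mono_neutral_right) (auto simp: coord_subspace_def)
    also have "\<dots> \<in> span ((\<lambda>j. axis j 1) ` J)"
      by (intro span_sum span_scale span_base) auto
    finally show "v \<in> span ((\<lambda>j. axis j 1) ` J)" .
  qed
qed

lemma coord_subspace_UNIV [simp]: "coord_subspace UNIV = UNIV"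
  unfolding coord_subspace_def by simp

text \<open>Gram-Schmidt on the coordinate vectors with index in \<open>J\<close>, carried out at
  all points of \<open>S\<close> simultaneously. Indexing by \<open>J\<close> with injectivity turns
  a sum over a varying basis into a sum of smooth functions over a fixed set.\<close>

lemma smooth_orthonormal_frame:
  fixes g :: "'x::real_normed_vector \<Rightarrow> real^'m \<Rightarrow> real^'m \<Rightarrow> real" and J :: "'m set"
  assumes o: "open S" and g: "\<And>y. y \<in> S \<Longrightarrow> inner_form (g y)" and s: "\<And>a b. smooth_on S (\<lambda>y. g y a b)"
  shows "\<exists>fr. (\<forall>j\<in>J. smooth_on S (fr j)) \<and> (\<forall>y\<in>S. inj_on (\<lambda>j. fr j y) J \<and>
    onb (g y) (coord_subspace J) ((\<lambda>j. fr j y) ` J))"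
proof -
  have "finite J" by simp
  then show ?thesis
  proof (induction J rule: finite_induct)
    case empty
    then show ?case by (auto simp: orthonormal_basis_of_def coord_subspace_def vec_eq_iff)
  next
    case (insert i J)
    then obtain fr where fr: "\<And>j. j \<in> J \<Longrightarrow> smooth_on S (fr j)"
      "\<And>y. y \<in> S \<Longrightarrow> inj_on (\<lambda>j. fr j y) J"
      "\<And>y. y \<in> S \<Longrightarrow> onb (g y) (coord_subspace J) ((\<lambda>j. fr j y) ` J)" by blast
    let ?a = "axis i 1 :: real^'m"
    have nin: "?a \<notin> coord_subspace J" using insert.hyps by (auto simp: coord_subspace_def axis_def)
    define w where "w y = ?a - (\<Sum>j\<in>J. g y ?a (fr j y) *\<^sub>R fr j y)" for y
    define n where "n y = (g y (w y) (w y)) powr (- 1 / 2)" for y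
    have bil: "bilinear (g y)" if "y \<in> S" for y using g[OF that] by (rule inner_formD(1))
    have w': "w y = ?a - (\<Sum>e\<in>(\<lambda>j. fr j y) ` J. g y ?a e *\<^sub>R e)" if "y \<in> S" for y
      unfolding w_def using fr(2)[OF that] by (simp add: sum.reindex)
    note gs = gram_schmidt_step[OF fr(3) g nin w']
    have n': "n y *\<^sub>R w y = w y /\<^sub>R sqrt (g y (w y) (w y))" if "y \<in> S" for y
      using gs(1)[OF that that that] unfolding n_def by (simp add: powr_minus powr_half_sqrt)
    have sw: "smooth_on S w" unfolding w_def
      by (intro smooth_on_diff smooth_on_const smooth_on_sum smooth_on_scaleR o fr(1)
        smooth_on_bilinear_family[OF o bil s])
    have sn: "smooth_on S n" unfolding n_def
      by (intro smooth_on_powr o smooth_on_bilinear_family[OF o bil s] sw gs(1))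
    define fr' where "fr' = fr(i := \<lambda>y. n y *\<^sub>R w y)"
    have im: "(\<lambda>j. fr' j y) ` insert i J = insert (w y /\<^sub>R sqrt (g y (w y) (w y))) ((\<lambda>j. fr j y) ` J)"
      if "y \<in> S" for y
      using insert.hyps n'[OF that] by (auto simp: fr'_def)
    have sp: "span (insert ?a (coord_subspace J)) = coord_subspace (insert i J)"
      unfolding span_axis[symmetric] span_insert_span by simp
    have "smooth_on S (fr' j)" if "j \<in> insert i J" for j
      using that fr(1) smooth_on_scaleR[OF o sn sw] by (auto simp: fr'_def)
    moreover have "inj_on (\<lambda>j. fr' j y) (insert i J)" if y: "y \<in> S" for y
    proof -
      have "inj_on (\<lambda>j. fr' j y) J"
        using fr(2)[OF y] insert.hyps by (auto simp: fr'_def inj_on_def)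
      moreover have "fr' i y \<notin> (\<lambda>j. fr' j y) ` (J - {i})"
        using gs(3)[OF y y y] n'[OF y] by (auto simp: fr'_def)
      ultimately show ?thesis by simp
    qed
    moreover have "onb (g y) (coord_subspace (insert i J)) ((\<lambda>j. fr' j y) ` insert i J)"
      if y: "y \<in> S" for y
      unfolding im[OF y] sp[symmetric] by (rule gs(4)[OF y y y])
    ultimately show ?case by blast
  qed
qed

locale conformal_coordinates = coordinates A U \<phi>
  for A :: "('a::topological_space, 'm::finite) chart set" and U and \<phi> :: "'a \<Rightarrow> real^'m" +
  fixes c :: "'a \<Rightarrow> real^'m \<Rightarrow> real^'m \<Rightarrow> real"
  assumes conformal: "conformal_structure A c"
begin

abbreviation "\<Omega> \<equiv> \<phi> ` U"
abbreviation "weyl \<equiv> weyl_structure A c"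
text \<open>Any coordinate direction would serve; \<open>undefined\<close> merely names some
  index.\<close>

abbreviation "e\<^sub>0 \<equiv> axis undefined 1 :: real^'m"

definition \<rho> :: "'a \<Rightarrow> real" where
  "\<rho> q = c q (cf e\<^sub>0 q) (cf e\<^sub>0 q)"

text \<open>Numerator and denominator have weight 2, so this is an ordinary metric in the conformal
  class, with \<open>gg y e\<^sub>0 e\<^sub>0 = 1\<close> on the chart image.\<close>

definition gg :: "real^'m \<Rightarrow> real^'m \<Rightarrow> real^'m \<Rightarrow> real" where
  "gg y a b = c (\<psi> y) (cf a (\<psi> y)) (cf b (\<psi> y)) / \<rho> (\<psi> y)"

text \<open>Compatibility with \<open>c\<close> gives
  \<open>\<nabla>\<rho> = 2 \<alpha> \<rho>\<close>, so \<alpha> is the connection form of weight 1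
  with respect to the unit \<open>\<rho> powr (1 / 2)\<close>.\<close>

definition \<alpha> :: "('a, 'm) conn \<Rightarrow> real^'m \<Rightarrow> real^'m \<Rightarrow> real" where
  "\<alpha> D y a = gg y (\<Gamma> D y a e\<^sub>0) e\<^sub>0"

text \<open>The weight \<open>k\<close> section \<open>l\<close> in the gauge \<open>\<rho>\<close>; \<open>der\<close> below is its covariant derivative.\<close>
definition fr :: "real \<Rightarrow> ('a \<Rightarrow> real) \<Rightarrow> real^'m \<Rightarrow> real" where
  "fr k l y = l (\<psi> y) * \<rho> (\<psi> y) powr (- k / 2)"

definition der :: "('a, 'm) conn \<Rightarrow> real \<Rightarrow> (real^'m \<Rightarrow> real) \<Rightarrow> real^'m \<Rightarrow> real^'m \<Rightarrow> real" where
  "der D k f y a = dd f y a + k * \<alpha> D y a * f y"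

lemma open_\<Omega>: "open \<Omega>"
  by (rule open_image[OF open_U subset_refl])

lemma c_smooth: "smooth_bil A 2 UNIV c"
  using conformal unfolding conformal_structure_def by blast

lemma c_inner: "inner_form (c q)"
  using conformal unfolding conformal_structure_def smooth_bil_def inner_form_def by blast

lemma rho_pos: assumes "q \<in> U" shows "\<rho> q > 0"
proof -
  have "cf e\<^sub>0 q \<noteq> 0" using dphi_cf[OF assms, of e\<^sub>0] linear_0[OF linear_dphi[OF assms]] by (metis axis_eq_0_iff zero_neq_one)
  then show ?thesis unfolding \<rho>_def by (rule inner_formD(3)[OF c_inner])
qed

lemma c_cf: "q \<in> U \<Longrightarrow> c q (cf a q) (cf b q) = \<rho> q * gg (\<phi> q) a b"
  using rho_pos[of q] by (simp add: gg_def)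

lemma c_gg: "q \<in> U \<Longrightarrow> c q u v = \<rho> q * gg (\<phi> q) (d\<phi> q u) (d\<phi> q v)"
  using c_cf[of q "d\<phi> q u" "d\<phi> q v"] by simp

lemma gg_inner: assumes y: "y \<in> \<Omega>" shows "inner_form (gg y)"
proof -
  have q: "\<psi> y \<in> U" by (rule psi_in[OF y])
  note l = linear_simps[OF linear_cf[OF q]]
  note b = bilinear_simps[OF inner_formD(1)[OF c_inner]]
  have "bilinear (gg y)" unfolding bilinear_def gg_def
    by (intro conjI allI linearI) (simp_all add: l b add_divide_distrib)
  moreover have "gg y u v = gg y v u" for u v unfolding gg_def by (metis inner_formD(2)[OF c_inner])
  moreover have "gg y u u > 0" if "u \<noteq> 0" for u
  proof -
    have "cf u (\<psi> y) \<noteq> 0" using that dphi_cf[OF q, of u] linear_0[OF linear_dphi[OF q]] by metis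
    then show ?thesis unfolding gg_def using rho_pos[OF q] inner_formD(3)[OF c_inner] by simp
  qed
  ultimately show ?thesis unfolding inner_form_def by blast
qed

lemma bilinear_gg: "y \<in> \<Omega> \<Longrightarrow> bilinear (gg y)"
  using gg_inner inner_formD(1) by blast

text \<open>The Jacobian powers by which the two weight 2 quantities enter are equal and cancel in
  the quotient.\<close>

lemma smooth_gg: "smooth_on \<Omega> (\<lambda>y. gg y a b)"
proof -
  define s where "s a b y = sec_coord A 2 \<phi> (\<lambda>q. c q (cf a q) (cf b q)) (\<psi> y)" for a b y
  have s: "smooth_on \<Omega> (s a b)" for a b
    using smooth_secD[OF smooth_bil_fields[OF c_smooth open_U _ smooth_cf smooth_cf] chart, of a b] open_U
    unfolding s_def by simp
  have eq: "s a b y = jac A \<phi> (\<psi> y) powr (2 / real CARD('m)) * c (\<psi> y) (cf a (\<psi> y)) (cf b (\<psi> y))" for a b y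
    unfolding s_def sec_coord_def ..
  have j: "jac A \<phi> (\<psi> y) powr (2 / real CARD('m)) > 0" if "y \<in> \<Omega>" for y
    using jac_pos[OF chart psi_in[OF that]] by simp
  have pos: "s e\<^sub>0 e\<^sub>0 y > 0" if "y \<in> \<Omega>" for y
    unfolding eq using j[OF that] rho_pos[OF psi_in[OF that]] by (simp add: \<rho>_def)
  show ?thesis
  proof (rule smooth_on_cong[OF open_\<Omega> smooth_on_mult[OF open_\<Omega> s smooth_on_powr[OF open_\<Omega> s pos, of "-1"]]])
    fix y assume y: "y \<in> \<Omega>"
    show "s a b y * s e\<^sub>0 e\<^sub>0 y powr - 1 = gg y a b"
      using pos[OF y] j[OF y] rho_pos[OF psi_in[OF y]]
      by (simp add: powr_minus_divide eq gg_def \<rho>_def)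
  qed
qed

lemma smooth_rho: "smooth_sec A 2 U \<rho>"
  unfolding \<rho>_def using smooth_bil_fields[OF c_smooth open_U _ smooth_cf smooth_cf] open_U by simp

lemma jac_powr_cancel:
  assumes j: "jac A \<eta> r > 0" and r: "\<rho> r > 0"
  shows "sec_coord A 2 \<eta> \<rho> r powr (k / 2) = jac A \<eta> r powr (k / real CARD('m)) * \<rho> r powr (k / 2)"
  unfolding sec_coord_def using j r by (simp add: powr_mult powr_powr)

lemma sec_coord_pos: "jac A \<eta> r > 0 \<Longrightarrow> \<rho> r > 0 \<Longrightarrow> sec_coord A 2 \<eta> \<rho> r > 0"
  unfolding sec_coord_def by simp

lemma smooth_fr:
  assumes l: "smooth_sec A k W l" and W: "open W" "W \<subseteq> U"
  shows "smooth_on (\<phi> ` W) (fr k l)"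
proof -
  let ?S = "\<phi> ` W"
  note o = open_image[OF W]
  have q: "\<psi> y \<in> U" if "y \<in> ?S" for y using that W by auto
  have s1: "smooth_on ?S (\<lambda>y. sec_coord A k \<phi> l (\<psi> y))" using smooth_secD[OF l chart] W by (simp add: Int_absorb1)
  have s2: "smooth_on ?S (\<lambda>y. sec_coord A 2 \<phi> \<rho> (\<psi> y))"
    by (rule smooth_on_subset[OF smooth_secD[OF smooth_rho chart]]) (use W in auto)
  have pos: "sec_coord A 2 \<phi> \<rho> (\<psi> y) > 0" if "y \<in> ?S" for y
    by (rule sec_coord_pos[OF jac_pos[OF chart q[OF that]] rho_pos[OF q[OF that]]])
  show ?thesis
  proof (rule smooth_on_cong[OF o smooth_on_mult[OF o s1 smooth_on_powr[OF o s2 pos, of "- k / 2"]]])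
    fix y assume y: "y \<in> ?S"
    note j = jac_pos[OF chart q[OF y]]
    show "sec_coord A k \<phi> l (\<psi> y) * sec_coord A 2 \<phi> \<rho> (\<psi> y) powr (- k / 2) = fr k l y"
      unfolding jac_powr_cancel[OF j rho_pos[OF q[OF y]]] using j
      by (simp add: sec_coord_def fr_def powr_minus)
  qed
qed

text \<open>Converse of \<open>smooth_fr\<close>: formulas in the gauge define smooth sections.
  Applied to \<open>nablaL\<close>, so that it can be iterated, and to the final operator.\<close>

lemma smooth_sec_fr:
  assumes F: "smooth_on (\<phi> ` W) F" and W: "open W" "W \<subseteq> U"
    and l: "\<And>q. q \<in> W \<Longrightarrow> l q = \<rho> q powr (k / 2) * F (\<phi> q)"
  shows "smooth_sec A k W l"
proof (rule smooth_secI)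
  fix V \<eta> assume V: "(V, \<eta>) \<in> A"
  let ?S = "\<eta> ` (V \<inter> W)"
  note o = chart_facts(4)[OF V W(1)]
  have q: "inv_into V \<eta> y \<in> V" "inv_into V \<eta> y \<in> W" "inv_into V \<eta> y \<in> U" if "y \<in> ?S" for y
    using that W V by auto
  have "smooth_fun A W (\<lambda>q. F (\<phi> q))"
    by (rule smooth_fun_chart[OF chart W], rule smooth_on_cong[OF open_image[OF W] F]) (use W in auto)
  note s1 = smooth_funD[OF this V W(1)]
  have s2: "smooth_on ?S (\<lambda>y. sec_coord A 2 \<eta> \<rho> (inv_into V \<eta> y))"
    by (rule smooth_on_subset[OF smooth_secD[OF smooth_rho V]]) (use W in auto)
  have pos: "sec_coord A 2 \<eta> \<rho> (inv_into V \<eta> y) > 0" if "y \<in> ?S" for y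
    by (rule sec_coord_pos[OF jac_pos[OF V q(1)[OF that]] rho_pos[OF q(3)[OF that]]])
  show "smooth_on ?S (\<lambda>y. sec_coord A k \<eta> l (inv_into V \<eta> y))"
  proof (rule smooth_on_cong[OF o smooth_on_mult[OF o smooth_on_powr[OF o s2 pos, of "k / 2"] s1]])
    fix y assume y: "y \<in> ?S"
    show "sec_coord A 2 \<eta> \<rho> (inv_into V \<eta> y) powr (k / 2) * F (\<phi> (inv_into V \<eta> y)) = sec_coord A k \<eta> l (inv_into V \<eta> y)"
      unfolding jac_powr_cancel[OF jac_pos[OF V q(1)[OF y]] rho_pos[OF q(3)[OF y]]]
      by (simp add: sec_coord_def l[OF q(2)[OF y]])
  qed
qed

section \<open>Covariant derivatives and compatibility in the gauge\<close>

lemma weylD: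
  assumes "weyl D"
  shows "connection A D" "torsion_free A D"
  using assms unfolding weyl_structure_def by blast+

lemma weyl_c:
  assumes "weyl D" "open W" "smooth_vf A W X" "smooth_vf A W Y" "smooth_vf A W Z" "q \<in> W"
  shows "nablaL A D 2 X (\<lambda>q. c q (Y q) (Z q)) q = c q (D X Y q) (Z q) + c q (Y q) (D X Z q)"
proof -
  have "nablaL A D 2 X (\<lambda>q. c q (Y q) (Z q)) q - c q (D X Y q) (Z q) - c q (Y q) (D X Z q) = 0"
    using assms unfolding weyl_structure_def by blast
  then show ?thesis by simp
qed

lemma linear_alpha:
  assumes "connection A D" "y \<in> \<Omega>" shows "linear (\<alpha> D y)"
  unfolding \<alpha>_def
  by (intro linearI) (simp_all add: bilinear_ladd[OF bilinear_Gamma[OF assms]] bilinear_lmul[OF bilinear_Gamma[OF assms]]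
    bilinear_ladd[OF bilinear_gg[OF assms(2)]] bilinear_lmul[OF bilinear_gg[OF assms(2)]])

lemma smooth_alpha: assumes "connection A D" shows "smooth_on \<Omega> (\<lambda>y. \<alpha> D y a)"
  unfolding \<alpha>_def
  by (rule smooth_on_bilinear_family[OF open_\<Omega> bilinear_gg smooth_gg smooth_Gamma[OF assms] smooth_on_const])

text \<open>Compatibility of \<open>\<nabla>\<close> with \<open>c\<close>, applied to the section \<open>\<rho>\<close>, determines the trace term in \<open>nablaL\<close>;
  the Leibniz rule for \<open>l = f \<rho>\<^sup>k\<^sup>/\<^sup>2\<close> does the rest.\<close>
lemma nablaL_coord:
  assumes D: "weyl D" and W: "open W" "W \<subseteq> U" and l: "smooth_sec A k W l" and q: "q \<in> W"
  shows "nablaL A D k X l q = \<rho> q powr (k / 2) * der D k (fr k l) (\<phi> q) (d\<phi> q (X q))"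
proof -
  let ?V = "pdom A q" and ?\<eta> = "pmap A q" and ?m = "real CARD('m)"
  let ?i = "inv_into ?V ?\<eta>"
  note V = pchart_mem[of q]
  define x where "x = d\<phi> q (X q)"
  define S where "S y = sec_coord A 2 ?\<eta> \<rho> (?i y)" for y
  define F where "F y = fr k l (\<phi> (?i y))" for y
  define t where "t = trace (matrix (\<lambda>v. D (cext A q (X q)) (cext A q v) q))"
  let ?S = "?\<eta> ` (?V \<inter> W)"
  have qU: "q \<in> U" using q W by auto
  have rp: "\<rho> q > 0" by (rule rho_pos[OF qU])
  have o: "open ?S" by (rule chart_facts(4)[OF V W(1)])
  have in': "?\<eta> q \<in> ?S" using q in_pdom by auto
  have iq: "?i (?\<eta> q) = q" by (rule chart_inv[OF V in_pdom])
  have r: "?i y \<in> ?V" "?i y \<in> W" "?i y \<in> U" if "y \<in> ?S" for y using that W V by auto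
  have oW: "open (\<phi> ` W)" by (rule open_image[OF W])
  note sfr = smooth_fr[OF l W]
  have sS: "smooth_on ?S S" unfolding S_def
    by (rule smooth_on_subset[OF smooth_secD[OF smooth_rho V]]) (use W in auto)
  have frf: "smooth_on (\<phi> ` W) (\<lambda>y. fr k l (\<phi> (\<psi> y)))"
    by (rule smooth_on_cong[OF oW sfr]) (use W in auto)
  have sF: "smooth_on ?S F" unfolding F_def
    by (rule smooth_funD[OF smooth_fun_chart[OF chart W frf] V W(1)])
  have Spos: "S y > 0" if "y \<in> ?S" for y unfolding S_def
    by (rule sec_coord_pos[OF jac_pos[OF V r(1)[OF that]] rho_pos[OF r(3)[OF that]]])
  have Sq: "S (?\<eta> q) = \<rho> q" unfolding S_def iq sec_coord_def jac_pmap by simp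
  have Fq: "F (?\<eta> q) = fr k l (\<phi> q)" unfolding F_def iq ..
  have eq: "sec_coord A k ?\<eta> l (?i y) = F y * S y powr (k / 2)" if y: "y \<in> ?S" for y
    unfolding S_def jac_powr_cancel[OF jac_pos[OF V r(1)[OF y]] rho_pos[OF r(3)[OF y]]] F_def fr_def
    using r[OF y] rho_pos[OF r(3)[OF y]] by (simp add: sec_coord_def powr_minus)
  have d1: "dd (\<lambda>y. sec_coord A k ?\<eta> l (?i y)) (?\<eta> q) v =
      fr k l (\<phi> q) * (k / 2 * \<rho> q powr (k / 2 - 1) * dd S (?\<eta> q) v) + dd F (?\<eta> q) v * \<rho> q powr (k / 2)" for v
  proof -
    have "dd (\<lambda>y. sec_coord A k ?\<eta> l (?i y)) (?\<eta> q) = dd (\<lambda>y. F y * S y powr (k / 2)) (?\<eta> q)"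
      by (rule dd_cong[OF o in' eq])
    also have "\<dots> = (\<lambda>v. F (?\<eta> q) * (k / 2 * S (?\<eta> q) powr (k / 2 - 1) * dd S (?\<eta> q) v) + dd F (?\<eta> q) v * S (?\<eta> q) powr (k / 2))"
      by (rule dd_eq[OF has_derivative_mult[OF smooth_on_has_derivative[OF sF in'] dd_powr[OF sS in' Spos[OF in']]]])
    finally show ?thesis unfolding Sq Fq by simp
  qed
  have d2: "dd F (?\<eta> q) (X q) = dd (fr k l) (\<phi> q) x"
  proof -
    have "dd F (?\<eta> q) (X q) = dd (\<lambda>y. fr k l (\<phi> (\<psi> y))) (\<phi> q) (dd (\<lambda>y. \<phi> (?i y)) (?\<eta> q) (X q))"
      unfolding F_def
      by (rule transition_compose(2)[where f="\<lambda>r. fr k l (\<phi> r)", OF V chart in_pdom qU smooth_on_differentiable[OF frf]])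
        (use q in auto)
    also have "dd (\<lambda>y. fr k l (\<phi> (\<psi> y))) (\<phi> q) = dd (fr k l) (\<phi> q)"
      by (rule dd_cong[OF oW]) (use q W in auto)
    finally show ?thesis unfolding x_def dchart_alt .
  qed
  have d3: "dd S (?\<eta> q) (X q) = 2 * \<rho> q * \<alpha> D (\<phi> q) x - 2 / ?m * t * \<rho> q"
  proof -
    note s = smooth_cf[OF open_U subset_refl]
    have X: "cf x q = X q" unfolding x_def using qU by simp
    have "nablaL A D 2 (cf x) \<rho> q = c q (D (cf x) (cf e\<^sub>0) q) (cf e\<^sub>0 q) + c q (cf e\<^sub>0 q) (D (cf x) (cf e\<^sub>0) q)"
      unfolding \<rho>_def by (rule weyl_c[OF D open_U s s s qU])
    also have "\<dots> = 2 * c q (D (cf x) (cf e\<^sub>0) q) (cf e\<^sub>0 q)"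
      using inner_formD(2)[OF c_inner, of q "cf e\<^sub>0 q" "D (cf x) (cf e\<^sub>0) q"] by simp
    also have "c q (D (cf x) (cf e\<^sub>0) q) (cf e\<^sub>0 q) = \<rho> q * \<alpha> D (\<phi> q) x"
      unfolding \<alpha>_def c_gg[OF qU] \<Gamma>_def using qU by (simp add: vc_phi)
    also have "nablaL A D 2 (cf x) \<rho> q = dd S (?\<eta> q) (X q) + 2 / ?m * t * \<rho> q"
      unfolding nablaL_def X dirderiv_alt S_def t_def ..
    finally show ?thesis by simp
  qed
  have lq: "l q = fr k l (\<phi> q) * \<rho> q powr (k / 2)"
    using rp qU by (simp add: fr_def powr_minus)
  have pw: "\<rho> q powr (k / 2 - 1) * \<rho> q = \<rho> q powr (k / 2)" using rp by (simp add: powr_diff)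
  have "nablaL A D k X l q = fr k l (\<phi> q) * (k / 2 * \<rho> q powr (k / 2 - 1) * (2 * \<rho> q * \<alpha> D (\<phi> q) x - 2 / ?m * t * \<rho> q))
      + dd (fr k l) (\<phi> q) x * \<rho> q powr (k / 2) + k / ?m * t * l q"
    unfolding nablaL_def dirderiv_alt d1 d2 d3 t_def ..
  also have "k / 2 * \<rho> q powr (k / 2 - 1) * (2 * \<rho> q * \<alpha> D (\<phi> q) x - 2 / ?m * t * \<rho> q)
      = (\<rho> q powr (k / 2 - 1) * \<rho> q) * (k * \<alpha> D (\<phi> q) x - k / ?m * t)"
    by (simp add: field_simps)
  finally show ?thesis unfolding pw lq der_def x_def by (simp add: algebra_simps)
qed

lemma fr_nablaL:
  assumes D: "weyl D" and W: "open W" "W \<subseteq> U" and l: "smooth_sec A k W l" and y: "y \<in> \<phi> ` W"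
  shows "fr k (nablaL A D k X l) y = der D k (fr k l) y (vc X y)"
proof -
  have q: "\<psi> y \<in> W" "\<psi> y \<in> U" "\<phi> (\<psi> y) = y" using y W by auto
  show ?thesis unfolding fr_def[of k "nablaL A D k X l"] nablaL_coord[OF D W l q(1)] using q rho_pos[OF q(2)]
    by (simp add: powr_minus vc_def)
qed

lemma linear_der:
  assumes "connection A D" "smooth_on S f" "S \<subseteq> \<Omega>" "y \<in> S"
  shows "linear (der D k f y)"
proof -
  have y: "y \<in> \<Omega>" using assms by auto
  note l = linear_simps[OF smooth_on_linear_dd[OF assms(2,4)]]
    linear_simps[OF linear_alpha[OF assms(1) y]]
  show ?thesis unfolding der_def by (intro linearI) (simp_all add: l algebra_simps)
qed

lemma smooth_der:
  assumes "connection A D" "smooth_on S f" "S \<subseteq> \<Omega>" "open S"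
  shows "smooth_on S (\<lambda>y. der D k f y a)"
  unfolding der_def
  by (intro smooth_on_add smooth_on_mult smooth_on_const smooth_on_dd_const assms
    smooth_on_subset[OF smooth_alpha[OF assms(1)] assms(3)])

lemma smooth_nablaL:
  assumes D: "weyl D" and W: "open W" "W \<subseteq> U" and l: "smooth_sec A k W l" and X: "smooth_vf A W X"
  shows "smooth_sec A k W (nablaL A D k X l)"
proof (rule smooth_sec_fr[OF _ W])
  have S: "\<phi> ` W \<subseteq> \<Omega>" using W by auto
  show "smooth_on (\<phi> ` W) (\<lambda>y. der D k (fr k l) y (vc X y))"
    by (rule smooth_on_linear_family[OF open_image[OF W] linear_der smooth_der])
      (use S smooth_fr[OF l W] weylD[OF D] open_image[OF W] smooth_vc[OF X W(2)] in auto)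
  show "nablaL A D k X l q = \<rho> q powr (k / 2) * der D k (fr k l) (\<phi> q) (vc X (\<phi> q))" if "q \<in> W" for q
    using nablaL_coord[OF D W l that, of X] that W vc_phi[of q X] by auto
qed

text \<open>In the gauge \<open>c\<close> is the weight 2 section represented by \<open>gg\<close>;
  hence \<open>\<nabla>c = 0\<close> says that the covariant derivative of the plain tensor
  \<open>gg\<close> is -2 \<alpha> times \<open>gg\<close>.\<close>

lemma gg_compat:
  assumes D: "weyl D" and y: "y \<in> \<Omega>"
  shows "dd (\<lambda>y. gg y a b) y v = gg y (\<Gamma> D y v a) b + gg y a (\<Gamma> D y v b) - 2 * \<alpha> D y v * gg y a b"
proof -
  note s = smooth_cf[OF open_U subset_refl]
  have q: "\<psi> y \<in> U" "\<phi> (\<psi> y) = y" using y by auto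
  let ?l = "\<lambda>q. c q (cf a q) (cf b q)"
  have l: "smooth_sec A 2 U ?l" using smooth_bil_fields[OF c_smooth open_U _ s s] by simp
  have f: "fr 2 ?l z = gg z a b" if "z \<in> \<Omega>" for z
    using rho_pos[OF psi_in[OF that]] by (simp add: fr_def gg_def powr_minus_divide)
  have "\<rho> (\<psi> y) powr (2/2) * der D 2 (fr 2 ?l) (\<phi> (\<psi> y)) (d\<phi> (\<psi> y) (cf v (\<psi> y)))
      = c (\<psi> y) (D (cf v) (cf a) (\<psi> y)) (cf b (\<psi> y)) + c (\<psi> y) (cf a (\<psi> y)) (D (cf v) (cf b) (\<psi> y))"
    unfolding nablaL_coord[OF D open_U subset_refl l q(1), symmetric]
    by (rule weyl_c[OF D open_U s s s q(1)])
  also have "\<dots> = \<rho> (\<psi> y) * (gg y (\<Gamma> D y v a) b + gg y a (\<Gamma> D y v b))"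
    unfolding c_gg[OF q(1)] \<Gamma>_def vc_def using q by (simp add: algebra_simps)
  finally have "der D 2 (fr 2 ?l) y v = gg y (\<Gamma> D y v a) b + gg y a (\<Gamma> D y v b)"
    using rho_pos[OF q(1)] q by simp
  then show ?thesis unfolding der_def f[OF y] using dd_cong[OF open_\<Omega> y f] by simp
qed

text \<open>With \<open>P = id\<close> this is the Hessian, with \<open>P\<close> the tangential projection its modification for submanifolds.\<close>
definition HB :: "(real^'m \<Rightarrow> real^'m) \<Rightarrow> ('a, 'm) conn \<Rightarrow> real \<Rightarrow> (real^'m \<Rightarrow> real) \<Rightarrow> real^'m \<Rightarrow> real^'m \<Rightarrow> real^'m \<Rightarrow> real" where
  "HB P D k f y a b = dd (\<lambda>z. der D k f z b) y a + k * \<alpha> D y a * der D k f y b - der D k f y (P (\<Gamma> D y a b))"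

text \<open>The term with \<open>dd (vc Y)\<close> is kept because it is removed in two ways: in
  \<open>hess\<close> it is part of \<open>D X Y\<close>, in \<open>hess_bar_fields\<close> it first
  has to be recognised as tangent to \<open>N\<close>.\<close>

lemma nablaL_nablaL:
  assumes D: "weyl D" and W: "open W" "W \<subseteq> U" and l: "smooth_sec A k W l"
    and Y: "smooth_vf A W Y" and q: "q \<in> W"
  shows "nablaL A D k X (nablaL A D k Y l) q = \<rho> q powr (k / 2) *
    (dd (\<lambda>z. der D k (fr k l) z (d\<phi> q (Y q))) (\<phi> q) (d\<phi> q (X q))
      + der D k (fr k l) (\<phi> q) (dd (vc Y) (\<phi> q) (d\<phi> q (X q)))
      + k * \<alpha> D (\<phi> q) (d\<phi> q (X q)) * der D k (fr k l) (\<phi> q) (d\<phi> q (Y q)))"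
proof -
  have y: "\<phi> q \<in> \<phi> ` W" and qU: "q \<in> U" and S: "\<phi> ` W \<subseteq> \<Omega>" using q W by auto
  note o = open_image[OF W] and sl = smooth_fr[OF l W] and sY = smooth_vc[OF Y W(2)]
  have "dd (fr k (nablaL A D k Y l)) (\<phi> q) = dd (\<lambda>z. der D k (fr k l) z (vc Y z)) (\<phi> q)"
    by (rule dd_cong[OF o y fr_nablaL[OF D W l]])
  moreover have "dd (\<lambda>z. der D k (fr k l) z (vc Y z)) (\<phi> q) v
    = dd (\<lambda>z. der D k (fr k l) z (vc Y (\<phi> q))) (\<phi> q) v + der D k (fr k l) (\<phi> q) (dd (vc Y) (\<phi> q) v)" for v
    by (rule dd_linear_family[OF o linear_der[OF weylD(1)[OF D] sl S] smooth_der[OF weylD(1)[OF D] sl S o] sY y])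
  ultimately show ?thesis
    unfolding nablaL_coord[OF D W smooth_nablaL[OF D W l Y] q] der_def[of D k "fr k (nablaL A D k Y l)"]
      fr_nablaL[OF D W l y] using vc_phi[OF qU, of Y] by simp
qed

lemma bilinear_HB:
  assumes D: "connection A D" and f: "smooth_on S f" "S \<subseteq> \<Omega>" "open S" "y \<in> S" and P: "linear P"
  shows "bilinear (HB P D k f y)"
proof -
  have y: "y \<in> \<Omega>" using f by auto
  note ld = linear_der[OF D f(1,2)] and sd = smooth_der[OF D f(1,2,3)]
  note l1 = linear_dd_family[where L="\<lambda>z b. der D k f z b", OF f(3) ld sd f(4)]
  have l2: "linear (dd (\<lambda>z. der D k f z b) y)" for b by (rule smooth_on_linear_dd[OF sd f(4)])
  note l = linear_simps[OF l1] linear_simps[OF l2]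
    linear_simps[OF ld[OF f(4)]] linear_simps[OF P]
    linear_simps[OF linear_alpha[OF D y]]
    bilinear_simps[OF bilinear_Gamma[OF D y]]
  show ?thesis unfolding HB_def bilinear_def
    by (intro conjI allI linearI) (simp_all add: l algebra_simps)
qed

end

section \<open>Change of the Weyl structure\<close>

context conformal_coordinates
begin

definition T :: "('a, 'm) conn \<Rightarrow> ('a, 'm) conn \<Rightarrow> real^'m \<Rightarrow> real^'m \<Rightarrow> real^'m \<Rightarrow> real^'m" where
  "T D D' y a b = \<Gamma> D' y a b - \<Gamma> D y a b"

text \<open>The change of the connection on weight 1 sections; \<open>T_formula\<close> shows that
  it also determines the change on TM.\<close>

definition \<beta> :: "('a, 'm) conn \<Rightarrow> ('a, 'm) conn \<Rightarrow> real^'m \<Rightarrow> real^'m \<Rightarrow> real" where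
  "\<beta> D D' y a = \<alpha> D' y a - \<alpha> D y a"

definition nabla_\<beta> :: "('a, 'm) conn \<Rightarrow> ('a, 'm) conn \<Rightarrow> real^'m \<Rightarrow> real^'m \<Rightarrow> real^'m \<Rightarrow> real" where
  "nabla_\<beta> D D' y u v = dd (\<lambda>z. \<beta> D D' z v) y u - \<beta> D D' y (\<Gamma> D y u v)"

definition nabla_T :: "('a, 'm) conn \<Rightarrow> ('a, 'm) conn \<Rightarrow> real^'m \<Rightarrow> real^'m \<Rightarrow> real^'m \<Rightarrow> real^'m \<Rightarrow> real^'m" where
  "nabla_T D D' y w u v = dd (\<lambda>z. T D D' z u v) y w + \<Gamma> D y w (T D D' y u v)
    - T D D' y (\<Gamma> D y w u) v - T D D' y u (\<Gamma> D y w v)"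

definition Rc :: "('a, 'm) conn \<Rightarrow> real^'m \<Rightarrow> real^'m \<Rightarrow> real^'m \<Rightarrow> real" where
  "Rc D y u v = trace (matrix (\<lambda>w. Rm D y w u v))"

lemma linear_beta: "connection A D \<Longrightarrow> connection A D' \<Longrightarrow> y \<in> \<Omega> \<Longrightarrow> linear (\<beta> D D' y)"
  unfolding \<beta>_def by (intro linear_compose_sub linear_alpha)

lemma smooth_beta: "connection A D \<Longrightarrow> connection A D' \<Longrightarrow> smooth_on \<Omega> (\<lambda>y. \<beta> D D' y a)"
  unfolding \<beta>_def by (intro smooth_on_diff smooth_alpha open_\<Omega>)

lemma smooth_T: "connection A D \<Longrightarrow> connection A D' \<Longrightarrow> smooth_on \<Omega> (\<lambda>y. T D D' y a b)"
  unfolding T_def by (intro smooth_on_diff smooth_Gamma open_\<Omega>)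

lemma bilinear_T: 
  assumes "connection A D" "connection A D'" "y \<in> \<Omega>" shows "bilinear (T D D' y)"
proof -
  note b = bilinear_Gamma[OF assms(1,3)] bilinear_Gamma[OF assms(2,3)]
  show ?thesis unfolding T_def bilinear_def
    by (intro conjI allI linearI)
      (simp_all add: b[THEN bilinear_ladd] b[THEN bilinear_radd] b[THEN bilinear_lmul] b[THEN bilinear_rmul] algebra_simps)
qed

lemma bilinear_nabla_beta:
  assumes D: "connection A D" "connection A D'" and y: "y \<in> \<Omega>"
  shows "bilinear (nabla_\<beta> D D' y)"
proof -
  note lb = linear_beta[OF D] and G = bilinear_Gamma[OF D(1) y]
  have l1: "linear (\<lambda>v. dd (\<lambda>z. \<beta> D D' z v) y u)" for u
    by (rule linear_dd_family[where L="\<lambda>z v. \<beta> D D' z v", OF open_\<Omega> lb smooth_beta[OF D] y])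
  have l2: "linear (dd (\<lambda>z. \<beta> D D' z v) y)" for v by (rule smooth_on_linear_dd[OF smooth_beta[OF D] y])
  note l = linear_simps[OF l1] linear_simps[OF l2]
    linear_simps[OF lb[OF y]]
    bilinear_simps[OF G]
  show ?thesis unfolding nabla_\<beta>_def bilinear_def
    by (intro conjI allI linearI) (simp_all add: l algebra_simps)
qed

lemma smooth_nabla_beta:
  assumes D: "connection A D" "connection A D'"
  shows "smooth_on \<Omega> (\<lambda>y. nabla_\<beta> D D' y u v)"
  unfolding nabla_\<beta>_def
  by (intro smooth_on_diff open_\<Omega> smooth_on_dd_const smooth_beta D smooth_Gamma
    smooth_on_linear_family[OF open_\<Omega> linear_beta[OF D]])

lemma gg_T_compat:
  assumes D: "weyl D" "weyl D'" and y: "y \<in> \<Omega>"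
  shows "2 * \<beta> D D' y v * gg y a b = gg y (T D D' y v a) b + gg y a (T D D' y v b)"
  using gg_compat[OF D(1) y, of a b v] gg_compat[OF D(2) y, of a b v]
  unfolding T_def \<beta>_def bilinear_lsub[OF bilinear_gg[OF y]] bilinear_rsub[OF bilinear_gg[OF y]]
  by (simp add: algebra_simps)

lemma T_sym:
  assumes D: "weyl D" "weyl D'" and y: "y \<in> \<Omega>"
  shows "T D D' y a b = T D D' y b a"
  unfolding T_def Gamma_sym[OF weylD[OF D(1)] y, of a b] Gamma_sym[OF weylD[OF D(2)] y, of a b] ..

text \<open>The Koszul trick: \<open>T\<close> is symmetric and \<open>T - \<beta> Id\<close> is skew with respect to \<open>c\<close>.\<close>
lemma T_formula:
  assumes D: "weyl D" "weyl D'" and y: "y \<in> \<Omega>"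
  shows "gg y (T D D' y a b) z = \<beta> D D' y a * gg y b z + \<beta> D D' y b * gg y a z - \<beta> D D' y z * gg y a b"
proof -
  note s = inner_formD(2)[OF gg_inner[OF y]]
  have "2 * \<beta> D D' y a * gg y b z = gg y (T D D' y a b) z + gg y (T D D' y a z) b"
    using gg_T_compat[OF D y, of a b z] s[of b "T D D' y a z"] by simp
  moreover have "2 * \<beta> D D' y b * gg y a z = gg y (T D D' y a b) z + gg y (T D D' y b z) a"
    using gg_T_compat[OF D y, of b a z] s[of a "T D D' y b z"] T_sym[OF D y, of b a] by simp
  moreover have "2 * \<beta> D D' y z * gg y a b = gg y (T D D' y a z) b + gg y (T D D' y b z) a"
    using gg_T_compat[OF D y, of z a b] s[of a "T D D' y z b"] T_sym[OF D y, of z] by simp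
  ultimately show ?thesis by linarith
qed

text \<open>\<open>T_formula\<close> differentiated covariantly. The metric \<open>gg\<close> is not
  parallel, but every term contains it exactly once, so the contributions of \<alpha>
  cancel.\<close>

lemma nabla_T_formula:
  assumes D: "weyl D" "weyl D'" and y: "y \<in> \<Omega>"
  shows "gg y (nabla_T D D' y w u v) z = nabla_\<beta> D D' y w u * gg y v z + nabla_\<beta> D D' y w v * gg y u z
    - nabla_\<beta> D D' y w z * gg y u v"
proof -
  note con = weylD(1)[OF D(1)] weylD(1)[OF D(2)]
  note sb = smooth_beta[OF con] and sT = smooth_T[OF con]
  have sbg: "smooth_on \<Omega> (\<lambda>p. \<beta> D D' p u * gg p v z)" for u v z
    by (intro smooth_on_mult open_\<Omega> sb smooth_gg)
  have dbg: "dd (\<lambda>p. \<beta> D D' p u * gg p v z) y w = \<beta> D D' y u * dd (\<lambda>p. gg p v z) y w + dd (\<lambda>p. \<beta> D D' p u) y w * gg y v z" for u v z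
    by (rule dd_mult[OF sb smooth_gg y])
  have "dd (\<lambda>p. gg p (T D D' p u v) z) y w = dd (\<lambda>p. gg p (T D D' y u v) z) y w + gg y (dd (\<lambda>p. T D D' p u v) y w) z"
    by (rule dd_linear_family[where L="\<lambda>p x. gg p x z", OF open_\<Omega> _ smooth_gg sT y])
      (use bilinear_gg in \<open>auto simp: bilinear_def\<close>)
  moreover have "dd (\<lambda>p. gg p (T D D' p u v) z) y
      = dd (\<lambda>p. (\<beta> D D' p u * gg p v z + \<beta> D D' p v * gg p u z) - \<beta> D D' p z * gg p u v) y"
    by (rule dd_cong[OF open_\<Omega> y T_formula[OF D]])
  moreover have "dd (\<lambda>p. (\<beta> D D' p u * gg p v z + \<beta> D D' p v * gg p u z) - \<beta> D D' p z * gg p u v) y w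
      = dd (\<lambda>p. \<beta> D D' p u * gg p v z) y w + dd (\<lambda>p. \<beta> D D' p v * gg p u z) y w - dd (\<lambda>p. \<beta> D D' p z * gg p u v) y w"
    unfolding dd_diff[OF smooth_on_add[OF open_\<Omega> sbg sbg] sbg y] dd_add[OF sbg sbg y] ..
  ultimately have 1: "gg y (dd (\<lambda>p. T D D' p u v) y w) z =
      dd (\<lambda>p. \<beta> D D' p u * gg p v z) y w + dd (\<lambda>p. \<beta> D D' p v * gg p u z) y w - dd (\<lambda>p. \<beta> D D' p z * gg p u v) y w
      - dd (\<lambda>p. gg p (T D D' y u v) z) y w" by simp
  note l = bilinear_ladd[OF bilinear_gg[OF y]] bilinear_lsub[OF bilinear_gg[OF y]]
  show ?thesis
    unfolding nabla_T_def l 1 dbg gg_compat[OF D(1) y] T_formula[OF D y] nabla_\<beta>_def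
    by (simp add: algebra_simps)
qed

section \<open>Curvature and Hessian under a change of the Weyl structure\<close>

text \<open>Curvature of a connection changed by a tensor: the linear part is the skew derivative of
  \<open>T\<close>, the quadratic part its commutator. The terms with
  \<open>\<Gamma> D y w u\<close> drop out because Christoffel symbols are symmetric.\<close>

lemma Rm_diff:
  assumes D: "weyl D" "weyl D'" and y: "y \<in> \<Omega>"
  shows "Rm D' y w u v - Rm D y w u v = nabla_T D D' y w u v - nabla_T D D' y u w v
    + T D D' y w (T D D' y u v) - T D D' y u (T D D' y w v)"
proof -
  note con = weylD(1)[OF D(1)] weylD(1)[OF D(2)]
  have G': "\<Gamma> D' y a b = \<Gamma> D y a b + T D D' y a b" for a b unfolding T_def by simp
  have d: "dd (\<lambda>z. T D D' z a b) y x = dd (\<lambda>z. \<Gamma> D' z a b) y x - dd (\<lambda>z. \<Gamma> D z a b) y x" for a b x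
    unfolding T_def by (rule dd_diff[OF smooth_Gamma[OF con(2)] smooth_Gamma[OF con(1)] y])
  note l = bilinear_radd[OF bilinear_Gamma[OF con(1) y]] bilinear_radd[OF bilinear_T[OF con y]]
  show ?thesis
    unfolding Rm_def nabla_T_def d G' l T_sym[OF D y, of "\<Gamma> D y w u" v] T_sym[OF D y, of "\<Gamma> D y u w" v]
      Gamma_sym[OF weylD[OF D(1)] y, of u w]
    by (simp add: algebra_simps)
qed

lemma Rc_onb:
  assumes D: "connection A D" and y: "y \<in> \<Omega>" and E: "onb (gg y) UNIV E"
  shows "Rc D y u v = (\<Sum>e\<in>E. gg y (Rm D y e u v) e)"
  unfolding Rc_def by (rule trace_matrix_onb[OF E gg_inner[OF y] linear_Rm[OF D y]])

lemma card_onb: "y \<in> \<Omega> \<Longrightarrow> onb (gg y) UNIV E \<Longrightarrow> card E = CARD('m)"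
  using onb_card[OF _ gg_inner] by simp

lemma Rc_diff:
  assumes D: "weyl D" "weyl D'" and y: "y \<in> \<Omega>"
    and E: "onb (gg y) UNIV E"
  shows "Rc D' y u u - Rc D y u u = - (real CARD('m) - 2) * nabla_\<beta> D D' y u u - (\<Sum>e\<in>E. nabla_\<beta> D D' y e e) * gg y u u
    + (real CARD('m) - 2) * ((\<beta> D D' y u)\<^sup>2 - (\<Sum>e\<in>E. (\<beta> D D' y e)\<^sup>2) * gg y u u)"
proof -
  note con = weylD(1)[OF D(1)] weylD(1)[OF D(2)]
  have "Rc D' y u u - Rc D y u u = (\<Sum>e\<in>E. gg y (Rm D' y e u u - Rm D y e u u) e)"
    unfolding Rc_onb[OF con(1) y E] Rc_onb[OF con(2) y E] bilinear_lsub[OF bilinear_gg[OF y]]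
    by (simp add: sum_subtractf)
  also have "\<dots> = - (real (card E) - 2) * nabla_\<beta> D D' y u u - (\<Sum>e\<in>E. nabla_\<beta> D D' y e e) * gg y u u
    + (real (card E) - 2) * ((\<beta> D D' y u)\<^sup>2 - (\<Sum>e\<in>E. (\<beta> D D' y e)\<^sup>2) * gg y u u)"
    unfolding Rm_diff[OF D y]
    by (rule ric_variation[where b="nabla_\<beta> D D' y" and \<beta>="\<beta> D D' y" and dT="nabla_T D D' y"
        and T="T D D' y" and g="gg y", OF E gg_inner[OF y] bilinear_nabla_beta[OF con y] linear_beta[OF con y]
      nabla_T_formula[OF D y] T_formula[OF D y]])
  finally show ?thesis unfolding card_onb[OF y E] .
qed

lemma linear_trace_matrix:
  fixes F :: "real^'m \<Rightarrow> real^'m \<Rightarrow> real^'m"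
  assumes "\<And>w. linear (\<lambda>u. F u w)"
  shows "linear (\<lambda>u. trace (matrix (F u)))"
  unfolding trace_def matrix_def
  by (intro linearI) (simp_all add: linear_simps[OF assms] sum.distrib sum_distrib_left)

lemma bilinear_Rc:
  assumes D: "connection A D" and y: "y \<in> \<Omega>"
  shows "bilinear (Rc D y)"
proof -
  note bil = bilinear_Gamma[OF D]
  have lin: "linear (\<Gamma> D y a)" "linear (\<lambda>a. \<Gamma> D y a b)" if "y \<in> \<Omega>" for y a b
    using bil[OF that] unfolding bilinear_def by auto
  have l1: "linear (dd (\<lambda>y. \<Gamma> D y v w) y)" for v w by (rule smooth_on_linear_dd[OF smooth_Gamma[OF D] y])
  have l2: "linear (\<lambda>u. dd (\<lambda>y. \<Gamma> D y u w) y v)" for v w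
    by (rule linear_dd_family[where L="\<lambda>y u. \<Gamma> D y u w", OF open_\<Omega> lin(2) smooth_Gamma[OF D] y])
  have l3: "linear (\<lambda>w. dd (\<lambda>y. \<Gamma> D y u w) y v)" for v u
    by (rule linear_dd_family[where L="\<lambda>y w. \<Gamma> D y u w", OF open_\<Omega> lin(1) smooth_Gamma[OF D] y])
  note l = linear_simps[OF l1] linear_simps[OF l2] linear_simps[OF l3]
    bilinear_simps[OF bil[OF y]]
  have "linear (\<lambda>u. Rm D y w u v)" "linear (\<lambda>v. Rm D y w u v)" for u v w
    unfolding Rm_def by (intro linearI; simp add: l algebra_simps)+
  then show ?thesis unfolding bilinear_def Rc_def by (auto intro: linear_trace_matrix)
qed

lemma smooth_Rc: assumes D: "connection A D" shows "smooth_on \<Omega> (\<lambda>y. Rc D y u v)"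
proof -
  have "smooth_on \<Omega> (\<lambda>y. Rm D y w u v)" for w unfolding Rm_def
    by (intro smooth_on_add smooth_on_diff open_\<Omega> smooth_on_dd_const smooth_Gamma D
      smooth_on_bilinear_family[OF open_\<Omega> bilinear_Gamma[OF D]] smooth_on_const)
  then show ?thesis unfolding Rc_def trace_def matrix_def
    by (auto intro!: smooth_on_sum smooth_on_nth open_\<Omega>)
qed

text \<open>Kept for general \<open>P\<close>: the identity gives the Hessian behind Moebius
  structures, the tangential projection the one along \<open>N\<close>. The factor
  \<open>k\<^sup>2\<close> arises because both covariant derivatives change.\<close>

lemma HB_diff:
  assumes D: "weyl D" "weyl D'" and f: "smooth_on S f" "S \<subseteq> \<Omega>" "open S" "y \<in> S"
    and P: "linear P"
  shows "HB P D' k f y a a - HB P D k f y a a =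
    k * (dd (\<lambda>z. \<beta> D D' z a) y a - \<beta> D D' y (P (\<Gamma> D y a a))) * f y
    + 2 * k * \<beta> D D' y a * der D k f y a + k\<^sup>2 * (\<beta> D D' y a)\<^sup>2 * f y
    - der D k f y (P (T D D' y a a)) - k * \<beta> D D' y (P (T D D' y a a)) * f y"
proof -
  note con = weylD(1)[OF D(1)] weylD(1)[OF D(2)]
  have y: "y \<in> \<Omega>" using f by auto
  have sb: "smooth_on S (\<lambda>z. \<beta> D D' z a)" by (rule smooth_on_subset[OF smooth_beta[OF con] f(2)])
  have al: "\<alpha> D' z b = \<alpha> D z b + \<beta> D D' z b" for z b unfolding \<beta>_def by simp
  have der': "der D' k f z b = der D k f z b + k * (\<beta> D D' z b * f z)" for z b
    unfolding der_def al by (simp add: algebra_simps)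
  have sm: "smooth_on S (\<lambda>z. \<beta> D D' z a * f z)" by (rule smooth_on_mult[OF f(3) sb f(1)])
  have "dd (\<lambda>z. der D k f z a + k * (\<beta> D D' z a * f z)) y a =
      dd (\<lambda>z. der D k f z a) y a + k * (\<beta> D D' y a * dd f y a + dd (\<lambda>z. \<beta> D D' z a) y a * f y)"
    unfolding dd_add[OF smooth_der[OF con(1) f(1,2,3)] smooth_on_mult[OF f(3) smooth_on_const sm] f(4)]
      dd_cmult[OF sm f(4)] dd_mult[OF sb f(1,4)] ..
  moreover have G': "\<Gamma> D' y a a = \<Gamma> D y a a + T D D' y a a" unfolding T_def by simp
  ultimately show ?thesis
    unfolding HB_def der' al by (simp add: linear_add[OF P] linear_add[OF linear_der[OF con(1) f(1,2,4)]]
      linear_add[OF linear_beta[OF con y]] der_def[of D k f y a] power2_eq_square algebra_simps)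
qed

lemma beta_sharp:
  assumes "connection A D" "connection A D'" and y: "y \<in> \<Omega>"
  shows "\<exists>s. \<forall>z. gg y s z = \<beta> D D' y z"
proof -
  obtain E where E: "onb (gg y) UNIV E"
    using onb_exists[OF gg_inner[OF y] subspace_UNIV] by blast
  have "gg y (\<Sum>e\<in>E. \<beta> D D' y e *\<^sub>R e) z = \<beta> D D' y z" for z
  proof -
    have "gg y (\<Sum>e\<in>E. \<beta> D D' y e *\<^sub>R e) z = (\<Sum>e\<in>E. \<beta> D D' y e * gg y e z)"
      by (rule inner_form_sum(1)[OF gg_inner[OF y]])
    also have "\<dots> = (\<Sum>e\<in>E. gg y z e *\<^sub>R \<beta> D D' y e)"
      by (intro sum.cong refl) (metis inner_formD(2)[OF gg_inner[OF y]] mult.commute real_scaleR_def)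
    also have "\<dots> = \<beta> D D' y z"
      by (rule onb_linear_expand[OF E gg_inner[OF y] UNIV_I linear_beta[OF assms], symmetric])
    finally show ?thesis .
  qed
  then show ?thesis by blast
qed

lemma T_diag:
  assumes D: "weyl D" "weyl D'" and y: "y \<in> \<Omega>" and s: "\<And>z. gg y s z = \<beta> D D' y z"
  shows "T D D' y a a = (2 * \<beta> D D' y a) *\<^sub>R a - gg y a a *\<^sub>R s"
  by (rule inner_form_eqI[OF gg_inner[OF y]])
    (simp add: T_formula[OF D y] bilinear_lsub[OF bilinear_gg[OF y]] bilinear_lmul[OF bilinear_gg[OF y]] s algebra_simps)

section \<open>From the gauge back to the invariant definitions\<close>

lemma range_cf: "q \<in> U \<Longrightarrow> (\<lambda>a. cf a q) ` UNIV = UNIV"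
  by (metis cf_dphi surjI)

lemma trace_c_coord:
  assumes q: "q \<in> U" and E: "onb (gg (\<phi> q)) V E"
    and B: "bilinear B'" "\<And>u. u \<in> V \<Longrightarrow> B (cf u q) (cf u q) = B' u u"
  shows "trace_c (c q) ((\<lambda>a. cf a q) ` V) B = (\<Sum>e\<in>E. B' e e) / \<rho> q"
  by (rule trace_c_transport[where K="\<lambda>a. cf a q" and K'="d\<phi> q" and g="gg (\<phi> q)" and c="c q" and r="\<rho> q" and B=B and B'=B', OF E gg_inner linear_cf[OF q] linear_dphi[OF q] _ c_inner c_cf[OF q] rho_pos[OF q] B])
    (use q in auto)

lemma sym_tracefree_coord:
  assumes q: "q \<in> U" and E: "onb (gg (\<phi> q)) UNIV E"
    and B: "bilinear B'" "\<And>u. B (cf u q) (cf u q) = B' u u"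
  shows "sym_tracefree (c q) B (cf a q) (cf a q) = B' a a - (\<Sum>e\<in>E. B' e e) / real CARD('m) * gg (\<phi> q) a a"
  unfolding sym_tracefree_def c_cf[OF q]
  using trace_c_coord[where B=B and B'=B', OF q E B] range_cf[OF q] rho_pos[OF q] B(2) by simp

lemma cext_here:
  shows "smooth_vf A (pdom A q \<inter> U) (cext A q a)" "cext A q a q = a" "open (pdom A q \<inter> U)" "q \<in> U \<Longrightarrow> q \<in> pdom A q \<inter> U"
proof -
  show "smooth_vf A (pdom A q \<inter> U) (cext A q a)"
    unfolding cext_eq by (rule smooth_vf_subset[OF smooth_coord_field[OF pchart_mem]]) auto
  show "cext A q a q = a"
    unfolding cext_def using dchart_inverse(2)[OF pchart_mem in_pdom, of q a] dchart_pmap by simp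
  show "open (pdom A q \<inter> U)" using chart_facts(1)[OF pchart_mem] open_U by auto
  show "q \<in> U \<Longrightarrow> q \<in> pdom A q \<inter> U" using in_pdom by auto
qed

lemma unit_sec_here: "smooth_sec A 1 (pdom A q \<inter> U) (unit_sec A q)"
  by (rule smooth_sec_subset[OF unit_sec_smooth]) auto

lemma nablaL_zero:
  assumes D: "weyl D" and W: "open W" "W \<subseteq> U" and l: "smooth_sec A k W l" and q: "q \<in> W" and X: "X q = 0"
  shows "nablaL A D k X l q = 0"
proof -
  have S: "\<phi> ` W \<subseteq> \<Omega>" "\<phi> q \<in> \<phi> ` W" "q \<in> U" using q W by auto
  show ?thesis unfolding nablaL_coord[OF D W l q] X
    using linear_0[OF linear_der[OF weylD(1)[OF D] smooth_fr[OF l W] S(1,2)]] linear_0[OF linear_dphi[OF S(3)]] by simp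
qed

text \<open>For equal arguments the two second derivatives coincide and the bracket vanishes; traces
  see nothing but these diagonal values.\<close>

lemma faraday_diag:
  assumes D: "weyl D" and q: "q \<in> U"
  shows "faraday A D q u u = 0"
proof -
  have "lie_bracket A X X q = 0" for X unfolding lie_bracket_def by simp
  then show ?thesis unfolding faraday_def Let_def
    using nablaL_zero[OF D cext_here(3) _ unit_sec_here cext_here(4)[OF q]] by simp
qed

lemma hess_coord:
  assumes D: "weyl D" and q: "q \<in> U" and W: "open W" "q \<in> W" and l: "smooth_sec A 1 W l"
  shows "hess A D l q (cf a q) (cf b q) = \<rho> q powr (1/2) * HB (\<lambda>x. x) D 1 (fr 1 l) (\<phi> q) a b"
proof -
  let ?W = "W \<inter> (pdom A q \<inter> U)"
  have W': "open ?W" "?W \<subseteq> U" "q \<in> ?W" using W cext_here(3,4) q by auto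
  have l': "smooth_sec A 1 ?W l" by (rule smooth_sec_subset[OF l]) auto
  have s: "smooth_vf A ?W (cext A q u)" for u by (rule smooth_vf_subset[OF cext_here(1)]) auto
  have y: "\<phi> q \<in> \<phi> ` ?W" "\<phi> ` ?W \<subseteq> \<Omega>" using W' by auto
  note ld = linear_der[OF weylD(1)[OF D] smooth_fr[OF l' W'(1,2)] y(2,1)]
  have "d\<phi> q (D (cext A q (cf a q)) (cext A q (cf b q)) q) = dd (vc (cext A q (cf b q))) (\<phi> q) a + \<Gamma> D (\<phi> q) a b"
    using connection_coord[OF weylD(1)[OF D] W'(1,2) s s y(1)] q by (simp add: vc_phi cext_here(2))
  then show ?thesis
    unfolding hess_def Let_def nablaL_nablaL[OF D W'(1,2) l' s W'(3)] nablaL_coord[OF D W'(1,2) l' W'(3)]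
    using q by (simp add: HB_def cext_here(2) linear_add[OF ld] algebra_simps)
qed

lemma hess0_coord:
  assumes D: "weyl D" and q: "q \<in> U" and W: "open W" "q \<in> W" and l: "smooth_sec A 1 W l"
    and E: "onb (gg (\<phi> q)) UNIV E"
  shows "hess0 A c D l q (cf a q) (cf a q) = \<rho> q powr (1/2) *
    (HB (\<lambda>x. x) D 1 (fr 1 l) (\<phi> q) a a - (\<Sum>e\<in>E. HB (\<lambda>x. x) D 1 (fr 1 l) (\<phi> q) e e) / real CARD('m) * gg (\<phi> q) a a)"
proof -
  have W': "open (W \<inter> U)" "W \<inter> U \<subseteq> U" "q \<in> W \<inter> U" using W q open_U by auto
  have l': "smooth_sec A 1 (W \<inter> U) l" by (rule smooth_sec_subset[OF l]) auto
  have y: "\<phi> q \<in> \<phi> ` (W \<inter> U)" "\<phi> ` (W \<inter> U) \<subseteq> \<Omega>" using W' by auto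
  have b: "bilinear (HB (\<lambda>x. x) D 1 (fr 1 l) (\<phi> q))"
    by (rule bilinear_HB[OF weylD(1)[OF D] smooth_fr[OF l' W'(1,2)] y(2) open_image[OF W'(1,2)] y(1)]) (rule linear_ident)
  have "bilinear (\<lambda>u v. \<rho> q powr (1/2) * HB (\<lambda>x. x) D 1 (fr 1 l) (\<phi> q) u v)"
    unfolding bilinear_def
    by (intro conjI allI linearI) (simp_all add: bilinear_simps[OF b] algebra_simps)
  from sym_tracefree_coord[where B="hess A D l q", OF q E this hess_coord[OF D q W l]] show ?thesis
    unfolding hess0_def by (simp add: algebra_simps flip: sum_distrib_left)
qed

text \<open>For weight 1 the terms with \<beta>(a) times a derivative in the direction
  \<open>a\<close> cancel against part of the derivative along \<open>T D D' y a a\<close>. What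
  remains of first order is a multiple of \<open>gg y a a\<close>, hence pure trace, and disappears
  in \<open>hess0\<close>.\<close>

lemma hess0_diff:
  assumes D: "weyl D" "weyl D'" and q: "q \<in> U"
    and E: "onb (gg (\<phi> q)) UNIV E"
  shows "hess0 A c D' (unit_sec A q) q (cf a q) (cf a q) - hess0 A c D (unit_sec A q) q (cf a q) (cf a q) =
    nabla_\<beta> D D' (\<phi> q) a a - (\<beta> D D' (\<phi> q) a)\<^sup>2
    - ((\<Sum>e\<in>E. nabla_\<beta> D D' (\<phi> q) e e) - (\<Sum>e\<in>E. (\<beta> D D' (\<phi> q) e)\<^sup>2)) / real CARD('m) * gg (\<phi> q) a a"
proof -
  note con = weylD(1)[OF D(1)] weylD(1)[OF D(2)]
  let ?y = "\<phi> q" and ?W = "pdom A q \<inter> U" and ?l = "unit_sec A q" and ?m = "real CARD('m)"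
  have y: "?y \<in> \<Omega>" using q by auto
  have W: "open ?W" "q \<in> ?W" "?W \<subseteq> U" using cext_here(3,4) q by auto
  obtain s where s: "\<And>z. gg ?y s z = \<beta> D D' ?y z" using beta_sharp[OF con y] by blast
  define f where "f = fr 1 ?l"
  have S: "smooth_on (\<phi> ` ?W) f" "\<phi> ` ?W \<subseteq> \<Omega>" "open (\<phi> ` ?W)" "?y \<in> \<phi> ` ?W"
    unfolding f_def using smooth_fr[OF unit_sec_here W(1,3)] W open_image[OF W(1,3)] by auto
  have f1: "\<rho> q powr (1/2) * f ?y = 1" unfolding f_def fr_def using q rho_pos[OF q] unit_sec_1 by (simp add: powr_minus)
  \<comment> \<open>Collects what multiplies \<open>gg ?y a a\<close>; it is removed together with
    the trace.\<close>
  define \<kappa> where "\<kappa> = der D 1 f ?y s + \<beta> D D' ?y s * f ?y"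
  note ld = linear_der[OF con(1) S(1,2,4), of 1] and lb = linear_beta[OF con y]
  have d: "HB (\<lambda>x. x) D' 1 f ?y a a - HB (\<lambda>x. x) D 1 f ?y a a =
      (nabla_\<beta> D D' ?y a a - (\<beta> D D' ?y a)\<^sup>2) * f ?y + gg ?y a a * \<kappa>" for a
    unfolding HB_diff[OF D S linear_ident] T_diag[OF D y s] nabla_\<beta>_def \<kappa>_def
      linear_diff[OF ld] linear_scale[OF ld] linear_diff[OF lb] linear_scale[OF lb]
    by (simp add: power2_eq_square algebra_simps)
  define h where "h a = HB (\<lambda>x. x) D 1 f ?y a a" for a
  have d': "HB (\<lambda>x. x) D' 1 f ?y a a = h a + (nabla_\<beta> D D' ?y a a - (\<beta> D D' ?y a)\<^sup>2) * f ?y + gg ?y a a * \<kappa>" for a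
    using d[of a] unfolding h_def by simp
  have sg: "(\<Sum>e\<in>E. gg ?y e e) = ?m" using onb_norm[OF E] card_onb[OF y E] by simp
  have sm: "(\<Sum>e\<in>E. HB (\<lambda>x. x) D' 1 f ?y e e) = (\<Sum>e\<in>E. h e) +
     ((\<Sum>e\<in>E. nabla_\<beta> D D' ?y e e) - (\<Sum>e\<in>E. (\<beta> D D' ?y e)\<^sup>2)) * f ?y + ?m * \<kappa>"
    unfolding d' by (simp add: sum.distrib sum_subtractf flip: sum_distrib_right sg)
  have "hess0 A c D' ?l q (cf a q) (cf a q) - hess0 A c D ?l q (cf a q) (cf a q) =
    \<rho> q powr (1/2) * f ?y * (nabla_\<beta> D D' ?y a a - (\<beta> D D' ?y a)\<^sup>2
      - ((\<Sum>e\<in>E. nabla_\<beta> D D' ?y e e) - (\<Sum>e\<in>E. (\<beta> D D' ?y e)\<^sup>2)) / ?m * gg ?y a a)"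
    unfolding hess0_coord[OF D(1) q W(1,2) unit_sec_here E] hess0_coord[OF D(2) q W(1,2) unit_sec_here E]
      f_def[symmetric] sm
    unfolding d' h_def[symmetric] using card_onb[OF y E] sg
    by (simp add: field_simps)
  then show ?thesis unfolding f1 by simp
qed

lemma schouten_coord:
  assumes D: "weyl D" and q: "q \<in> U" and E: "onb (gg (\<phi> q)) UNIV E"
  shows "schouten A c \<M> D q (cf a q) (cf a q) =
    (if CARD('m) = 2 then \<M> (unit_sec A q) q (cf a q) (cf a q) - hess0 A c D (unit_sec A q) q (cf a q) (cf a q)
     else (Rc D (\<phi> q) a a - (\<Sum>e\<in>E. Rc D (\<phi> q) e e) / real CARD('m) * gg (\<phi> q) a a) / (real CARD('m) - 2))
    + (\<Sum>e\<in>E. Rc D (\<phi> q) e e) / (2 * (real CARD('m) - 1)) / real CARD('m) * gg (\<phi> q) a a"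
proof -
  have y: "\<phi> q \<in> \<Omega>" using q by auto
  note b = bilinear_Rc[OF weylD(1)[OF D] y]
  have r: "ric A D q (cf u q) (cf u q) = Rc D (\<phi> q) u u" for u
    unfolding Rc_def by (rule ric_coord[OF weylD[OF D] q])
  have "sigma A c D q / real CARD('m) * c q (cf a q) (cf a q) =
      (\<Sum>e\<in>E. Rc D (\<phi> q) e e) / (2 * (real CARD('m) - 1)) / real CARD('m) * gg (\<phi> q) a a"
    unfolding sigma_def scal_def c_cf[OF q]
    using trace_c_coord[OF q E b, of "ric A D q"] r range_cf[OF q] rho_pos[OF q] by simp
  moreover have "sym_tracefree (c q) (ric A D q) (cf a q) (cf a q) =
      Rc D (\<phi> q) a a - (\<Sum>e\<in>E. Rc D (\<phi> q) e e) / real CARD('m) * gg (\<phi> q) a a"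
    by (rule sym_tracefree_coord[where B="ric A D q" and B'="Rc D (\<phi> q)", OF q E b r])
  ultimately show ?thesis
    unfolding schouten_def faraday_diag[OF D q] by simp
qed

text \<open>The same formula in all dimensions, for two reasons: if m > 2 the trace-free part
  changes through the Ricci tensor; if m = 2 the operator \<M> is common to both structures and the
  change comes from \<open>hess0\<close>. The trace part comes from \<open>sigma\<close> in both
  cases.\<close>

lemma schouten_diff:
  assumes D: "weyl D" "weyl D'" and q: "q \<in> U"
    and E: "onb (gg (\<phi> q)) UNIV E" and m: "2 \<le> CARD('m)"
  shows "schouten A c \<M> D' q (cf a q) (cf a q) - schouten A c \<M> D q (cf a q) (cf a q) =
    - nabla_\<beta> D D' (\<phi> q) a a + (\<beta> D D' (\<phi> q) a)\<^sup>2 - (\<Sum>e\<in>E. (\<beta> D D' (\<phi> q) e)\<^sup>2) / 2 * gg (\<phi> q) a a"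
proof -
  have y: "\<phi> q \<in> \<Omega>" using q by auto
  let ?m = "real CARD('m)" and ?y = "\<phi> q"
  let ?b = "\<Sum>e\<in>E. nabla_\<beta> D D' ?y e e" and ?n = "\<Sum>e\<in>E. (\<beta> D D' ?y e)\<^sup>2"
  have sg: "(\<Sum>e\<in>E. gg ?y e e) = ?m" using onb_norm[OF E] card_onb[OF y E] by simp
  define R where "R = (\<Sum>e\<in>E. Rc D ?y e e)"
  have Rd: "Rc D' ?y u u = Rc D ?y u u - (?m - 2) * nabla_\<beta> D D' ?y u u - ?b * gg ?y u u
    + (?m - 2) * ((\<beta> D D' ?y u)\<^sup>2 - ?n * gg ?y u u)" for u
    using Rc_diff[OF D y E, of u] by (simp add: algebra_simps)
  have "(\<Sum>e\<in>E. Rc D' ?y e e) = R - (?m - 2) * ?b - ?b * (\<Sum>e\<in>E. gg ?y e e) + (?m - 2) * (?n - ?n * (\<Sum>e\<in>E. gg ?y e e))"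
    unfolding Rd R_def by (simp add: sum.distrib sum_subtractf flip: sum_distrib_left)
  \<comment> \<open>Since \<open>gg\<close> has trace m, the coefficients combine as (m - 2) + m = 2
    (m - 1) and 1 - m.\<close>
  then have S: "(\<Sum>e\<in>E. Rc D' ?y e e) = R - 2 * (?m - 1) * ?b - (?m - 2) * (?m - 1) * ?n"
    unfolding sg by (simp add: algebra_simps)
  note sc = schouten_coord[OF D(1) q E, of \<M> a, folded R_def] schouten_coord[OF D(2) q E, of \<M> a, unfolded S]
  show ?thesis
  proof (cases "CARD('m) = 2")
    case True
    then have m2: "?m = 2" by simp
    show ?thesis using hess0_diff[OF D q E, of a] unfolding sc m2 using True by (simp add: field_simps)
  next
    case False
    then have "?m > 2" using m by linarith
    \<comment> \<open>With m = t + 2 the denominators m - 2, m - 1 and m become t, t + 1 and t + 2,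
      which are visibly nonzero.\<close>
    then obtain t where t: "?m = t + 2" "t > 0" by (metis add.commute diff_gt_0_iff_gt diff_add_cancel)
    have t': "t \<noteq> 0" "t + 1 \<noteq> 0" "t + 2 \<noteq> 0" using t(2) by linarith+
    show ?thesis unfolding sc Rd t(1) using False t' by (simp add: divide_simps) (simp add: algebra_simps)
  qed
qed

end

section \<open>Submanifolds in slice coordinates\<close>

lemma bilinear_plus: "bilinear f \<Longrightarrow> bilinear g \<Longrightarrow> bilinear (\<lambda>a b. f a b + g a b)"
  unfolding bilinear_def by (auto intro: linear_compose_add)

lemma bilinear_cmult:
  fixes f :: "'a::real_vector \<Rightarrow> 'b::real_vector \<Rightarrow> real"
  assumes f: "bilinear f"
  shows "bilinear (\<lambda>a b. r * f a b)"
  unfolding bilinear_def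
  by (intro conjI allI linearI) (simp_all add: f[THEN bilinear_ladd] f[THEN bilinear_radd]
    f[THEN bilinear_lmul] f[THEN bilinear_rmul] algebra_simps)

lemma bilinear_product:
  fixes f :: "'a::real_vector \<Rightarrow> real"
  shows "linear f \<Longrightarrow> bilinear (\<lambda>a b. f a * f b)"
  unfolding bilinear_def by (auto intro!: linearI simp: linear_add linear_scale algebra_simps)

text \<open>Makes tangential derivatives along a submanifold independent of the chosen extensions.\<close>
lemma dd_zero_on_subspace:
  fixes f :: "'x::real_normed_vector \<Rightarrow> 'y::real_normed_vector"
  assumes S: "open S" "y \<in> S" and f: "f differentiable (at y)" and V: "subspace V" "y \<in> V" "a \<in> V"
    and z: "\<And>z. z \<in> S \<Longrightarrow> z \<in> V \<Longrightarrow> f z = 0"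
  shows "dd f y a = 0"
proof -
  let ?l = "\<lambda>t::real. y + t *\<^sub>R a"
  have l: "(?l has_derivative (\<lambda>t. t *\<^sub>R a)) (at 0)" by (auto intro!: derivative_eq_intros)
  have "((\<lambda>t. f (?l t)) has_derivative (\<lambda>t. dd f y (t *\<^sub>R a))) (at 0)"
    using has_derivative_compose[OF l, of f "dd f y"] f by (simp add: frechet_derivative_works)
  from dd_eq[OF this] have 1: "dd (\<lambda>t. f (?l t)) 0 1 = dd f y a" by simp
  have o: "open (?l -` S)" by (intro open_vimage S continuous_intros)
  have "dd (\<lambda>t. f (?l t)) 0 = dd (\<lambda>t. 0) 0"
    by (rule dd_cong[OF o]) (use S V z in \<open>auto intro!: z subspace_add subspace_scale\<close>)
  then show ?thesis using 1 by simp
qed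

lemma dd_in_coord_subspace:
  fixes f :: "'x::real_normed_vector \<Rightarrow> real^'m"
  assumes S: "open S" "y \<in> S" and f: "f differentiable (at y)" and V: "subspace V" "y \<in> V" "a \<in> V"
    and z: "\<And>z. z \<in> S \<Longrightarrow> z \<in> V \<Longrightarrow> f z \<in> coord_subspace J"
  shows "dd f y a \<in> coord_subspace J"
  unfolding coord_subspace_def
proof (intro CollectI allI impI)
  fix i assume i: "i \<notin> J"
  have d: "((\<lambda>z. f z $ i) has_derivative (\<lambda>v. dd f y v $ i)) (at y)"
    by (rule bounded_linear.has_derivative[OF bounded_linear_vec_nth]) (use f frechet_derivative_works in blast)
  have "dd (\<lambda>z. f z $ i) y a = 0"
    by (rule dd_zero_on_subspace[OF S _ V]) (use d z i in \<open>auto simp: differentiable_def coord_subspace_def\<close>)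
  then show "dd f y a $ i = 0" using dd_eq[OF d] by simp
qed

context conformal_coordinates
begin

lemma smooth_frame_sum:
  fixes b :: "real^'m \<Rightarrow> real^'m \<Rightarrow> real^'m \<Rightarrow> real"
  assumes S: "open S" "S \<subseteq> \<Omega>" and b: "\<And>y. y \<in> S \<Longrightarrow> bilinear (b y)" "\<And>u v. smooth_on S (\<lambda>y. b y u v)"
    and fm: "\<And>j. j \<in> J \<Longrightarrow> smooth_on \<Omega> (fm j)"
  shows "smooth_on S (\<lambda>y. \<Sum>j\<in>J. b y (fm j y) (fm j y))"
  by (intro smooth_on_sum S(1) smooth_on_bilinear_family[OF S(1) b] smooth_on_subset[OF fm S(2)])

text \<open>For m = 2 the tensor at \<open>q\<close> involves \<M> and \<open>hess0\<close> on
  \<open>unit_sec A q\<close>, a section that changes irregularly with \<open>q\<close>. Only the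
  difference to a reference Weyl structure is tensorial, so smoothness is reached through that
  structure and \<open>hess0_diff\<close>.\<close>

lemma schouten_smooth:
  assumes D: "weyl D" and m: "2 \<le> CARD('m)" "CARD('m) = 2 \<Longrightarrow> moebius_structure A c \<M>"
  shows "\<exists>Q. (\<forall>y\<in>\<Omega>. bilinear (Q y)) \<and> (\<forall>a b. smooth_on \<Omega> (\<lambda>y. Q y a b)) \<and>
    (\<forall>q\<in>U. \<forall>a. schouten A c \<M> D q (cf a q) (cf a q) = (Q (\<phi> q) a a :: real))"
proof -
  note con = weylD(1)[OF D]
  obtain fm where fm: "\<And>j. smooth_on \<Omega> (fm j)" "\<And>y. y \<in> \<Omega> \<Longrightarrow> inj (\<lambda>j::'m. fm j y)"
    "\<And>y. y \<in> \<Omega> \<Longrightarrow> onb (gg y) UNIV (range (\<lambda>j. fm j y))"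
    using smooth_orthonormal_frame[where g=gg, OF open_\<Omega> gg_inner smooth_gg, of UNIV] by auto
  define tr where "tr b y = (\<Sum>j\<in>UNIV. b y (fm j y) (fm j y))" for b :: "real^'m \<Rightarrow> real^'m \<Rightarrow> real^'m \<Rightarrow> real" and y
  have tr: "(\<Sum>e\<in>range (\<lambda>j. fm j y). b y e e) = tr b y" if "y \<in> \<Omega>" for b y
    unfolding tr_def using fm(2)[OF that] by (simp add: sum.reindex)
  have str: "smooth_on \<Omega> (tr b)" if "\<And>y. y \<in> \<Omega> \<Longrightarrow> bilinear (b y)" "\<And>u v. smooth_on \<Omega> (\<lambda>y. b y u v)" for b
    unfolding tr_def by (rule smooth_frame_sum[OF open_\<Omega> subset_refl that fm(1)])
  have sR: "smooth_on \<Omega> (tr (Rc D))" by (rule str[OF bilinear_Rc[OF con] smooth_Rc[OF con]])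
  let ?m = "real CARD('m)"
  have sc: "schouten A c \<M> D q (cf a q) (cf a q) =
    (if CARD('m) = 2 then \<M> (unit_sec A q) q (cf a q) (cf a q) - hess0 A c D (unit_sec A q) q (cf a q) (cf a q)
     else (Rc D (\<phi> q) a a - tr (Rc D) (\<phi> q) / ?m * gg (\<phi> q) a a) / (?m - 2))
    + tr (Rc D) (\<phi> q) / (2 * (?m - 1)) / ?m * gg (\<phi> q) a a" if "q \<in> U" for q a
    using schouten_coord[OF D that fm(3), of \<M> a] tr[of "\<phi> q" "Rc D"] that by simp
  \<comment> \<open>Both cases yield a smooth bilinear form plus a smooth multiple of the
    metric.\<close>
  have final: ?thesis if "\<And>y. y \<in> \<Omega> \<Longrightarrow> bilinear (Q y)" "\<And>a b. smooth_on \<Omega> (\<lambda>y. Q y a b)" "smooth_on \<Omega> w"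
    "\<And>q a. q \<in> U \<Longrightarrow> schouten A c \<M> D q (cf a q) (cf a q) = Q (\<phi> q) a a + w (\<phi> q) * gg (\<phi> q) a a" for Q w
  proof (intro exI[of _ "\<lambda>y a b. Q y a b + w y * gg y a b"] conjI ballI allI)
    show "bilinear (\<lambda>a b. Q y a b + w y * gg y a b)" if "y \<in> \<Omega>" for y
      by (intro bilinear_plus bilinear_cmult bilinear_gg that \<open>y \<in> \<Omega> \<Longrightarrow> bilinear (Q y)\<close>)
    show "smooth_on \<Omega> (\<lambda>y. Q y a b + w y * gg y a b)" for a b
      by (intro smooth_on_add smooth_on_mult smooth_gg that open_\<Omega>)
  qed (use that in auto)
  show ?thesis
  proof (cases "CARD('m) = 2")
    case False
    show ?thesis
    proof (rule final)
      show "bilinear (\<lambda>a b. (1 / (?m - 2)) * Rc D y a b)" if "y \<in> \<Omega>" for y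
        by (intro bilinear_cmult bilinear_Rc con that)
      show "smooth_on \<Omega> (\<lambda>y. (1 / (?m - 2)) * Rc D y a b)" for a b
        by (intro smooth_on_mult smooth_on_const smooth_Rc con open_\<Omega>)
      \<comment> \<open>Coefficient of the metric: the \<open>sigma\<close> term minus the trace
        that is removed from the Ricci tensor.\<close>
      show "smooth_on \<Omega> (\<lambda>y. (1 / (2 * (?m - 1)) / ?m - 1 / ?m / (?m - 2)) * tr (Rc D) y)"
        by (intro smooth_on_mult smooth_on_const sR open_\<Omega>)
    qed (use False in \<open>simp add: sc diff_divide_distrib left_diff_distrib\<close>)
  next
    case True
    \<comment> \<open>\<open>D0\<close> is the reference structure: from it \<M> differs by the
      zeroth order term \<open>B\<close>.\<close>
    obtain D0 B where D0: "weyl D0" and B: "smooth_bil A 0 UNIV B"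
      "\<And>W l p u v. open W \<Longrightarrow> smooth_sec A 1 W l \<Longrightarrow> p \<in> W \<Longrightarrow> \<M> l p u v - hess0 A c D0 l p u v = B p u v * l p"
      using m(2)[OF True] unfolding moebius_structure_def order_zero_def by metis
    note con0 = weylD(1)[OF D0]
    let ?b = "\<lambda>y a b. \<beta> D0 D y a * \<beta> D0 D y b"
    have bb: "\<And>y. y \<in> \<Omega> \<Longrightarrow> bilinear (?b y)" by (intro bilinear_product linear_beta con0 con)
    have sb: "smooth_on \<Omega> (\<lambda>y. ?b y u v)" for u v by (intro smooth_on_mult smooth_beta con0 con open_\<Omega>)
    have M: "\<M> (unit_sec A q) q u v = hess0 A c D0 (unit_sec A q) q u v + B q u v" if q: "q \<in> U" for q u v
      using B(2)[OF cext_here(3) unit_sec_here cext_here(4)[OF q]] unit_sec_1 by (simp add: algebra_simps)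
    show ?thesis
    proof (rule final)
      show "bilinear (\<lambda>a b. (B (\<psi> y) (cf a (\<psi> y)) (cf b (\<psi> y)) + (-1) * nabla_\<beta> D0 D y a b) + ?b y a b)" if y: "y \<in> \<Omega>" for y
      proof (intro bilinear_plus bilinear_cmult bilinear_nabla_beta con0 con y bb)
        have "bilinear (B (\<psi> y))" using B(1) unfolding smooth_bil_def by blast
        then show "bilinear (\<lambda>a b. B (\<psi> y) (cf a (\<psi> y)) (cf b (\<psi> y)))"
          using linear_compose[OF linear_cf[OF psi_in[OF y]]] unfolding bilinear_def by (auto simp: o_def)
      qed
      show "smooth_on \<Omega> (\<lambda>y. (B (\<psi> y) (cf a (\<psi> y)) (cf b (\<psi> y)) + (-1) * nabla_\<beta> D0 D y a b) + ?b y a b)" for a b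
      proof (intro smooth_on_add smooth_on_mult smooth_on_const smooth_nabla_beta con0 con open_\<Omega> smooth_beta)
        have "smooth_fun A U (\<lambda>q. B q (cf a q) (cf b q))"
          using smooth_bil_fields[OF B(1) open_U _ smooth_cf smooth_cf] open_U by simp
        from smooth_funD[OF this chart open_U]
        show "smooth_on \<Omega> (\<lambda>y. B (\<psi> y) (cf a (\<psi> y)) (cf b (\<psi> y)))" by simp
      qed
      show "smooth_on \<Omega> (\<lambda>y. (1 / ?m) * (tr (nabla_\<beta> D0 D) y - tr ?b y) + (1 / (2 * (?m - 1)) / ?m) * tr (Rc D) y)"
        by (intro smooth_on_add smooth_on_mult smooth_on_const smooth_on_diff sR open_\<Omega> str bb sb
          bilinear_nabla_beta smooth_nabla_beta con0 con)
      show "schouten A c \<M> D q (cf a q) (cf a q) =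
          (B (\<psi> (\<phi> q)) (cf a (\<psi> (\<phi> q))) (cf a (\<psi> (\<phi> q))) + (-1) * nabla_\<beta> D0 D (\<phi> q) a a) + ?b (\<phi> q) a a
          + ((1 / ?m) * (tr (nabla_\<beta> D0 D) (\<phi> q) - tr ?b (\<phi> q)) + (1 / (2 * (?m - 1)) / ?m) * tr (Rc D) (\<phi> q)) * gg (\<phi> q) a a"
        if q: "q \<in> U" for q a
      proof -
        have y: "\<phi> q \<in> \<Omega>" using q by auto
        show ?thesis
          unfolding sc[OF q] M[OF q]
          using True hess0_diff[OF D0 D q fm(3)[OF y], of a] q
            tr[OF y, of "nabla_\<beta> D0 D"] tr[OF y, of ?b]
          by (simp add: power2_eq_square field_simps)
      qed
    qed
  qed
qed

end

locale slice_coordinates = conformal_coordinates A U \<phi> c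
  for A :: "('a::topological_space, 'm::finite) chart set" and U and \<phi> :: "'a \<Rightarrow> real^'m" and c +
  fixes n :: nat and N :: "'a set" and J :: "'m set"
  assumes slice: "slice_chart A n N U \<phi> J"
begin

abbreviation "VJ \<equiv> coord_subspace J"

definition fm :: "'m \<Rightarrow> real^'m \<Rightarrow> real^'m" where
  "fm = (SOME fm. (\<forall>j\<in>J. smooth_on \<Omega> (fm j)) \<and> (\<forall>y\<in>\<Omega>. inj_on (\<lambda>j. fm j y) J \<and>
    onb (gg y) VJ ((\<lambda>j. fm j y) ` J)))"

definition Ev :: "real^'m \<Rightarrow> (real^'m) set" where "Ev y = (\<lambda>j. fm j y) ` J"

text \<open>The orthogonal projection to \<open>VJ\<close>, available at every point of the chart
  image and not only along \<open>N\<close>; projected fields are therefore smooth on open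
  sets.\<close>

definition Pr :: "real^'m \<Rightarrow> real^'m \<Rightarrow> real^'m" where "Pr y = onb_proj (gg y) (Ev y)"

lemma fm: "j \<in> J \<Longrightarrow> smooth_on \<Omega> (fm j)" "y \<in> \<Omega> \<Longrightarrow> inj_on (\<lambda>j. fm j y) J"
  "y \<in> \<Omega> \<Longrightarrow> onb (gg y) VJ (Ev y)"
  using someI_ex[OF smooth_orthonormal_frame[where g=gg, OF open_\<Omega> gg_inner smooth_gg, of J]]
  unfolding fm_def[symmetric] Ev_def by blast+

lemma sum_Ev: "y \<in> \<Omega> \<Longrightarrow> (\<Sum>e\<in>Ev y. b e) = (\<Sum>j\<in>J. b (fm j y))"
  unfolding Ev_def using fm(2) by (simp add: sum.reindex)

lemma card_J: "card J = n"
  using slice unfolding slice_chart_def by blast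

lemma card_Ev: "y \<in> \<Omega> \<Longrightarrow> card (Ev y) = n"
  unfolding Ev_def using card_image[OF fm(2)] card_J by simp

lemma Pr:
  assumes "y \<in> \<Omega>"
  shows "linear (Pr y)" "Pr y v \<in> VJ" "w \<in> VJ \<Longrightarrow> gg y (Pr y v) w = gg y v w"
    "v \<in> VJ \<Longrightarrow> Pr y v = v" "(\<And>w. w \<in> VJ \<Longrightarrow> gg y v w = 0) \<Longrightarrow> Pr y v = 0"
  unfolding Pr_def using onb_proj[OF fm(3)[OF assms] gg_inner[OF assms]] by blast+

lemma smooth_Pr:
  assumes "smooth_on S X" "open S" "S \<subseteq> \<Omega>"
  shows "smooth_on S (\<lambda>y. Pr y (X y))"
proof (rule smooth_on_cong[OF assms(2)])
  note g = smooth_on_subset[OF smooth_gg assms(3)] and f = smooth_on_subset[OF fm(1) assms(3)]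
  show "smooth_on S (\<lambda>y. \<Sum>j\<in>J. gg y (X y) (fm j y) *\<^sub>R fm j y)"
    by (intro smooth_on_sum smooth_on_scaleR assms f smooth_on_bilinear_family[OF assms(2) _ g])
      (use bilinear_gg assms(3) in auto)
  show "(\<Sum>j\<in>J. gg y (X y) (fm j y) *\<^sub>R fm j y) = Pr y (X y)" if "y \<in> S" for y
  proof -
    have y: "y \<in> \<Omega>" using that assms(3) by blast
    show ?thesis unfolding Pr_def onb_proj_def Ev_def using fm(2)[OF y] by (simp add: sum.reindex)
  qed
qed

text \<open>The slice condition speaks about images; injectivity of \<phi> turns it into a condition
  on points.\<close>

lemma N_iff: "q \<in> U \<Longrightarrow> q \<in> N \<longleftrightarrow> \<phi> q \<in> VJ"
proof -
  assume q: "q \<in> U"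
  have e: "\<phi> ` (U \<inter> N) = \<Omega> \<inter> VJ" using slice unfolding slice_chart_def coord_subspace_def by blast
  show ?thesis
  proof
    assume "\<phi> q \<in> VJ"
    then have "\<phi> q \<in> \<phi> ` (U \<inter> N)" unfolding e using q by auto
    then obtain r where "r \<in> U" "r \<in> N" "\<phi> q = \<phi> r" by auto
    then show "q \<in> N" using q by (metis psi_phi)
  qed (use e q in auto)
qed

end

section \<open>Tangent and normal spaces in slice charts\<close>

text \<open>\<open>tangentN\<close> admits every slice chart, so the charts must give the same
  space. The transition map sends one slice into the other, hence its derivative maps tangential
  directions to tangential directions.\<close>

lemma (in smooth_manifold) slice_tangent_subset:
  assumes sU: "slice_chart A n N U \<phi> J" and sV: "slice_chart A n N V \<eta> J'" and q: "q \<in> U" "q \<in> V" "q \<in> N"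
    and v: "dchart A \<phi> q v \<in> coord_subspace J"
  shows "dchart A \<eta> q v \<in> coord_subspace J'"
proof -
  have U: "(U, \<phi>) \<in> A" and V: "(V, \<eta>) \<in> A" and eU: "\<phi> ` (U \<inter> N) = \<phi> ` U \<inter> coord_subspace J"
    and eV: "\<eta> ` (V \<inter> N) = \<eta> ` V \<inter> coord_subspace J'"
    using sU sV unfolding slice_chart_def coord_subspace_def by auto
  let ?S = "\<phi> ` (U \<inter> V)"
  have o: "open ?S" using chart_facts(4)[OF U] chart_facts(1)[OF V] by blast
  have y: "\<phi> q \<in> ?S" "\<phi> q \<in> coord_subspace J" using q eU by auto
  show ?thesis
    unfolding dchart_transition[OF U V q(1,2)]
  proof (rule dd_in_coord_subspace[OF o y(1) transition_differentiable[OF U V q(1,2)] subspace_coord_subspace y(2) v])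
    fix z assume z: "z \<in> ?S" "z \<in> coord_subspace J"
    then obtain r where r: "r \<in> U" "r \<in> V" "z = \<phi> r" by auto
    have "z \<in> \<phi> ` (U \<inter> N)" unfolding eU using z by auto
    then have "r \<in> N" using r U chart_inv by (metis IntE imageE)
    then show "\<eta> (inv_into U \<phi> z) \<in> coord_subspace J'" using r eV U by auto
  qed
qed

context slice_coordinates
begin

lemma tangent_iff:
  assumes "q \<in> U" "q \<in> N"
  shows "v \<in> tangentN A n N q \<longleftrightarrow> d\<phi> q v \<in> VJ"
proof
  assume "v \<in> tangentN A n N q"
  then obtain V \<eta> J' where V: "slice_chart A n N V \<eta> J'" "q \<in> V" "dchart A \<eta> q v \<in> coord_subspace J'"
    unfolding tangentN_def coord_subspace_def by blast
  show "d\<phi> q v \<in> VJ" by (rule slice_tangent_subset[OF V(1) slice V(2) assms V(3)])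
next
  assume "d\<phi> q v \<in> VJ"
  then show "v \<in> tangentN A n N q" unfolding tangentN_def coord_subspace_def using slice assms by blast
qed

lemma cf_image_iff: "q \<in> U \<Longrightarrow> v \<in> (\<lambda>a. cf a q) ` V \<longleftrightarrow> d\<phi> q v \<in> V"
proof
  assume q: "q \<in> U"
  show "d\<phi> q v \<in> V" if "v \<in> (\<lambda>a. cf a q) ` V" using that q by auto
  show "v \<in> (\<lambda>a. cf a q) ` V" if "d\<phi> q v \<in> V"
    by (rule image_eqI[of _ _ "d\<phi> q v"]) (use that q in simp_all)
qed

lemma tangent_image:
  assumes "q \<in> U" "q \<in> N"
  shows "tangentN A n N q = (\<lambda>a. cf a q) ` VJ"
  by (rule set_eqI) (simp only: tangent_iff[OF assms] cf_image_iff[OF assms(1)])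

definition NJ :: "real^'m \<Rightarrow> (real^'m) set" where "NJ y = {w. \<forall>v\<in>VJ. gg y w v = 0}"

lemma normal_iff:
  assumes "q \<in> U" "q \<in> N"
  shows "w \<in> normalN A c n N q \<longleftrightarrow> d\<phi> q w \<in> NJ (\<phi> q)"
  unfolding normalN_def tangent_image[OF assms] NJ_def c_gg[OF assms(1)]
  using rho_pos[OF assms(1)] assms(1) by auto

lemma normal_image:
  assumes "q \<in> U" "q \<in> N"
  shows "normalN A c n N q = (\<lambda>a. cf a q) ` NJ (\<phi> q)"
  by (rule set_eqI) (simp only: normal_iff[OF assms] cf_image_iff[OF assms(1)])

lemma subspace_NJ: "y \<in> \<Omega> \<Longrightarrow> subspace (NJ y)"
  unfolding NJ_def by (rule subspaceI)
    (auto simp: bilinear_ladd[OF bilinear_gg] bilinear_lmul[OF bilinear_gg] bilinear_lzero[OF bilinear_gg])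

lemma Pr_NJ: "y \<in> \<Omega> \<Longrightarrow> v - Pr y v \<in> NJ y"
  unfolding NJ_def using Pr(3) by (auto simp: bilinear_lsub[OF bilinear_gg])

lemma tan_proj_coord:
  assumes q: "q \<in> U" "q \<in> N"
  shows "tan_proj A c n N q w = cf (Pr (\<phi> q) (d\<phi> q w)) q"
  unfolding tan_proj_def
proof (rule the_equality)
  have y: "\<phi> q \<in> \<Omega>" using q by auto
  show "cf (Pr (\<phi> q) (d\<phi> q w)) q \<in> tangentN A n N q \<and> w - cf (Pr (\<phi> q) (d\<phi> q w)) q \<in> normalN A c n N q"
    unfolding tangent_iff[OF q] normal_iff[OF q] linear_diff[OF linear_dphi[OF q(1)]]
    using q Pr(2)[OF y] Pr_NJ[OF y] by simp
  fix v assume "v \<in> tangentN A n N q \<and> w - v \<in> normalN A c n N q"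
  then have v: "d\<phi> q v \<in> VJ" "d\<phi> q w - d\<phi> q v \<in> NJ (\<phi> q)"
    unfolding tangent_iff[OF q] normal_iff[OF q] linear_diff[OF linear_dphi[OF q(1)]] by auto
  have "Pr (\<phi> q) (d\<phi> q w - d\<phi> q v) = 0" by (rule Pr(5)[OF y]) (use v in \<open>auto simp: NJ_def\<close>)
  then have "Pr (\<phi> q) (d\<phi> q w) = d\<phi> q v" using linear_diff[OF Pr(1)[OF y]] Pr(4)[OF y v(1)] by simp
  then show "v = cf (Pr (\<phi> q) (d\<phi> q w)) q" using q by simp
qed

section \<open>The modified Hessian along the submanifold\<close>

text \<open>As \<open>Y\<close> is tangent along \<open>N\<close>, the derivative of its components
  in a tangential direction lies in \<open>VJ\<close> and passes unchanged through the projection.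
  It then cancels, and only the values of \<open>X\<close> and \<open>Y\<close> at \<open>q\<close>
  remain.\<close>

lemma hess_bar_fields_coord:
  assumes D: "weyl D" and q: "q \<in> U" "q \<in> N"
    and X: "tangent_field A n N q X" and Y: "tangent_field A n N q Y" and l: "extends_sec A k N l q l'"
  shows "hess_bar_fields A c n N D k X Y l' q =
    \<rho> q powr (k / 2) * HB (Pr (\<phi> q)) D k (fr k l') (\<phi> q) (d\<phi> q (X q)) (d\<phi> q (Y q))"
proof -
  obtain W1 W2 W3 where W1: "open W1" "q \<in> W1" "smooth_vf A W1 X" "\<And>q. q \<in> W1 \<inter> N \<Longrightarrow> X q \<in> tangentN A n N q"
    and W2: "open W2" "q \<in> W2" "smooth_vf A W2 Y" "\<And>q. q \<in> W2 \<inter> N \<Longrightarrow> Y q \<in> tangentN A n N q"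
    and W3: "open W3" "q \<in> W3" "smooth_sec A k W3 l'"
    using X Y l unfolding tangent_field_def extends_sec_def by blast
  let ?W = "W1 \<inter> W2 \<inter> W3 \<inter> U"
  have W: "open ?W" "?W \<subseteq> U" "q \<in> ?W" using W1 W2 W3 q open_U by auto
  have X': "smooth_vf A ?W X" by (rule smooth_vf_subset[OF W1(3)]) auto
  have Y': "smooth_vf A ?W Y" by (rule smooth_vf_subset[OF W2(3)]) auto
  have l': "smooth_sec A k ?W l'" by (rule smooth_sec_subset[OF W3(3)]) auto
  let ?S = "\<phi> ` ?W" and ?y = "\<phi> q"
  have y: "?y \<in> ?S" "?y \<in> VJ" "?S \<subseteq> \<Omega>" "?y \<in> \<Omega>" using W q N_iff[OF q(1)] by auto
  have o: "open ?S" by (rule open_image[OF W(1,2)])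
  have xV: "d\<phi> q (X q) \<in> VJ" using W1(4)[of q] W1(2) q tangent_iff[OF q] by auto
  have YV: "vc Y z \<in> VJ" if z: "z \<in> ?S" "z \<in> VJ" for z
  proof -
    have r: "\<psi> z \<in> W2" "\<psi> z \<in> U" "\<phi> (\<psi> z) = z" using z by auto
    then have "\<psi> z \<in> N" using N_iff[OF r(2)] z by simp
    then show ?thesis unfolding vc_def using tangent_iff[OF r(2)] W2(4) r by auto
  qed
  have dV: "dd (vc Y) ?y (d\<phi> q (X q)) \<in> VJ"
    by (rule dd_in_coord_subspace[OF o y(1) smooth_on_differentiable[OF smooth_vc[OF Y' W(2)] y(1)]
        subspace_coord_subspace y(2) xV YV])
  have DXY: "d\<phi> q (D X Y q) = dd (vc Y) ?y (d\<phi> q (X q)) + \<Gamma> D ?y (d\<phi> q (X q)) (d\<phi> q (Y q))"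
    using connection_coord[OF weylD(1)[OF D] W(1,2) X' Y' y(1)] q by (simp add: vc_phi)
  note ld = linear_der[OF weylD(1)[OF D] smooth_fr[OF l' W(1,2)] y(3,1)]
  have "nablaL A D k (\<lambda>q. tan_proj A c n N q (D X Y q)) l' q = \<rho> q powr (k / 2) *
     (der D k (fr k l') ?y (dd (vc Y) ?y (d\<phi> q (X q)))
       + der D k (fr k l') ?y (Pr ?y (\<Gamma> D ?y (d\<phi> q (X q)) (d\<phi> q (Y q)))))"
    unfolding nablaL_coord[OF D W(1,2) l' W(3)] tan_proj_coord[OF q] DXY dphi_cf[OF q(1)]
      linear_add[OF Pr(1)[OF y(4)]] Pr(4)[OF y(4) dV] linear_add[OF ld] ..
  then show ?thesis
    unfolding hess_bar_fields_def nablaL_nablaL[OF D W(1,2) l' Y' W(3)] HB_def by (simp add: algebra_simps)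
qed

text \<open>Only tangential derivatives occur: the outer one is in the direction \<open>a\<close>,
  and \<open>Pr\<close> makes the direction of the last term tangential. These depend on the values
  along the slice alone.\<close>

lemma HB_restrict:
  assumes D: "connection A D" and S: "open S" "S \<subseteq> \<Omega>" "y \<in> S" "y \<in> VJ"
    and f: "smooth_on S f" "smooth_on S f'" "\<And>z. z \<in> S \<Longrightarrow> z \<in> VJ \<Longrightarrow> f z = f' z"
    and ab: "a \<in> VJ" "b \<in> VJ"
  shows "HB (Pr y) D k f y a b = HB (Pr y) D k f' y a b"
proof -
  have d: "dd f z v = dd f' z v" if z: "z \<in> S" "z \<in> VJ" "v \<in> VJ" for z v
  proof -
    have "dd (\<lambda>z. f z - f' z) z v = 0"
      by (rule dd_zero_on_subspace[OF S(1) z(1) smooth_on_differentiable[OF smooth_on_diff[OF S(1) f(1,2)] z(1)]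
          subspace_coord_subspace z(2,3)]) (simp add: f(3))
    then show ?thesis using dd_diff[OF f(1,2) z(1)] by simp
  qed
  have e: "der D k f z v = der D k f' z v" if z: "z \<in> S" "z \<in> VJ" "v \<in> VJ" for z v
    unfolding der_def using d[OF z] f(3)[OF z(1,2)] by simp
  note s = smooth_der[OF D f(1) S(2,1), of k b] smooth_der[OF D f(2) S(2,1), of k b]
  have "dd (\<lambda>z. der D k f z b - der D k f' z b) y a = 0"
    by (rule dd_zero_on_subspace[OF S(1,3) smooth_on_differentiable[OF smooth_on_diff[OF S(1) s] S(3)]
          subspace_coord_subspace S(4) ab(1)]) (simp add: e ab)
  then have "dd (\<lambda>z. der D k f z b) y a = dd (\<lambda>z. der D k f' z b) y a"
    using dd_diff[OF s S(3)] by simp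
  moreover have "Pr y v \<in> VJ" for v using Pr(2) S by auto
  ultimately show ?thesis unfolding HB_def using e[OF S(3,4)] ab by simp
qed

end

section \<open>Normal fields, mean curvature and choices of extensions\<close>

context slice_coordinates
begin

text \<open>The mean curvature form is represented by the normal part \<open>Hn\<close> of this vector.\<close>
definition Hv :: "('a, 'm) conn \<Rightarrow> real^'m \<Rightarrow> real^'m" where
  "Hv D y = (1 / real n) *\<^sub>R (\<Sum>e\<in>Ev y. \<Gamma> D y e e)"

lemma normal_extension:
  assumes q: "q \<in> U" "q \<in> N" and \<xi>: "\<xi> \<in> NJ (\<phi> q)"
  shows "\<exists>Z. normal_field A c n N q Z \<and> Z q = cf \<xi> q"
proof -
  \<comment> \<open>A constant vector made normal everywhere by removing its tangential part; at
    \<open>q\<close> nothing is removed.\<close>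
  let ?Z = "\<lambda>y. \<xi> - Pr y \<xi>"
  have s: "smooth_on \<Omega> ?Z"
    by (intro smooth_on_diff smooth_on_const smooth_Pr open_\<Omega> subset_refl)
  have "normal_field A c n N q (\<lambda>r. cf (?Z (\<phi> r)) r)"
    unfolding normal_field_def
  proof (intro exI conjI ballI)
    show "smooth_vf A U (\<lambda>r. cf (?Z (\<phi> r)) r)"
      by (rule smooth_vf_const_combination[OF s open_U subset_refl])
    fix r assume "r \<in> U \<inter> N"
    then show "cf (?Z (\<phi> r)) r \<in> normalN A c n N r" using normal_iff[of r] Pr_NJ[of "\<phi> r" \<xi>] by auto
  qed (use open_U q in auto)
  moreover have "Pr (\<phi> q) \<xi> = 0" by (rule Pr(5)) (use q \<xi> in \<open>auto simp: NJ_def\<close>)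
  ultimately show ?thesis by (intro exI[of _ "\<lambda>r. cf (?Z (\<phi> r)) r"]) simp
qed

lemma tangent_extension:
  assumes q: "q \<in> U" "q \<in> N" and a: "a \<in> VJ"
  shows "tangent_field A n N q (cf a)"
  unfolding tangent_field_def
  by (intro exI[of _ U] conjI ballI open_U q smooth_cf subset_refl) (use tangent_iff a in auto)

text \<open>Differentiating g(Z, e) = 0 along \<open>N\<close> with \<open>e\<close> constant moves
  the derivative from \<open>Z\<close> to \<open>\<Gamma> D y e e\<close>; the \<alpha> term of
  \<open>gg_compat\<close> carries the factor g(\<xi>, e) = 0. The normal field chosen by
  \<open>SOME\<close> thus does not matter.\<close>

lemma mean_curv_coord:
  assumes D: "weyl D" and q: "q \<in> U" "q \<in> N" and \<xi>: "\<xi> \<in> NJ (\<phi> q)"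
  shows "mean_curv A c n N D q (cf \<xi> q) = gg (\<phi> q) \<xi> (Hv D (\<phi> q))"
proof -
  let ?y = "\<phi> q"
  have y: "?y \<in> \<Omega>" "?y \<in> VJ" using q N_iff by auto
  note con = weylD(1)[OF D]
  define Z where "Z = (SOME Z. normal_field A c n N q Z \<and> Z q = cf \<xi> q)"
  have "normal_field A c n N q Z \<and> Z q = cf \<xi> q"
    unfolding Z_def by (rule someI_ex[OF normal_extension[OF q \<xi>]])
  then obtain W0 where W0: "open W0" "q \<in> W0" "smooth_vf A W0 Z" "\<And>r. r \<in> W0 \<inter> N \<Longrightarrow> Z r \<in> normalN A c n N r"
    and Zq: "Z q = cf \<xi> q" unfolding normal_field_def by blast
  let ?W = "W0 \<inter> U"
  have W: "open ?W" "?W \<subseteq> U" "q \<in> ?W" using W0 q open_U by auto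
  have sZ: "smooth_vf A ?W Z" by (rule smooth_vf_subset[OF W0(3)]) auto
  let ?S = "\<phi> ` ?W"
  have S: "open ?S" "?y \<in> ?S" "?S \<subseteq> \<Omega>" using open_image[OF W(1,2)] W by auto
  note sz = smooth_vc[OF sZ W(2)]
  have z\<xi>: "vc Z ?y = \<xi>" using vc_phi[OF q(1)] Zq q by simp
  note sg = smooth_on_subset[OF smooth_gg S(3)]
  have bg: "z \<in> ?S \<Longrightarrow> bilinear (gg z)" for z using bilinear_gg S(3) by blast
  have Zn: "gg z (vc Z z) e = 0" if z: "z \<in> ?S" "z \<in> VJ" and e: "e \<in> VJ" for z e
  proof -
    have r: "\<psi> z \<in> W0" "\<psi> z \<in> U" "\<phi> (\<psi> z) = z" using z by auto
    then have rN: "\<psi> z \<in> N" using N_iff[OF r(2)] z by simp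
    show ?thesis using normal_iff[OF r(2) rN, of "Z (\<psi> z)"] W0(4) r rN e unfolding vc_def NJ_def by auto
  qed
  let ?dZ = "\<lambda>a. dd (vc Z) ?y a + \<Gamma> D ?y a \<xi>"
  have key: "gg ?y (?dZ e) e = - gg ?y \<xi> (\<Gamma> D ?y e e)" if e: "e \<in> VJ" for e
  proof -
    have sze: "smooth_on ?S (\<lambda>z. gg z (vc Z z) e)"
      by (rule smooth_on_bilinear_family[OF S(1) bg sg sz smooth_on_const])
    have "dd (\<lambda>z. gg z (vc Z z) e) ?y e = 0"
      by (rule dd_zero_on_subspace[OF S(1,2) smooth_on_differentiable[OF sze S(2)] subspace_coord_subspace y(2) e Zn])
        (use e in auto)
    moreover have "dd (\<lambda>z. gg z (vc Z z) e) ?y e = dd (\<lambda>z. gg z \<xi> e) ?y e + gg ?y (dd (vc Z) ?y e) e"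
      using dd_bilinear_family[OF S(1) bg sg sz smooth_on_const S(2), of e e] z\<xi> bilinear_rzero[OF bilinear_gg[OF y(1)]] by simp
    moreover have "gg ?y \<xi> e = 0" using \<xi> e unfolding NJ_def by auto
    ultimately show ?thesis
      unfolding bilinear_ladd[OF bilinear_gg[OF y(1)]] using gg_compat[OF D y(1), of \<xi> e e] by simp
  qed
  have "d\<phi> q (D (cext A q v) Z q) = ?dZ (d\<phi> q v)" for v
  proof -
    let ?W' = "?W \<inter> pdom A q"
    have W': "open ?W'" "?W' \<subseteq> U" "q \<in> ?W'" using W cext_here(3)[of q] cext_here(4)[OF q(1)] chart_facts(1)[OF pchart_mem] by auto
    have s: "smooth_vf A ?W' (cext A q v)" "smooth_vf A ?W' Z"
      by (rule smooth_vf_subset[OF cext_here(1)]; auto) (rule smooth_vf_subset[OF sZ]; auto)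
    have "?y \<in> \<phi> ` ?W'" using W' by auto
    from connection_coord[OF con W'(1,2) s this] show ?thesis
      using q z\<xi> by (simp add: vc_phi cext_here(2))
  qed
  then have f: "tan_proj A c n N q (D (cext A q (cf a q)) Z q) = cf (Pr ?y (?dZ a)) q" for a
    unfolding tan_proj_coord[OF q] using q by simp
  have lin: "linear (\<lambda>a. Pr ?y (?dZ a))"
  proof -
    have "linear ?dZ" using smooth_on_linear_dd[OF sz S(2)] bilinear_Gamma[OF con y(1)] unfolding bilinear_def
      by (auto intro: linear_compose_add)
    from linear_compose[OF this Pr(1)[OF y(1)]] show ?thesis by (simp add: o_def)
  qed
  have "lin_trace (tangentN A n N q) (\<lambda>v. tan_proj A c n N q (D (cext A q v) Z q)) = (\<Sum>e\<in>Ev ?y. gg ?y (Pr ?y (?dZ e)) e)"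
    unfolding tangent_image[OF q]
    by (rule lin_trace_transport[where K="\<lambda>a. cf a q" and K'="d\<phi> q" and c="c q" and r="\<rho> q" and g="gg ?y" and f'="\<lambda>a. Pr ?y (?dZ a)",
      OF fm(3)[OF y(1)] gg_inner[OF y(1)] linear_cf[OF q(1)] linear_dphi[OF q(1)] dphi_cf[OF q(1)] c_inner c_cf[OF q(1)] rho_pos[OF q(1)] lin f Pr(2)[OF y(1)]])
  also have "\<dots> = (\<Sum>e\<in>Ev ?y. - gg ?y \<xi> (\<Gamma> D ?y e e))"
    using onb_in[OF fm(3)[OF y(1)]] Pr(3)[OF y(1)] key by (intro sum.cong refl) simp
  finally have "mean_curv A c n N D q (cf \<xi> q) = (1 / real n) * (\<Sum>e\<in>Ev ?y. gg ?y \<xi> (\<Gamma> D ?y e e))"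
    unfolding mean_curv_def Let_def Z_def[symmetric] by (simp add: sum_negf)
  also have "\<dots> = gg ?y \<xi> (Hv D ?y)"
    unfolding Hv_def using inner_formD(4)[OF gg_inner[OF y(1)]]
    by (simp add: linear_scale linear_sum sum_divide_distrib)
  finally show ?thesis .
qed

definition Hn :: "('a, 'm) conn \<Rightarrow> real^'m \<Rightarrow> real^'m" where
  "Hn D y = Hv D y - Pr y (Hv D y)"

text \<open>\<open>Hn\<close> is the metric dual of the mean curvature form within the normal space,
  so Parseval gives its squared length; dividing by \<rho> accounts for the weight -2.\<close>

lemma mean_curv_sq_coord:
  assumes D: "weyl D" and q: "q \<in> U" "q \<in> N"
  shows "mean_curv_sq A c n N D q = gg (\<phi> q) (Hn D (\<phi> q)) (Hn D (\<phi> q)) / \<rho> q"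
proof -
  let ?y = "\<phi> q"
  have y: "?y \<in> \<Omega>" "?y \<in> VJ" using q N_iff by auto
  note g = gg_inner[OF y(1)]
  obtain F where F: "onb (gg ?y) (NJ ?y) F" using onb_exists[OF g subspace_NJ[OF y(1)]] by blast
  have h: "Hn D ?y \<in> NJ ?y" unfolding Hn_def by (rule Pr_NJ[OF y(1)])
  have H: "mean_curv A c n N D q (cf \<xi> q) = gg ?y (Hn D ?y) \<xi>" if "\<xi> \<in> NJ ?y" for \<xi>
  proof -
    have "gg ?y \<xi> (Pr ?y (Hv D ?y)) = 0" using that Pr(2)[OF y(1)] unfolding NJ_def by auto
    then show ?thesis unfolding mean_curv_coord[OF D q that] Hn_def
      using inner_formD(2)[OF g, of _ \<xi>] bilinear_rsub[OF bilinear_gg[OF y(1)]] by simp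
  qed
  have "mean_curv_sq A c n N D q = (\<Sum>f\<in>F. gg ?y (Hn D ?y) f * gg ?y (Hn D ?y) f) / \<rho> q"
    unfolding mean_curv_sq_def normal_image[OF q]
    by (rule trace_c_coord[OF q(1) F bilinear_product[OF inner_formD(4)[OF g]]]) (simp add: H)
  also have "(\<Sum>f\<in>F. gg ?y (Hn D ?y) f * gg ?y (Hn D ?y) f) = gg ?y (Hn D ?y) (Hn D ?y)"
    by (rule trans[OF _ onb_parseval[OF F g h, symmetric]])
      (intro sum.cong refl arg_cong2[where f="(*)"] inner_formD(2)[OF g])
  finally show ?thesis .
qed

lemma extends_nbhd:
  assumes "extends_sec A k N l q l'" "q \<in> U"
  obtains W where "open W" "W \<subseteq> U" "q \<in> W" "smooth_sec A k W l'" "\<And>r. r \<in> W \<Longrightarrow> r \<in> N \<Longrightarrow> l' r = l r"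
proof -
  obtain W where W: "open W" "q \<in> W" "smooth_sec A k W l'" "\<forall>q\<in>W \<inter> N. l' q = l q"
    using assms unfolding extends_sec_def by blast
  show ?thesis
    by (rule that[of "W \<inter> U"]) (use W assms open_U smooth_sec_subset[OF W(3)] in auto)
qed

lemma HB_extension:
  assumes D: "weyl D" and q: "q \<in> U" "q \<in> N"
    and l: "extends_sec A k N l q l1" "extends_sec A k N l q l2" and ab: "a \<in> VJ" "b \<in> VJ"
  shows "HB (Pr (\<phi> q)) D k (fr k l1) (\<phi> q) a b = HB (Pr (\<phi> q)) D k (fr k l2) (\<phi> q) a b"
proof -
  obtain W1 where W1: "open W1" "W1 \<subseteq> U" "q \<in> W1" "smooth_sec A k W1 l1" "\<And>r. r \<in> W1 \<Longrightarrow> r \<in> N \<Longrightarrow> l1 r = l r"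
    using extends_nbhd[OF l(1) q(1)] by metis
  obtain W2 where W2: "open W2" "W2 \<subseteq> U" "q \<in> W2" "smooth_sec A k W2 l2" "\<And>r. r \<in> W2 \<Longrightarrow> r \<in> N \<Longrightarrow> l2 r = l r"
    using extends_nbhd[OF l(2) q(1)] by metis
  let ?W = "W1 \<inter> W2"
  have W: "open ?W" "?W \<subseteq> U" "q \<in> ?W" using W1 W2 by auto
  have s: "smooth_sec A k ?W l1" "smooth_sec A k ?W l2"
    by (rule smooth_sec_subset[OF W1(4)]; auto) (rule smooth_sec_subset[OF W2(4)]; auto)
  have y: "\<phi> ` ?W \<subseteq> \<Omega>" "\<phi> q \<in> \<phi> ` ?W" "\<phi> q \<in> VJ" using W q N_iff by auto
  show ?thesis
  proof (rule HB_restrict[OF weylD(1)[OF D] open_image[OF W(1,2)] y smooth_fr[OF s(1) W(1,2)] smooth_fr[OF s(2) W(1,2)] _ ab])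
    fix z assume z: "z \<in> \<phi> ` ?W" "z \<in> VJ"
    then have r: "\<psi> z \<in> ?W" "\<phi> (\<psi> z) = z" using W by auto
    then have "\<psi> z \<in> N" using N_iff[of "\<psi> z"] W z by auto
    then show "fr k l1 z = fr k l2 z" using W1(5) W2(5) r unfolding fr_def by auto
  qed
qed

text \<open>All three choices by \<open>SOME\<close> are harmless: the value depends on the two
  fields at \<open>q\<close> only and on the section along \<open>N\<close> only.\<close>

lemma hess_bar_coord:
  assumes D: "weyl D" and q: "q \<in> U" "q \<in> N" and l: "extends_sec A k N l q l'"
    and ab: "a \<in> VJ" "b \<in> VJ"
  shows "hess_bar A c n N D k l q (cf a q) (cf b q) = \<rho> q powr (k / 2) * HB (Pr (\<phi> q)) D k (fr k l') (\<phi> q) a b"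
proof -
  define X where "X a = (SOME X. tangent_field A n N q X \<and> X q = cf a q)" for a
  have X: "tangent_field A n N q (X a)" "X a q = cf a q" if "a \<in> VJ" for a
    using someI[of "\<lambda>X. tangent_field A n N q X \<and> X q = cf a q" "cf a"] tangent_extension[OF q that]
    unfolding X_def by auto
  define l0 where "l0 = (SOME l'. extends_sec A k N l q l')"
  have l0: "extends_sec A k N l q l0" unfolding l0_def by (rule someI[of _ l']) (rule l)
  show ?thesis
    unfolding hess_bar_def X_def[symmetric] l0_def[symmetric]
      hess_bar_fields_coord[OF D q X(1)[OF ab(1)] X(1)[OF ab(2)] l0] X(2)[OF ab(1)] X(2)[OF ab(2)]
      dphi_cf[OF q(1)] HB_extension[OF D q l0 l ab] ..
qed

section \<open>The operator in the gauge: smoothness and invariance\<close>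

text \<open>The traces over TN and the square norm of the mean curvature lower the weight by 2,
  whence the common factor \<open>\<rho> powr (k / 2 - 1)\<close>.\<close>

lemma L_ind_coord:
  assumes D: "weyl D" and q: "q \<in> U" "q \<in> N" and k: "k = 1 - real n / 2" and l: "extends_sec A k N l q l'"
    and Q: "bilinear Q" "\<And>a. schouten A c \<M> D q (cf a q) (cf a q) = Q a a"
  shows "L_ind A c \<M> n N D l q = \<rho> q powr (k / 2 - 1) *
    ((\<Sum>e\<in>Ev (\<phi> q). HB (Pr (\<phi> q)) D k (fr k l') (\<phi> q) e e)
     + (k * (\<Sum>e\<in>Ev (\<phi> q). Q e e) + k * real n / 2 * gg (\<phi> q) (Hn D (\<phi> q)) (Hn D (\<phi> q))) * fr k l' (\<phi> q))"
proof -
  let ?y = "\<phi> q" and ?p = "\<rho> q powr (k / 2)"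
  have y: "?y \<in> \<Omega>" "?y \<in> VJ" using q N_iff by auto
  have rp: "\<rho> q > 0" by (rule rho_pos[OF q(1)])
  obtain W where W: "open W" "W \<subseteq> U" "q \<in> W" "smooth_sec A k W l'" "\<And>r. r \<in> W \<Longrightarrow> r \<in> N \<Longrightarrow> l' r = l r"
    using extends_nbhd[OF l q(1)] by metis
  have S: "\<phi> ` W \<subseteq> \<Omega>" "?y \<in> \<phi> ` W" using W by auto
  note E = fm(3)[OF y(1)]
  have bH: "bilinear (HB (Pr ?y) D k (fr k l') ?y)"
    by (rule bilinear_HB[OF weylD(1)[OF D] smooth_fr[OF W(4,1,2)] S(1) open_image[OF W(1,2)] S(2) Pr(1)[OF y(1)]])
  have t1: "trace_c (c q) (tangentN A n N q) (hess_bar A c n N D k l q)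
      = (\<Sum>e\<in>Ev ?y. ?p * HB (Pr ?y) D k (fr k l') ?y e e) / \<rho> q"
    unfolding tangent_image[OF q]
    by (rule trace_c_coord[OF q(1) E bilinear_cmult[OF bH]]) (rule hess_bar_coord[OF D q l])
  have t2: "trace_c (c q) (tangentN A n N q) (schouten A c \<M> D q) = (\<Sum>e\<in>Ev ?y. Q e e) / \<rho> q"
    unfolding tangent_image[OF q] by (rule trace_c_coord[where B="schouten A c \<M> D q" and B'=Q, OF q(1) E Q])
  have lq: "l q = ?p * fr k l' ?y" unfolding fr_def using W(3,5) q rp by (simp add: powr_minus)
  have pw: "\<rho> q powr (k / 2 - 1) = ?p / \<rho> q" using rp by (simp add: powr_diff)
  show ?thesis
    unfolding L_ind_def Let_def k[symmetric] t1 t2 mean_curv_sq_coord[OF D q] lq pw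
    by (simp add: algebra_simps add_divide_distrib flip: sum_distrib_left)
qed

text \<open>The expression of \<open>L_ind_coord\<close> makes sense and is smooth on an open set,
  because frame, projection and mean curvature vector are. Read as a section of weight k - 2, it is
  the required extension.\<close>

lemma L_ind_smooth:
  assumes D: "weyl D" and m: "2 \<le> CARD('m)" "CARD('m) = 2 \<Longrightarrow> moebius_structure A c \<M>"
    and q: "q \<in> U" "q \<in> N" and k: "k = 1 - real n / 2" and l: "extends_sec A k N l q l'"
  shows "\<exists>L. extends_sec A (k - 2) N (L_ind A c \<M> n N D l) q L"
proof -
  note con = weylD(1)[OF D]
  obtain Q where Q: "\<And>y. y \<in> \<Omega> \<Longrightarrow> bilinear (Q y)" "\<And>a b. smooth_on \<Omega> (\<lambda>y. Q y a b)"
    "\<And>q a. q \<in> U \<Longrightarrow> schouten A c \<M> D q (cf a q) (cf a q) = Q (\<phi> q) a a"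
    using schouten_smooth[OF D m] by blast
  obtain W where W: "open W" "W \<subseteq> U" "q \<in> W" "smooth_sec A k W l'" "\<And>r. r \<in> W \<Longrightarrow> r \<in> N \<Longrightarrow> l' r = l r"
    using extends_nbhd[OF l q(1)] by metis
  let ?S = "\<phi> ` W" and ?f = "fr k l'"
  have o: "open ?S" and S: "?S \<subseteq> \<Omega>" using open_image[OF W(1,2)] W by auto
  note sf = smooth_fr[OF W(4,1,2)]
  have yS: "y \<in> \<Omega>" if "y \<in> ?S" for y using that S by auto
  note res = smooth_on_subset[OF _ S]
  have sE: "smooth_on ?S (\<lambda>y. \<Sum>e\<in>Ev y. b y e e)" if "\<And>y. y \<in> ?S \<Longrightarrow> bilinear (b y)" "\<And>u v. smooth_on ?S (\<lambda>y. b y u v)"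
    for b :: "real^'m \<Rightarrow> real^'m \<Rightarrow> real^'m \<Rightarrow> real"
  proof (rule smooth_on_cong[OF o])
    show "smooth_on ?S (\<lambda>y. \<Sum>j\<in>J. b y (fm j y) (fm j y))"
      by (rule smooth_frame_sum[OF o S that fm(1)])
  qed (rule sum_Ev[OF yS, symmetric])
  have sHB: "smooth_on ?S (\<lambda>y. HB (Pr y) D k ?f y a b)" for a b
    unfolding HB_def
    by (intro smooth_on_diff smooth_on_add smooth_on_mult smooth_on_const smooth_on_dd_const o
      smooth_der con sf S res[OF smooth_alpha] smooth_on_linear_family[OF o linear_der[OF con sf S]]
      smooth_Pr res[OF smooth_Gamma])
  have bHB: "bilinear (HB (Pr y) D k ?f y)" if "y \<in> ?S" for y
    by (rule bilinear_HB[OF con sf S o that Pr(1)[OF yS[OF that]]])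
  have sHv: "smooth_on ?S (Hv D)"
  proof (rule smooth_on_cong[OF o])
    show "smooth_on ?S (\<lambda>y. (1 / real n) *\<^sub>R (\<Sum>j\<in>J. \<Gamma> D y (fm j y) (fm j y)))"
    proof (intro smooth_on_scaleR smooth_on_const smooth_on_sum o)
      fix j assume "j \<in> J"
      note f = res[OF fm(1)[OF this]]
      show "smooth_on ?S (\<lambda>y. \<Gamma> D y (fm j y) (fm j y))"
        by (rule smooth_on_bilinear_family[where B="\<Gamma> D", OF o bilinear_Gamma[OF con yS] res[OF smooth_Gamma[OF con]] f f])
    qed
  qed (simp only: Hv_def sum_Ev[OF yS])
  have sHn: "smooth_on ?S (Hn D)" unfolding Hn_def
    by (intro smooth_on_diff smooth_Pr o S sHv)
  have sgH: "smooth_on ?S (\<lambda>y. gg y (Hn D y) (Hn D y))"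
    by (rule smooth_on_bilinear_family[OF o bilinear_gg[OF yS] res[OF smooth_gg] sHn sHn])
  let ?F = "\<lambda>y. (\<Sum>e\<in>Ev y. HB (Pr y) D k ?f y e e) + (k * (\<Sum>e\<in>Ev y. Q y e e) + k * real n / 2 * gg y (Hn D y) (Hn D y)) * ?f y"
  have sF: "smooth_on ?S ?F"
    by (intro smooth_on_add smooth_on_mult smooth_on_const o sE sHB bHB Q(1) yS res[OF Q(2)] sgH sf)
  define L where "L r = \<rho> r powr ((k - 2) / 2) * ?F (\<phi> r)" for r
  have "smooth_sec A (k - 2) W L"
    by (rule smooth_sec_fr[OF sF W(1,2)]) (simp add: L_def)
  moreover have "L r = L_ind A c \<M> n N D l r" if r: "r \<in> W \<inter> N" for r
  proof -
    have rU: "r \<in> U" "r \<in> N" and y: "\<phi> r \<in> \<Omega>" using r W by auto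
    have "extends_sec A k N l r l'" unfolding extends_sec_def using W r by blast
    from L_ind_coord[OF D rU k this Q(1)[OF y] Q(3)[OF rU(1)]] show ?thesis
      unfolding L_def by (simp add: diff_divide_distrib)
  qed
  ultimately show ?thesis unfolding extends_sec_def using W by blast
qed

lemma L_ind_invariant:
  assumes D: "weyl D" "weyl D'"
    and m: "2 \<le> CARD('m)" "CARD('m) = 2 \<Longrightarrow> moebius_structure A c \<M>" and n: "1 \<le> n"
    and q: "q \<in> U" "q \<in> N" and k: "k = 1 - real n / 2" and l: "extends_sec A k N l q l'"
  shows "L_ind A c \<M> n N D l q = L_ind A c \<M> n N D' l q"
proof -
  note con = weylD(1)[OF D(1)] weylD(1)[OF D(2)]
  let ?y = "\<phi> q" and ?P = "Pr (\<phi> q)" and ?E = "Ev (\<phi> q)"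
  have y: "?y \<in> \<Omega>" "?y \<in> VJ" using q N_iff by auto
  obtain Q where Q: "bilinear Q" "\<And>a. schouten A c \<M> D q (cf a q) (cf a q) = Q a a"
    using schouten_smooth[OF D(1) m] q y by metis
  obtain Q' where Q': "bilinear Q'" "\<And>a. schouten A c \<M> D' q (cf a q) (cf a q) = Q' a a"
    using schouten_smooth[OF D(2) m] q y by metis
  obtain W where W: "open W" "W \<subseteq> U" "q \<in> W" "smooth_sec A k W l'"
    using extends_nbhd[OF l q(1)] by metis
  define f where "f = fr k l'"
  have S: "smooth_on (\<phi> ` W) f" "\<phi> ` W \<subseteq> \<Omega>" "open (\<phi> ` W)" "?y \<in> \<phi> ` W"
    unfolding f_def using smooth_fr[OF W(4,1,2)] open_image[OF W(1,2)] W by auto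
  note g = gg_inner[OF y(1)] and bg = bilinear_gg[OF y(1)] and E = fm(3)[OF y(1)] and P = Pr[OF y(1)]
  obtain F where F: "onb (gg ?y) UNIV F" using onb_exists[OF g subspace_UNIV] by blast
  obtain s where s: "\<And>z. gg ?y s z = \<beta> D D' ?y z" using beta_sharp[OF con y(1)] by blast
  let ?b = "\<beta> D D' ?y"
  note lb = linear_beta[OF con y(1)] and ld = linear_der[OF con(1) S(1,2,4), of k]
  have Ps: "?P s = (\<Sum>e\<in>?E. ?b e *\<^sub>R e)" unfolding Pr_def onb_proj_def s ..
  have LPs: "L (?P s) = (\<Sum>e\<in>?E. ?b e *\<^sub>R L e)" if "linear L" for L :: "real^'m \<Rightarrow> 'z::real_vector"
    unfolding Ps by (simp add: linear_sum[OF that] linear_scale[OF that])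
  \<comment> \<open>\<open>b2\<close> and \<open>B2\<close> are the squared norms of the tangential
    part of \<beta> and of \<beta> itself. \<open>Ds\<close> is the only first order quantity that
    survives the trace.\<close>
  define b2 where "b2 = (\<Sum>e\<in>?E. (?b e)\<^sup>2)"
  define B2 where "B2 = (\<Sum>e\<in>F. (?b e)\<^sup>2)"
  define Ds where "Ds = der D k f ?y (?P s)"
  have bPs: "?b (?P s) = b2" using LPs[OF lb] by (simp add: b2_def power2_eq_square)
  have DPs: "(\<Sum>e\<in>?E. ?b e * der D k f ?y e) = Ds" using LPs[OF ld] by (simp add: Ds_def)
  have s': "gg ?y z s = ?b z" for z using inner_formD(2)[OF g, of z s] s[of z] by (simp only:)
  have bs: "?b s = B2" using onb_parseval[OF F g UNIV_I, of s s]
    unfolding s s' B2_def by (simp only: power2_eq_square)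
  have cE: "card ?E = n" by (rule card_Ev[OF y(1)])
  have eV: "e \<in> VJ" and ge: "gg ?y e e = 1" if "e \<in> ?E" for e using onb_in[OF E that] onb_norm[OF E that] by auto
  have Te: "T D D' ?y e e = (2 * ?b e) *\<^sub>R e - s" if "e \<in> ?E" for e
    using T_diag[OF D y(1) s, of e] ge[OF that] by simp
  have PTe: "?P (T D D' ?y e e) = (2 * ?b e) *\<^sub>R e - ?P s" if "e \<in> ?E" for e
    unfolding Te[OF that] linear_diff[OF P(1)] linear_scale[OF P(1)] P(4)[OF eV[OF that]] ..
  \<comment> \<open>The frame is frozen at \<open>?y\<close>, so the covariant derivative of \<beta>
    splits into \<open>db\<close> and a Christoffel trace. The Hessian sees the projected trace
    \<open>bPG\<close>, the Schouten tensor the full trace \<open>bG\<close>.\<close>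
  define db where "db = (\<Sum>e\<in>?E. dd (\<lambda>z. \<beta> D D' z e) ?y e)"
  define bG where "bG = (\<Sum>e\<in>?E. ?b (\<Gamma> D ?y e e))"
  define bPG where "bPG = (\<Sum>e\<in>?E. ?b (?P (\<Gamma> D ?y e e)))"
  have "HB ?P D' k f ?y e e - HB ?P D k f ?y e e = (k * f ?y) * (dd (\<lambda>z. \<beta> D D' z e) ?y e - ?b (?P (\<Gamma> D ?y e e)))
      + (2 * k - 2) * (?b e * der D k f ?y e) + ((k\<^sup>2 - 2 * k) * f ?y) * (?b e)\<^sup>2 + (Ds + k * b2 * f ?y)"
    if e: "e \<in> ?E" for e
    unfolding HB_diff[OF D S P(1)] PTe[OF e] linear_diff[OF lb] linear_scale[OF lb] linear_diff[OF ld] linear_scale[OF ld]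
      bPs Ds_def by (simp add: power2_eq_square algebra_simps)
  then have "(\<Sum>e\<in>?E. HB ?P D' k f ?y e e - HB ?P D k f ?y e e) = (\<Sum>e\<in>?E. (k * f ?y) * (dd (\<lambda>z. \<beta> D D' z e) ?y e - ?b (?P (\<Gamma> D ?y e e)))
      + (2 * k - 2) * (?b e * der D k f ?y e) + ((k\<^sup>2 - 2 * k) * f ?y) * (?b e)\<^sup>2 + (Ds + k * b2 * f ?y))"
    by simp
  also have "\<dots> = (k * f ?y) * (db - bPG) + (2 * k - 2) * Ds + ((k\<^sup>2 - 2 * k) * f ?y) * b2 + real n * (Ds + k * b2 * f ?y)"
    unfolding sum.distrib sum_distrib_left[symmetric] sum_subtractf db_def[symmetric] bPG_def[symmetric] DPs b2_def[symmetric]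
    by (simp add: cE algebra_simps)
  finally have H: "(\<Sum>e\<in>?E. HB ?P D' k f ?y e e) = (\<Sum>e\<in>?E. HB ?P D k f ?y e e) + ((k * f ?y) * (db - bPG) + (2 * k - 2) * Ds
      + ((k\<^sup>2 - 2 * k) * f ?y) * b2 + real n * (Ds + k * b2 * f ?y))" by (simp add: sum_subtractf)
  have "Q' e e - Q e e = - (dd (\<lambda>z. \<beta> D D' z e) ?y e) + ?b (\<Gamma> D ?y e e) + (?b e)\<^sup>2 - B2 / 2" if e: "e \<in> ?E" for e
    using schouten_diff[OF D q(1) F m(1), of \<M> e] ge[OF e] unfolding Q(2) Q'(2) nabla_\<beta>_def B2_def[symmetric] by simp
  then have "(\<Sum>e\<in>?E. Q' e e - Q e e) = (\<Sum>e\<in>?E. - (dd (\<lambda>z. \<beta> D D' z e) ?y e) + ?b (\<Gamma> D ?y e e) + (?b e)\<^sup>2 - B2 / 2)" by simp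
  then have Qs: "(\<Sum>e\<in>?E. Q' e e) = (\<Sum>e\<in>?E. Q e e) + (- db + bG + b2 - real n * B2 / 2)"
    unfolding sum.distrib sum_subtractf sum_negf db_def[symmetric] bG_def[symmetric] b2_def[symmetric] by (simp add: cE)
  have n0: "real n \<noteq> 0" using n by simp
  let ?h = "Hn D ?y"
  have "Hv D' ?y = Hv D ?y + (1 / real n) *\<^sub>R (\<Sum>e\<in>?E. T D D' ?y e e)"
    unfolding Hv_def T_def by (simp add: sum_subtractf scaleR_diff_right)
  also have "(\<Sum>e\<in>?E. T D D' ?y e e) = 2 *\<^sub>R ?P s - real n *\<^sub>R s"
    using Te by (simp add: sum_subtractf Ps scaleR_sum_right cE sum_constant_scaleR del: sum_constant cong: sum.cong)
  \<comment> \<open>The term with \<open>?P s\<close> is tangential and vanishes in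
    \<open>Hn\<close>; what remains is minus the normal part of \<open>s\<close>.\<close>
  finally have Hv': "Hv D' ?y = Hv D ?y + ((2 / real n) *\<^sub>R ?P s - s)"
    using n0 by (simp add: scaleR_diff_right)
  have PP: "?P (?P s) = ?P s" by (rule P(4)[OF P(2)])
  have Hn': "Hn D' ?y = ?h - (s - ?P s)"
    unfolding Hn_def Hv' linear_add[OF P(1)] linear_diff[OF P(1)] linear_scale[OF P(1)] PP by (simp add: algebra_simps)
  have gPs: "gg ?y (?P s) s = b2" unfolding s' bPs ..
  have hP: "gg ?y ?h (?P s) = 0" using Pr_NJ[OF y(1)] P(2) unfolding Hn_def NJ_def by blast
  have gsP: "gg ?y s (?P s) = b2" unfolding s bPs ..
  have gPP: "gg ?y (?P s) (?P s) = b2" using P(3)[OF P(2), of s s] gsP by simp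
  \<comment> \<open>The cross term of the mean curvature is the discrepancy between the two
    Christoffel traces.\<close>
  have hs: "gg ?y ?h s = (bG - bPG) / real n"
  proof -
    have "gg ?y ?h s = ?b ?h" by (rule s')
    also have "\<dots> = ?b (Hv D ?y) - ?b (?P (Hv D ?y))" unfolding Hn_def linear_diff[OF lb] ..
    also have "\<dots> = (bG - bPG) / real n"
      unfolding Hv_def bG_def bPG_def
      by (simp add: linear_scale[OF P(1)] linear_sum[OF P(1)] linear_scale[OF lb] linear_sum[OF lb] diff_divide_distrib)
    finally show ?thesis .
  qed
  have HH: "gg ?y (Hn D' ?y) (Hn D' ?y) = gg ?y ?h ?h - 2 * ((bG - bPG) / real n) + (B2 - b2)"
    unfolding Hn' bilinear_lsub[OF bg] bilinear_rsub[OF bg]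
      hs hP gsP gPP gPs s[of s] bs inner_formD(2)[OF g, of s ?h] inner_formD(2)[OF g, of "?P s" ?h]
    by (simp add: diff_divide_distrib)
  have nk: "real n = 2 - 2 * k" using k by simp
  have c: "k * real n / 2 * (2 * ((bG - bPG) / real n)) = k * (bG - bPG)" using n0 by (simp add: field_simps)
  \<comment> \<open>With n = 2 - 2 k: \<open>Ds\<close> has the factor 2 k - 2 + n = 0;
    \<open>db\<close> cancels between Hessian and Schouten tensor; \<open>bG\<close> and
    \<open>bPG\<close> cancel with the help of the cross term; \<open>B2\<close> cancels between
    Schouten tensor and mean curvature; the factor of \<open>b2\<close> is k^2 - 2 k + n k + k - n k
    / 2 = 0.\<close>
  have "(\<Sum>e\<in>?E. HB ?P D' k f ?y e e) + (k * (\<Sum>e\<in>?E. Q' e e) + k * real n / 2 * gg ?y (Hn D' ?y) (Hn D' ?y)) * f ?y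
     = (\<Sum>e\<in>?E. HB ?P D k f ?y e e) + (k * (\<Sum>e\<in>?E. Q e e) + k * real n / 2 * gg ?y ?h ?h) * f ?y"
    unfolding H Qs HH right_diff_distrib[of "k * real n / 2"] distrib_left[of "k * real n / 2"] c
    unfolding nk by (simp add: field_simps power2_eq_square)
  then show ?thesis
    unfolding L_ind_coord[OF D(1) q k l Q] L_ind_coord[OF D(2) q k l Q'] f_def by simp
qed

end

section \<open>Passage from slice charts to all of \<open>N\<close>\<close>

theorem proposition4p24:
  fixes A :: "('a::{t2_space, second_countable_topology}, 'm::finite) chart set"
    and c :: "'a \<Rightarrow> real ^ 'm \<Rightarrow> real ^ 'm \<Rightarrow> real"
    and \<M> :: "('a \<Rightarrow> real) \<Rightarrow> 'a \<Rightarrow> real ^ 'm \<Rightarrow> real ^ 'm \<Rightarrow> real"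
    and n :: nat and N :: "'a set"
  assumes "smooth_structure A"
    and "conformal_structure A c"
    and "1 \<le> n" and "n < CARD('m)"
    and "submanifold A n N"
    and "CARD('m) = 2 \<Longrightarrow> moebius_structure A c \<M>"
  shows "(\<forall>D l. weyl_structure A c D \<and> smooth_secN A (1 - real n / 2) N l \<longrightarrow>
            (\<forall>p\<in>N. \<exists>B. bilinear B \<and>
               (\<forall>u\<in>tangentN A n N p. \<forall>v\<in>tangentN A n N p.
                  hess_bar A c n N D (1 - real n / 2) l p u v = B u v) \<and>
               (\<forall>X Y l'. tangent_field A n N p X \<and> tangent_field A n N p Y \<and>
                  extends_sec A (1 - real n / 2) N l p l' \<longrightarrow>
                  hess_bar_fields A c n N D (1 - real n / 2) X Y l' p = B (X p) (Y p))) \<and>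
            smooth_secN A (- 1 - real n / 2) N (L_ind A c \<M> n N D l)) \<and>
         (\<forall>D D' l. weyl_structure A c D \<and> weyl_structure A c D' \<and>
            smooth_secN A (1 - real n / 2) N l \<longrightarrow>
            (\<forall>p\<in>N. L_ind A c \<M> n N D l p = L_ind A c \<M> n N D' l p))"
proof -
  let ?k = "1 - real n / 2"
  \<comment> \<open>Dimension 1 is excluded, so the divisor m - 1 in \<open>sigma\<close> is
    nonzero.\<close>
  have m: "2 \<le> CARD('m)" using assms(3,4) by linarith
  have slice: "\<exists>U \<phi> J. slice_coordinates A U \<phi> c n N J \<and> p \<in> U" if p: "p \<in> N" for p
  proof -
    obtain U \<phi> J where s: "slice_chart A n N U \<phi> J" "p \<in> U"
      using assms(5) p unfolding submanifold_def by blast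
    then have "(U, \<phi>) \<in> A" unfolding slice_chart_def by blast
    then have "slice_coordinates A U \<phi> c n N J" by unfold_locales (use assms(1,2) s in auto)
    then show ?thesis using s by blast
  qed
  have hess: "\<exists>B. bilinear B \<and>
      (\<forall>u\<in>tangentN A n N p. \<forall>v\<in>tangentN A n N p. hess_bar A c n N D ?k l p u v = B u v) \<and>
      (\<forall>X Y l'. tangent_field A n N p X \<and> tangent_field A n N p Y \<and> extends_sec A ?k N l p l' \<longrightarrow>
        hess_bar_fields A c n N D ?k X Y l' p = B (X p) (Y p))"
    if D: "weyl_structure A c D" and l: "smooth_secN A ?k N l" and p: "p \<in> N" for D l p
  proof -
    obtain U \<phi> J where sc: "slice_coordinates A U \<phi> c n N J" and pU: "p \<in> U" using slice[OF p] by blast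
    interpret slice_coordinates A U \<phi> c n N J by (rule sc)
    obtain l0 where l0: "extends_sec A ?k N l p l0" using l p unfolding smooth_secN_def by blast
    obtain W where W: "open W" "W \<subseteq> U" "p \<in> W" "smooth_sec A ?k W l0"
      using extends_nbhd[OF l0 pU] by metis
    have y: "\<phi> p \<in> \<phi> ` U" using pU by auto
    \<comment> \<open>One extension \<open>l0\<close> fixes the bilinear form; by
      \<open>HB_extension\<close> every other extension gives the same values on tangent
      vectors.\<close>
    define h where "h = HB (Pr (\<phi> p)) D ?k (fr ?k l0) (\<phi> p)"
    have bh: "bilinear h" unfolding h_def
      by (rule bilinear_HB[OF weylD(1)[OF D] smooth_fr[OF W(4,1,2)] _ open_image[OF W(1,2)] _ Pr(1)[OF y]])
        (use W in auto)
    let ?B = "\<lambda>u v. \<rho> p powr (?k / 2) * h (d\<phi> p u) (d\<phi> p v)"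
    have "bilinear (\<lambda>u v. h (d\<phi> p u) (d\<phi> p v))"
      using bh linear_compose[OF linear_dphi[OF pU]] unfolding bilinear_def by (auto simp: o_def)
    then have "bilinear ?B" by (rule bilinear_cmult)
    moreover have "hess_bar A c n N D ?k l p u v = ?B u v" if "u \<in> tangentN A n N p" "v \<in> tangentN A n N p" for u v
      using hess_bar_coord[OF D pU p l0, of "d\<phi> p u" "d\<phi> p v"] that tangent_iff[OF pU p] pU unfolding h_def by simp
    moreover have "hess_bar_fields A c n N D ?k X Y l' p = ?B (X p) (Y p)"
      if X: "tangent_field A n N p X" and Y: "tangent_field A n N p Y" and l': "extends_sec A ?k N l p l'" for X Y l'
    proof -
      have "d\<phi> p (X p) \<in> VJ" "d\<phi> p (Y p) \<in> VJ"
        using X Y p tangent_iff[OF pU p] unfolding tangent_field_def by blast+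
      then show ?thesis unfolding h_def hess_bar_fields_coord[OF D pU p X Y l'] using HB_extension[OF D pU p l' l0] by simp
    qed
    ultimately show ?thesis by blast
  qed
  have smooth: "smooth_secN A (- 1 - real n / 2) N (L_ind A c \<M> n N D l)"
    if D: "weyl_structure A c D" and l: "smooth_secN A ?k N l" for D l
    unfolding smooth_secN_def
  proof
    fix p assume p: "p \<in> N"
    obtain U \<phi> J where sc: "slice_coordinates A U \<phi> c n N J" and pU: "p \<in> U" using slice[OF p] by blast
    obtain l0 where l0: "extends_sec A ?k N l p l0" using l p unfolding smooth_secN_def by blast
    have "?k - 2 = - 1 - real n / 2" by simp
    then show "\<exists>L. extends_sec A (- 1 - real n / 2) N (L_ind A c \<M> n N D l) p L"
      using slice_coordinates.L_ind_smooth[OF sc D m assms(6) pU p refl l0] by simp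
  qed
  have inv: "L_ind A c \<M> n N D l p = L_ind A c \<M> n N D' l p"
    if D: "weyl_structure A c D" "weyl_structure A c D'" and l: "smooth_secN A ?k N l" and p: "p \<in> N" for D D' l p
  proof -
    obtain U \<phi> J where sc: "slice_coordinates A U \<phi> c n N J" and pU: "p \<in> U" using slice[OF p] by blast
    obtain l0 where l0: "extends_sec A ?k N l p l0" using l p unfolding smooth_secN_def by blast
    show ?thesis by (rule slice_coordinates.L_ind_invariant[OF sc D m assms(6) assms(3) pU p refl l0])
  qed
  show ?thesis using hess smooth inv by blast
qed

end
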